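(* Let $r\ge1$ be an integer. There is a constant $c>0$ depending only on $r$ such that the following holds. Let $\beta>0$, $\gamma\ge0$, $\mu\ge0$, $\eta\in\mathbb{R}$, $f\in(H^1(\Lambda))'$. Let $u\in H^1(\Lambda)$ be the (weak) solution of $$-u''+\gamma u=f\ \text{ in }\Lambda,\qquad -u'(0)+\mu u(0)=\eta,\qquad \lim_{x\to+\infty}u(x)=0,$$ i.e. $\mu u(0)v(0)+(u',v')+\gamma(u,v)=(f,v)+\eta v(0)$ for all $v\in H^1(\Lambda)$, and let $u_N\in X^{\beta}_N$ be the solution of the spectral scheme $\mu u_N(0)v_N(0)+(u_N',v_N')+\gamma(u_N,v_N)=(f,v_N)+\eta v_N(0)$ for all $v_N\in X^{\beta}_N$. If $u\in H^r_{w^{r-1}}(\Lambda)$, then for all sufficiently large $N$, $$\mu|u(0)-u_N(0)|^2+\|(u-u_N)'\|^2+\gamma\|u-u_N\|^2\le c\Big(1+\frac{4\gamma}{\beta^2}\Big)(\beta N)^{1-r}\,\|u\|^2_{r,-1,\beta}$$ and, when $\gamma>0$ and $\mu>0$ (otherwise the right-hand side is understood as $+\infty$), $$\|u-u_N\|_{(1+w)^{-1}}\le c\Big(1+\frac1{\sqrt{2\mu}}\Big)\Big(1+\frac{\beta^2}{4\gamma}\Big)\Big(1+\frac{2\sqrt{\gamma}}{\beta}\Big)^2(\beta N)^{-\frac r2}\,\|u\|_{r,-1,\beta}.$$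
   Context: $\Lambda=(0,\infty)$; $(\cdot,\cdot)$ and $\|\cdot\|$ are the $L^2(\Lambda)$ inner product and norm, and $(f,v)$ also denotes the duality pairing between $(H^1(\Lambda))'$ and $H^1(\Lambda)$. $w(x)=x$, $w^{\alpha}(x)=x^{\alpha}$; for a weight $\varpi$, $\|v\|_{\varpi}^2=\int_\Lambda v^2\varpi\,dx$, so $\|v\|_{(1+w)^{-1}}^2=\int_0^\infty\frac{v(x)^2}{1+x}dx$. $H^r_{w^{r-1}}(\Lambda)=\{v:\partial_x^kv\in L^2_{w^{r-1}}(\Lambda),\ 0\le k\le r\}$. The norm is $$\|u\|_{r,-1,\beta}=\Big[\sum_{\nu=0}^{r}\binom r\nu\frac{\beta^{2r-2\nu}}{2^{2r-2\nu}}\|\partial_x^{\nu}u\|^2_{w^{r-1}}\Big]^{1/2}.$$ $X^{\beta}_N=\{e^{-\frac12\beta x}p(x):p\text{ a real polynomial of degree}\le N\}$. *)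

theory Defs
  imports "HOL-Analysis.Analysis" "HOL-Computational_Algebra.Polynomial"
begin

abbreviation half_line :: "real set" where
  "half_line \<equiv> {0<..}"

text \<open>Functions on the half-line are represented by total functions; their values at
  nonpositive arguments never matter. Members of Lebesgue and Sobolev spaces are
  representatives of their classes, and the norms, pairings, weak derivatives and traces below
  do not depend on the representative.\<close>

definition L2w :: "(real \<Rightarrow> real) \<Rightarrow> (real \<Rightarrow> real) set" where
  "L2w \<omega> = {v. v \<in> borel_measurable (lebesgue_on half_line) \<and>
               integrable (lebesgue_on half_line) (\<lambda>x. (v x)\<^sup>2 * \<omega> x)}"

definition wnorm :: "(real \<Rightarrow> real) \<Rightarrow> (real \<Rightarrow> real) \<Rightarrow> real" where
  "wnorm \<omega> v = sqrt (LINT x|lebesgue_on half_line. (v x)\<^sup>2 * \<omega> x)"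

definition ip :: "(real \<Rightarrow> real) \<Rightarrow> (real \<Rightarrow> real) \<Rightarrow> real" where
  "ip v z = (LINT x|lebesgue_on half_line. v x * z x)"

abbreviation L2norm :: "(real \<Rightarrow> real) \<Rightarrow> real" where
  "L2norm \<equiv> wnorm (\<lambda>_. 1)"

definition test_function :: "(real \<Rightarrow> real) \<Rightarrow> bool" where
  "test_function \<phi> \<longleftrightarrow>
     (\<forall>n x. (deriv ^^ n) \<phi> field_differentiable (at x)) \<and>
     (\<exists>K. compact K \<and> K \<subseteq> half_line \<and> (\<forall>x. x \<notin> K \<longrightarrow> \<phi> x = 0))"

definition locally_integrable :: "(real \<Rightarrow> real) \<Rightarrow> bool" where
  "locally_integrable v \<longleftrightarrow>
     (\<forall>K. compact K \<and> K \<subseteq> half_line \<longrightarrow> v absolutely_integrable_on K)"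

definition has_weak_deriv :: "nat \<Rightarrow> (real \<Rightarrow> real) \<Rightarrow> (real \<Rightarrow> real) \<Rightarrow> bool" where
  "has_weak_deriv k v g \<longleftrightarrow> locally_integrable v \<and> locally_integrable g \<and>
     (\<forall>\<phi>. test_function \<phi> \<longrightarrow> ip v ((deriv ^^ k) \<phi>) = (-1) ^ k * ip g \<phi>)"

text \<open>The weak derivative is unique only up to null sets; the choice of representative is
  immaterial because it is only used inside integrals.\<close>

definition weak_deriv :: "nat \<Rightarrow> (real \<Rightarrow> real) \<Rightarrow> real \<Rightarrow> real" where
  "weak_deriv k v = (SOME g. has_weak_deriv k v g)"

definition sobolev :: "nat \<Rightarrow> (real \<Rightarrow> real) \<Rightarrow> (real \<Rightarrow> real) set" where
  "sobolev r \<omega> = {v. \<forall>k\<le>r. \<exists>g\<in>L2w \<omega>. has_weak_deriv k v g}"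

abbreviation H1 :: "(real \<Rightarrow> real) set" where
  "H1 \<equiv> sobolev 1 (\<lambda>_. 1)"

definition H1norm :: "(real \<Rightarrow> real) \<Rightarrow> real" where
  "H1norm v = sqrt ((L2norm v)\<^sup>2 + (L2norm (weak_deriv 1 v))\<^sup>2)"

text \<open>Functionals are only constrained on \<^term>\<open>H1\<close>. Linearity and boundedness force equal
  values on functions that agree almost everywhere.\<close>

definition H1_dual :: "((real \<Rightarrow> real) \<Rightarrow> real) set" where
  "H1_dual = {f.
     (\<forall>v\<in>H1. \<forall>z\<in>H1. f (\<lambda>x. v x + z x) = f v + f z) \<and>
     (\<forall>a. \<forall>v\<in>H1. f (\<lambda>x. a * v x) = a * f v) \<and>
     (\<exists>C. \<forall>v\<in>H1. \<bar>f v\<bar> \<le> C * H1norm v)}"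

text \<open>Point values of \<^term>\<open>H1\<close> functions, at the origin and at infinity, are those of the
  representative that is continuous on the closed half-line.\<close>

definition continuous_rep :: "(real \<Rightarrow> real) \<Rightarrow> (real \<Rightarrow> real) \<Rightarrow> bool" where
  "continuous_rep v h \<longleftrightarrow>
     continuous_on {0..} h \<and> (AE x in lebesgue_on half_line. v x = h x)"

definition trace0 :: "(real \<Rightarrow> real) \<Rightarrow> real" where
  "trace0 v = (THE c. \<exists>h. continuous_rep v h \<and> h 0 = c)"

definition vanishes_at_infinity :: "(real \<Rightarrow> real) \<Rightarrow> bool" where
  "vanishes_at_infinity v \<longleftrightarrow> (\<exists>h. continuous_rep v h \<and> (h \<longlongrightarrow> 0) at_top)"

definition bilinear_form ::
    "real \<Rightarrow> real \<Rightarrow> (real \<Rightarrow> real) \<Rightarrow> (real \<Rightarrow> real) \<Rightarrow> real" where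
  "bilinear_form \<gamma> \<mu> u v =
     \<mu> * trace0 u * trace0 v + ip (weak_deriv 1 u) (weak_deriv 1 v) + \<gamma> * ip u v"

text \<open>The limit condition is implied by membership in \<^term>\<open>H1\<close>; it is kept because it is part
  of the boundary value problem.\<close>

definition weak_solution ::
    "real \<Rightarrow> real \<Rightarrow> real \<Rightarrow> ((real \<Rightarrow> real) \<Rightarrow> real) \<Rightarrow> (real \<Rightarrow> real) \<Rightarrow> bool" where
  "weak_solution \<gamma> \<mu> \<eta> f u \<longleftrightarrow>
     u \<in> H1 \<and> vanishes_at_infinity u \<and>
     (\<forall>v\<in>H1. bilinear_form \<gamma> \<mu> u v = f v + \<eta> * trace0 v)"

definition X_space :: "real \<Rightarrow> nat \<Rightarrow> (real \<Rightarrow> real) set" where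
  "X_space \<beta> N = {\<lambda>x. exp (- (\<beta> * x / 2)) * poly p x | p :: real poly. degree p \<le> N}"

definition spectral_solution ::
    "real \<Rightarrow> nat \<Rightarrow> real \<Rightarrow> real \<Rightarrow> real \<Rightarrow> ((real \<Rightarrow> real) \<Rightarrow> real) \<Rightarrow> (real \<Rightarrow> real) \<Rightarrow> bool" where
  "spectral_solution \<beta> N \<gamma> \<mu> \<eta> f uN \<longleftrightarrow>
     uN \<in> X_space \<beta> N \<and>
     (\<forall>v\<in>X_space \<beta> N. bilinear_form \<gamma> \<mu> uN v = f v + \<eta> * trace0 v)"

definition beta_norm :: "nat \<Rightarrow> real \<Rightarrow> (real \<Rightarrow> real) \<Rightarrow> real" where
  "beta_norm r \<beta> u =
     sqrt (\<Sum>\<nu>=0..r. real (r choose \<nu>) * (\<beta> ^ (2*r - 2*\<nu>) / 2 ^ (2*r - 2*\<nu>)) *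
                      (wnorm (\<lambda>x. x ^ (r - 1)) (weak_deriv \<nu> u))\<^sup>2)"

end

theory Submission
  imports Defs "HOL-Real_Asymp.Real_Asymp"
begin

text \<open>
Both estimates rest on one approximation result. Put U(x) = e^(\<beta>x/2) u(x) and compare u with
e^(-\<beta>x/2) P(x), where P is a polynomial of degree at most N with P(0) = U(0). The difference e
vanishes at 0, so the integral of e e' is zero and
  \<parallel>e'\<parallel>^2 + (\<beta>/2)^2 \<parallel>e\<parallel>^2 = \<parallel>e' + (\<beta>/2) e\<parallel>^2 = \<integral> (U' - P')^2 e^(-\<beta>x) dx.
Now P' is an arbitrary polynomial of degree less than N. The best choice is the truncated Laguerre
expansion of U', and the error is the tail of the squared coefficients. By the Rodrigues formula
L_n e^(-\<beta>x) = (d/dx)^n (x^n e^(-\<beta>x) / n!), r - 1 integrations by parts express these coefficients by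
(d/dx)^r U and polynomials that are orthogonal for the weight x^(r-1) e^(-\<beta>x) and have squared norms
of order n^(1-r). Bessel's inequality bounds the tail by a multiple of (\<beta>N)^(1-r) times the weighted
square integral of (d/dx)^r U = e^(\<beta>x/2) (d/dx + \<beta>/2)^r u, which \<open>beta_norm\<close> controls. This is
\<open>approximation_in_X_space\<close>. It needs the completeness of the Laguerre functions
(\<open>poly_approximable_continuous\<close>): for e^(-sx) Parseval's identity is a geometric series, and every
square integrable continuous function is reached by Weierstrass approximation in the variable e^(-x).

The first estimate follows from Galerkin orthogonality (\<open>Galerkin_optimality\<close>): the spectral solution
is the best approximation in energy, and the comparison function has the exact trace, so only
\<gamma> has to be compared with \<beta>^2/4.

The second estimate is a duality argument. The problem -z'' + \<gamma> z = e / (1 + x) with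
-z'(0) + \<mu> z(0) = 0, where e is now the error of the scheme, has an explicit solution. Testing it with z
and with x z bounds the norm of z with r = 2 by the weighted norm of e (\<open>dual_problem\<close>). Since the
squared weighted norm of e is the energy product of z and e, z may be replaced by its approximation
error, which gains a factor (\<beta>N)^(-1/2) over the energy estimate.

Weak derivatives are made concrete by the lemma of du Bois-Reymond (\<open>weak_deriv_imp_primitive\<close>): it
turns a Sobolev function into a chain of functions each of which is an indefinite integral of the next.
\<close>

section \<open>Indefinite integrals on the half-line\<close>

abbreviation HL :: "real measure" where "HL \<equiv> lebesgue_on half_line"

text \<open>Locally absolutely continuous functions on the open half-line, together with a derivative. Nothing
is required at 0 or at infinity, and g may be changed on a null set.\<close>

definition primitive :: "(real \<Rightarrow> real) \<Rightarrow> (real \<Rightarrow> real) \<Rightarrow> bool" where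
  "primitive G g \<longleftrightarrow> (\<forall>a b. 0 < a \<longrightarrow> a \<le> b \<longrightarrow>
     g absolutely_integrable_on {a..b} \<and> G b - G a = integral {a..b} g)"

lemma primitiveD:
  assumes "primitive G g" "0 < a" "a \<le> b"
  shows "g absolutely_integrable_on {a..b}" "g integrable_on {a..b}" "G b - G a = integral {a..b} g"
  using assms unfolding primitive_def by (auto simp: absolutely_integrable_on_def)

lemma integrable_HL_iff: "integrable HL f \<longleftrightarrow> set_integrable lebesgue half_line f"
  for f :: "real \<Rightarrow> real"
  by (simp add: integrable_restrict_space set_integrable_def)

lemma primitive_continuous_Icc:
  assumes "primitive G g" "0 < a"
  shows "continuous_on {a..b} G"
proof -
  have c: "continuous_on {a..b} (\<lambda>x. G a + integral {a..x} g)" if "a \<le> b"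
    using primitiveD(2)[OF assms that] by (intro continuous_intros indefinite_integral_continuous_1)
  have e: "G a + integral {a..x} g = G x" if "x \<in> {a..b}" for x
    using primitiveD(3)[OF assms, of x] that by simp
  show ?thesis
  proof (cases "a \<le> b")
    case True
    show ?thesis by (rule continuous_on_eq[OF c[OF True] e])
  qed simp
qed

lemma primitive_continuous:
  assumes "primitive G g"
  shows "continuous_on half_line G"
proof -
  have "isCont G x" if "x > 0" for x
  proof -
    have "continuous_on {x/2<..<x+1} G"
      by (rule continuous_on_subset[OF primitive_continuous_Icc[OF assms, of "x/2" "x+1"]]) (use that in auto)
    then show ?thesis using that
      by (subst (asm) continuous_on_eq_continuous_at) auto
  qed
  then show ?thesis by (auto intro: continuous_at_imp_continuous_on)
qed

lemma half_line_exhaustion: "half_line = (\<Union>n::nat. {1 / real (Suc n)..real (Suc n)})"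
proof -
  have "\<exists>n. 1 / real (Suc n) \<le> x \<and> x \<le> real (Suc n)" if "x > 0" for x
  proof -
    obtain n where n: "real n \<ge> max x (1/x)" using real_arch_simple by blast
    have "1 / real (Suc n) \<le> x"
      using n that by (simp add: field_simps)
    with n show ?thesis by (intro exI[of _ n]) auto
  qed
  moreover have "x > 0" if "1 / real (Suc n) \<le> x" for x n
    using that by (meson less_le_trans of_nat_0_less_iff zero_less_Suc zero_less_divide_1_iff)
  ultimately show ?thesis by auto
qed

text \<open>Measurability holds on compact intervals, and countably many of them exhaust the half-line.\<close>

lemma primitive_measurable:
  assumes "primitive G g"
  shows "g \<in> borel_measurable HL"
proof -
  have *: "g \<in> borel_measurable (lebesgue_on {1 / real (Suc n)..real (Suc n)})" for n
  proof (rule absolutely_integrable_imp_borel_measurable)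
    have "1 / real (Suc n) \<le> real (Suc n)" by (simp add: divide_le_eq mult_ge1_I)
    then show "g absolutely_integrable_on {1 / real (Suc n)..real (Suc n)}"
      by (intro primitiveD(1)[OF assms]) auto
  qed auto
  show ?thesis
  proof (rule measurable_piecewise_restrict[where C="range (\<lambda>n::nat. {1 / real (Suc n)..real (Suc n)})"])
    show "space HL \<subseteq> \<Union> (range (\<lambda>n::nat. {1 / real (Suc n)..real (Suc n)}))"
      using half_line_exhaustion by simp
    fix S assume "S \<in> range (\<lambda>n::nat. {1 / real (Suc n)..real (Suc n)})"
    then obtain n where n: "S = {1 / real (Suc n)..real (Suc n)}" by auto
    have sub: "S \<subseteq> half_line" using half_line_exhaustion n by blast
    show "S \<inter> space HL \<in> sets HL" using sub by (auto simp: n sets_restrict_space)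
    have "restrict_space HL S = lebesgue_on S"
      using sub n by (subst restrict_restrict_space) (auto simp: Int_absorb1 simp del: of_nat_Suc)
    then show "g \<in> borel_measurable (restrict_space HL S)" using *[of n] n by simp
  qed auto
qed

lemma continuous_HL_measurable: "continuous_on half_line f \<Longrightarrow> f \<in> borel_measurable HL"
  for f :: "real \<Rightarrow> real"
  by (rule continuous_imp_measurable_on_sets_lebesgue) auto

lemma primitive_cong:
  assumes "primitive G g" "\<And>x. x > 0 \<Longrightarrow> G' x = G x" "\<And>x. x > 0 \<Longrightarrow> g' x = g x"
  shows "primitive G' g'"
proof -
  have "g' absolutely_integrable_on {a..b} \<longleftrightarrow> g absolutely_integrable_on {a..b}" if "a > 0" for a b
    by (rule set_integrable_cong) (use assms(3) that in auto)
  moreover have "integral {a..b} g' = integral {a..b} g" if "a > 0" for a b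
    using assms(3) that by (intro integral_cong) auto
  ultimately show ?thesis using assms unfolding primitive_def by auto
qed

lemma AE_HL_iff: "(AE x in HL. P x) \<longleftrightarrow> (AE x in lebesgue. x > 0 \<longrightarrow> P x)"
  by (simp add: AE_restrict_space_iff)

lemma primitive_cong_AE:
  assumes "primitive G g" "AE x in HL. g x = g' x"
  shows "primitive G g'"
  unfolding primitive_def
proof (intro allI impI)
  fix a b :: real assume ab: "0 < a" "a \<le> b"
  have "AE x in lebesgue. x > 0 \<longrightarrow> g x = g' x" using assms(2) by (simp only: AE_HL_iff)
  then obtain N where N: "N \<in> null_sets lebesgue" "{x. \<not> (x > 0 \<longrightarrow> g x = g' x)} \<subseteq> N"
    unfolding eventually_ae_filter by auto
  then have neg: "negligible N" by (simp add: negligible_iff_null_sets)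
  have eq: "g' x = g x" if "x \<in> {a..b} - N" for x
  proof -
    have "x \<notin> {x. \<not> (x > 0 \<longrightarrow> g x = g' x)}" using N(2) that by blast
    then show ?thesis using ab that by auto
  qed
  have "integral {a..b} g = integral {a..b} g'"
    by (rule integral_spike[OF neg]) (rule eq)
  then show "g' absolutely_integrable_on {a..b} \<and> G b - G a = integral {a..b} g'"
    using absolutely_integrable_spike[OF primitiveD(1)[OF assms(1) ab] neg eq]
      primitiveD(3)[OF assms(1) ab] by auto
qed

lemma primitive_add:
  assumes "primitive F f" "primitive G g"
  shows "primitive (\<lambda>x. F x + G x) (\<lambda>x. f x + g x)"
  unfolding primitive_def
proof (intro allI impI)
  fix a b :: real assume ab: "0 < a" "a \<le> b"
  note 1 = primitiveD[OF assms(1) ab] and 2 = primitiveD[OF assms(2) ab]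
  show "(\<lambda>x. f x + g x) absolutely_integrable_on {a..b} \<and> 
     F b + G b - (F a + G a) = integral {a..b} (\<lambda>x. f x + g x)"
    using 1 2 by (auto simp: integral_add intro: set_integral_add)
qed

lemma primitive_cmult:
  assumes "primitive F f"
  shows "primitive (\<lambda>x. c * F x) (\<lambda>x. c * f x)"
  unfolding primitive_def
  using primitiveD[OF assms] by (auto simp flip: right_diff_distrib)

lemma primitive_diff:
  assumes "primitive F f" "primitive G g"
  shows "primitive (\<lambda>x. F x - G x) (\<lambda>x. f x - g x)"
  using primitive_add[OF assms(1) primitive_cmult[OF assms(2), of "-1"]] by simp

lemma primitive_zero: "primitive (\<lambda>x. c) (\<lambda>x. 0)"
  by (simp add: primitive_def)

lemma primitive_C1:
  assumes "\<And>x. x > 0 \<Longrightarrow> (G has_real_derivative g x) (at x)" "continuous_on half_line g"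
  shows "primitive G g"
  unfolding primitive_def
proof (intro allI impI conjI)
  fix a b :: real assume ab: "0 < a" "a \<le> b"
  show "g absolutely_integrable_on {a..b}"
    by (rule absolutely_integrable_continuous_real) (use ab assms(2) in \<open>auto elim: continuous_on_subset\<close>)
  have "(g has_integral (G b - G a)) {a..b}"
    by (rule fundamental_theorem_of_calculus[OF ab(2)])
       (use ab assms(1) in \<open>auto simp flip: has_real_derivative_iff_has_vector_derivative intro: has_field_derivative_at_within\<close>)
  then show "G b - G a = integral {a..b} g" by (simp add: integral_unique)
qed

lemma continuous_mult_absolutely_integrable:
  fixes f g :: "real \<Rightarrow> real"
  assumes "g absolutely_integrable_on {a..b}" "continuous_on {a..b} f"
  shows "(\<lambda>x. f x * g x) absolutely_integrable_on {a..b}"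
  using assms
  by (intro absolutely_integrable_bounded_measurable_product_real)
     (auto intro: continuous_imp_measurable_on_sets_lebesgue compact_imp_bounded compact_continuous_image)

text \<open>The derivatives exist only almost everywhere, so the product rule cannot be integrated pointwise.
Instead, the defect of the integrated rule is additive over intervals, and on short intervals it
is at most e times the integral of \<open>\<bar>f\<bar> + \<bar>g\<bar>\<close>, because F and G
are continuous. Bisection carries the bound over to long intervals, for every e.\<close>

lemma primitive_mult:
  assumes F: "primitive F f" and G: "primitive G g"
  shows "primitive (\<lambda>x. F x * G x) (\<lambda>x. f x * G x + F x * g x)"
  unfolding primitive_def
proof (intro allI impI conjI)
  fix a b :: real assume ab: "0 < a" "a \<le> b"
  define k where "k x = f x * G x + F x * g x" for x
  have ai: "(\<lambda>x. f x * c) absolutely_integrable_on {s..t}" "(\<lambda>x. c * g x) absolutely_integrable_on {s..t}"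
    "(\<lambda>x. f x * G x) absolutely_integrable_on {s..t}" "(\<lambda>x. F x * g x) absolutely_integrable_on {s..t}"
    if "0 < s" "s \<le> t" for s t c
    using primitiveD(1)[OF F that] primitiveD(1)[OF G that]
     continuous_mult_absolutely_integrable[OF primitiveD(1)[OF F that] primitive_continuous_Icc[OF G that(1)]]
     continuous_mult_absolutely_integrable[OF primitiveD(1)[OF G that] primitive_continuous_Icc[OF F that(1)]]
    by (auto simp: mult.commute)
  have kai: "k absolutely_integrable_on {s..t}" if "0 < s" "s \<le> t" for s t
    unfolding k_def using ai[OF that] by (intro set_integral_add)
  show "(\<lambda>x. f x * G x + F x * g x) absolutely_integrable_on {a..b}"
    using kai[OF ab] by (simp add: k_def[abs_def])
  define m where "m x = \<bar>f x\<bar> + \<bar>g x\<bar>" for x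
  have mai: "m absolutely_integrable_on {s..t}" if "0 < s" "s \<le> t" for s t
    unfolding m_def using primitiveD(1)[OF F that] primitiveD(1)[OF G that]
    by (intro set_integral_add set_integrable_abs)
  define D where "D s t = F t * G t - F s * G s - integral {s..t} k" for s t
  have main: "\<bar>D a b\<bar> \<le> e * integral {a..b} m" if e: "e > 0" for e
  proof -
    have "a \<le> a \<longrightarrow> b \<le> b \<longrightarrow> \<bar>D a b\<bar> \<le> e * integral {a..b} m"
    proof (rule Bolzano[OF ab(2), where P="\<lambda>s t. a \<le> s \<longrightarrow> t \<le> b \<longrightarrow> \<bar>D s t\<bar> \<le> e * integral {s..t} m"])
      fix s c t :: real
      assume 1: "a \<le> s \<longrightarrow> c \<le> b \<longrightarrow> \<bar>D s c\<bar> \<le> e * integral {s..c} m"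
        and 2: "a \<le> c \<longrightarrow> t \<le> b \<longrightarrow> \<bar>D c t\<bar> \<le> e * integral {c..t} m" and o: "s \<le> c" "c \<le> t"
      show "a \<le> s \<longrightarrow> t \<le> b \<longrightarrow> \<bar>D s t\<bar> \<le> e * integral {s..t} m"
      proof (intro impI)
        assume as: "a \<le> s" "t \<le> b"
        have s: "0 < s" "s \<le> t" using as ab o by auto
        have i: "integral {s..c} q + integral {c..t} q = integral {s..t} q"
          if "q absolutely_integrable_on {s..t}" for q :: "real \<Rightarrow> real"
          by (rule Henstock_Kurzweil_Integration.integral_combine[OF o]) (use that in \<open>auto simp: absolutely_integrable_on_def\<close>)
        have "D s t = D s c + D c t" using i[OF kai[OF s]] by (simp add: D_def)
        moreover have "\<bar>D s c\<bar> \<le> e * integral {s..c} m" "\<bar>D c t\<bar> \<le> e * integral {c..t} m"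
          using 1 2 as o by auto
        ultimately show "\<bar>D s t\<bar> \<le> e * integral {s..t} m"
          using i[OF mai[OF s], symmetric] by (auto simp: distrib_left)
      qed
    next
      fix x assume x: "a \<le> x" "x \<le> b"
      then have "x > 0" using ab by auto
      then have "isCont F x" "isCont G x"
        using primitive_continuous[OF F] primitive_continuous[OF G]
        by (auto simp: continuous_on_eq_continuous_at)
      then obtain d1 d2 where d: "d1 > 0" "\<And>y. \<bar>y - x\<bar> < d1 \<Longrightarrow> \<bar>F y - F x\<bar> < e/2"
          "d2 > 0" "\<And>y. \<bar>y - x\<bar> < d2 \<Longrightarrow> \<bar>G y - G x\<bar> < e/2"
        using e unfolding continuous_at_eps_delta dist_real_def by (metis half_gt_zero)
      show "\<exists>d>0. \<forall>s t. s \<le> x \<and> x \<le> t \<and> t - s < d \<longrightarrow> a \<le> s \<longrightarrow> t \<le> b \<longrightarrow> \<bar>D s t\<bar> \<le> e * integral {s..t} m"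
      proof (intro exI[of _ "min d1 d2"] conjI allI impI)
        fix s t assume st: "s \<le> x \<and> x \<le> t \<and> t - s < min d1 d2" "a \<le> s" "t \<le> b"
        have s: "0 < s" "s \<le> t" using st ab by auto
        have near: "\<bar>F y - F t\<bar> \<le> e" "\<bar>G y - G s\<bar> \<le> e" if "y \<in> {s..t}" for y
        proof -
          have "\<bar>y - x\<bar> < d1" "\<bar>y - x\<bar> < d2" "\<bar>t - x\<bar> < d1" "\<bar>s - x\<bar> < d2" using st that by auto
          then show "\<bar>F y - F t\<bar> \<le> e" "\<bar>G y - G s\<bar> \<le> e" using d(2)[of y] d(2)[of t] d(4)[of y] d(4)[of s] by linarith+
        qed
        have int: "(\<lambda>x. f x * G s + F t * g x) absolutely_integrable_on {s..t}"
          using ai[OF s] by (intro set_integral_add)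
        have "F t * G t - F s * G s = (F t - F s) * G s + F t * (G t - G s)" by (simp add: algebra_simps)
        also have "\<dots> = integral {s..t} (\<lambda>x. f x * G s + F t * g x)"
          using primitiveD[OF F s] primitiveD[OF G s]
          by (subst Henstock_Kurzweil_Integration.integral_add) (auto intro: integrable_on_mult_left integrable_on_mult_right)
        finally have "D s t = integral {s..t} (\<lambda>x. (f x * G s + F t * g x) - k x)"
          using int kai[OF s] by (simp add: D_def Henstock_Kurzweil_Integration.integral_diff absolutely_integrable_on_def)
        also have "\<bar>\<dots>\<bar> \<le> integral {s..t} (\<lambda>x. e * m x)"
        proof -
          have "norm (integral {s..t} (\<lambda>x. (f x * G s + F t * g x) - k x)) \<le> integral {s..t} (\<lambda>x. e * m x)"
          proof (rule integral_norm_bound_integral)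
            show "(\<lambda>x. (f x * G s + F t * g x) - k x) integrable_on {s..t}"
              using int kai[OF s] by (intro integrable_diff) (auto simp: absolutely_integrable_on_def)
            show "(\<lambda>x. e * m x) integrable_on {s..t}"
              using mai[OF s] by (intro integrable_on_mult_right) (auto simp: absolutely_integrable_on_def)
            fix y assume y: "y \<in> {s..t}"
            have "(f y * G s + F t * g y) - k y = - (f y * (G y - G s)) - (F y - F t) * g y"
              by (simp add: k_def algebra_simps)
            also have "\<bar>\<dots>\<bar> \<le> \<bar>f y\<bar> * \<bar>G y - G s\<bar> + \<bar>F y - F t\<bar> * \<bar>g y\<bar>"
              by (metis abs_minus_cancel abs_mult abs_triangle_ineq4)
            also have "\<dots> \<le> \<bar>f y\<bar> * e + e * \<bar>g y\<bar>"
              using near[OF y] by (intro add_mono mult_left_mono mult_right_mono) auto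
            finally show "norm ((f y * G s + F t * g y) - k y) \<le> e * m y"
              by (simp add: m_def algebra_simps)
          qed
          then show ?thesis by simp
        qed
        finally show "\<bar>D s t\<bar> \<le> e * integral {s..t} m" by simp
      qed (use d in auto)
    qed
    then show ?thesis by simp
  qed
  have "D a b = 0"
  proof (rule ccontr)
    assume nz: "D a b \<noteq> 0"
    define I where "I = integral {a..b} m"
    have I: "I \<ge> 0" unfolding I_def by (rule integral_nonneg) (use mai[OF ab] in \<open>auto simp: absolutely_integrable_on_def m_def\<close>)
    have "\<bar>D a b\<bar> \<le> (\<bar>D a b\<bar> / (2 * (I + 1))) * I"
      using main[of "\<bar>D a b\<bar> / (2 * (I + 1))"] nz I by (auto simp: I_def)
    also have "\<dots> \<le> \<bar>D a b\<bar> / 2" using I by (simp add: field_simps)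
    finally show False using nz by auto
  qed
  then show "F b * G b - F a * G a = integral {a..b} (\<lambda>x. f x * G x + F x * g x)"
    by (simp add: D_def k_def[abs_def])
qed

lemma integral_HL_Icc:
  fixes f :: "real \<Rightarrow> real"
  assumes "0 < a" "f absolutely_integrable_on {a..b}"
  shows "(LINT x|HL. indicator {a..b} x * f x) = integral {a..b} f"
proof -
  have "(LINT x|HL. indicator {a..b} x * f x) = (LINT x|lebesgue. indicator {a..b} x * f x)"
    using assms by (subst integral_restrict_space) (auto intro!: Bochner_Integration.integral_cong simp: indicator_def)
  also have "\<dots> = integral {a..b} f"
    using set_lebesgue_integral_eq_integral(2)[OF assms(2)] by (simp add: set_lebesgue_integral_def)
  finally show ?thesis .
qed

lemma eventually_in_exhaustion:
  assumes "x > 0"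
  shows "\<forall>\<^sub>F n in sequentially. x \<in> {1 / real (Suc n)..real (Suc n)}"
proof -
  have "\<forall>\<^sub>F n in sequentially. 1 / real (Suc n) < x" 
    by (rule order_tendstoD[OF _ assms]) real_asymp
  moreover have "\<forall>\<^sub>F n in sequentially. real (Suc n) \<ge> x" by real_asymp
  ultimately show ?thesis by eventually_elim auto
qed

lemma primitive_integral_exhaustion:
  assumes "primitive G g"
  shows "(LINT x|HL. indicator {1 / real (Suc n)..real (Suc n)} x * g x) = G (real (Suc n)) - G (1 / real (Suc n))"
proof -
  have *: "0 < 1 / real (Suc n)" "1 / real (Suc n) \<le> real (Suc n)" by (auto simp: divide_le_eq mult_ge1_I)
  show ?thesis using integral_HL_Icc[OF *(1) primitiveD(1)[OF assms *]] primitiveD(3)[OF assms *] by simp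
qed

lemma integral_HL_exhaustion_limit:
  fixes g :: "real \<Rightarrow> real"
  assumes g: "integrable HL g"
  shows "(\<lambda>n. LINT x|HL. indicator {1 / real (Suc n)..real (Suc n)} x * g x) \<longlonglongrightarrow> (LINT x|HL. g x)"
proof (rule integral_dominated_convergence[where w="\<lambda>x. \<bar>g x\<bar>"])
  show "AE x in HL. (\<lambda>n. indicator {1 / real (Suc n)..real (Suc n)} x * g x) \<longlonglongrightarrow> g x"
  proof (rule AE_I2)
    fix x assume "x \<in> space HL"
    then have "\<forall>\<^sub>F n in sequentially. x \<in> {1 / real (Suc n)..real (Suc n)}" using eventually_in_exhaustion[of x] by simp
    then have "\<forall>\<^sub>F n in sequentially. indicator {1 / real (Suc n)..real (Suc n)} x * g x = g x" by eventually_elim simp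
    then show "(\<lambda>n. indicator {1 / real (Suc n)..real (Suc n)} x * g x) \<longlonglongrightarrow> g x" by (rule tendsto_eventually)
  qed
  show "(\<lambda>x. indicator {1 / real (Suc n)..real (Suc n)} x * g x) \<in> borel_measurable HL" for n
    using g by (intro borel_measurable_times measurable_restrict_space1[OF borel_measurable_indicator]) auto
qed (use g in \<open>auto simp: indicator_def\<close>)

text \<open>Every later integration by parts on the half-line is this fact applied to a product; the boundary
terms appear as one-sided limits.\<close>

lemma integral_HL_primitive:
  assumes G: "primitive G g" and g: "integrable HL g"
    and A: "(G \<longlongrightarrow> A) (at_right 0)" and B: "(G \<longlongrightarrow> B) at_top"
  shows "(LINT x|HL. g x) = B - A"
proof -
  have "(\<lambda>n. G (real (Suc n)) - G (1 / real (Suc n))) \<longlonglongrightarrow> (LINT x|HL. g x)"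
    using integral_HL_exhaustion_limit[OF g] unfolding primitive_integral_exhaustion[OF G] .
  moreover have "(\<lambda>n. G (real (Suc n)) - G (1 / real (Suc n))) \<longlonglongrightarrow> B - A"
  proof (intro tendsto_diff)
    have "filterlim (\<lambda>n. real (Suc n)) at_top sequentially" by real_asymp
    then show "(\<lambda>n. G (real (Suc n))) \<longlonglongrightarrow> B" using B by (rule filterlim_compose[rotated])
    have "filterlim (\<lambda>n. 1 / real (Suc n)) (at_right 0) sequentially" by real_asymp
    then show "(\<lambda>n. G (1 / real (Suc n))) \<longlonglongrightarrow> A" using A by (rule filterlim_compose[rotated])
  qed
  ultimately show ?thesis by (rule LIMSEQ_unique)
qed

text \<open>Monotone convergence: a nonnegative derivative of a bounded function is integrable. All concrete
majorants below are shown to be integrable in this way.\<close>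

lemma integrable_HL_primitive:
  assumes G: "primitive G g" and nn: "\<And>x. x > 0 \<Longrightarrow> g x \<ge> 0" and bd: "\<And>x. x > 0 \<Longrightarrow> \<bar>G x\<bar> \<le> C"
  shows "integrable HL g"
proof -
  define I where "I n = {1 / real (Suc n)..real (Suc n)}" for n
  have *: "0 < 1 / real (Suc n)" "1 / real (Suc n) \<le> real (Suc n)" for n by (auto simp: divide_le_eq mult_ge1_I)
  define J where "J n = (LINT x|HL. indicator (I n) x * g x)" for n
  have Jeq: "J n = G (real (Suc n)) - G (1 / real (Suc n))" for n
    unfolding I_def J_def by (rule primitive_integral_exhaustion[OF G])
  have int: "integrable HL (\<lambda>x. indicator (I n) x * g x)" for n
  proof -
    have "integrable lebesgue (\<lambda>x. indicator (I n) x * g x)"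
      using primitiveD(1)[OF G *[of n]] by (simp add: set_integrable_def I_def)
    from integrable_mult_indicator[OF _ this, of half_line]
    show ?thesis by (subst integrable_restrict_space) auto
  qed
  have sub: "I m \<subseteq> I n" if "m \<le> n" for m n
    using that by (auto simp: I_def frac_le intro: order_trans[OF frac_le[of 1 1 "real (Suc m)" "real (Suc n)"]])
  have mono: "mono (\<lambda>n. indicator (I n) x * g x)" if "x > 0" for x
    using sub nn[OF that] by (intro monoI mult_right_mono) (auto simp: indicator_def)
  have "mono J" unfolding J_def
  proof (intro monoI integral_mono_AE int AE_I2)
    fix m n :: nat and x assume "m \<le> n" "x \<in> space HL"
    then show "indicator (I m) x * g x \<le> indicator (I n) x * g x" using mono[of x] by (auto dest: monoD)
  qed
  moreover have "bdd_above (range J)"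
  proof (rule bdd_aboveI2[of _ _ "2 * C"])
    fix n
    have "\<bar>G (real (Suc n))\<bar> \<le> C" by (rule bd) simp
    moreover have "\<bar>G (1 / real (Suc n))\<bar> \<le> C" by (rule bd[OF *(1)])
    ultimately show "J n \<le> 2 * C" unfolding Jeq by linarith
  qed
  ultimately have Jlim: "J \<longlonglongrightarrow> (SUP n. J n)" by (intro LIMSEQ_incseq_SUP)
  show ?thesis
  proof (rule integrable_monotone_convergence[where f="\<lambda>n x. indicator (I n) x * g x", OF int])
    show "AE x in HL. mono (\<lambda>n. indicator (I n) x * g x)" by (rule AE_I2) (simp add: mono)
    show "AE x in HL. (\<lambda>n. indicator (I n) x * g x) \<longlonglongrightarrow> g x"
    proof (rule AE_I2)
      fix x assume "x \<in> space HL"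
      then have "\<forall>\<^sub>F n in sequentially. x \<in> I n" using eventually_in_exhaustion[of x] by (simp add: I_def)
      then have "\<forall>\<^sub>F n in sequentially. indicator (I n) x * g x = g x" by eventually_elim simp
      then show "(\<lambda>n. indicator (I n) x * g x) \<longlonglongrightarrow> g x" by (rule tendsto_eventually)
    qed
    show "(\<lambda>n. LINT x|HL. indicator (I n) x * g x) \<longlonglongrightarrow> (SUP n. J n)"
      using Jlim by (simp add: J_def[abs_def])
  qed (rule primitive_measurable[OF G])
qed

lemma primitive_comparison:
  assumes "primitive G g" "primitive F f" "0 < s" "s \<le> t" "\<And>y. y \<in> {s..t} \<Longrightarrow> \<bar>g y\<bar> \<le> f y"
  shows "\<bar>G t - G s\<bar> \<le> F t - F s"
proof -
  have "norm (integral {s..t} g) \<le> integral {s..t} f"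
    by (rule integral_norm_bound_integral) (use primitiveD(2)[OF assms(1,3,4)] primitiveD(2)[OF assms(2,3,4)] assms(5) in auto)
  then show ?thesis using primitiveD(3)[OF assms(1,3,4)] primitiveD(3)[OF assms(2,3,4)] by simp
qed

lemma primitive_bounded:
  assumes A: "primitive A f" and f: "integrable HL f"
  obtains C where "\<And>x. x > 0 \<Longrightarrow> \<bar>A x\<bar> \<le> C"
proof -
  have d: "\<bar>A t - A s\<bar> \<le> (LINT x|HL. \<bar>f x\<bar>)" if "0 < s" "s \<le> t" for s t
  proof -
    have "A t - A s = (LINT x|HL. indicator {s..t} x * f x)"
      using primitiveD[OF A that] integral_HL_Icc[OF that(1)] by simp
    also have "\<bar>\<dots>\<bar> \<le> (LINT x|HL. \<bar>f x\<bar>)"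
    proof -
      have "norm (LINT x|HL. indicator {s..t} x * f x) \<le> (LINT x|HL. norm (indicator {s..t} x * f x))"
        by (rule integral_norm_bound)
      also have "\<dots> \<le> (LINT x|HL. \<bar>f x\<bar>)"
        by (rule integral_mono_AE') (use f in \<open>auto intro!: AE_I2 simp: indicator_def\<close>)
      finally show ?thesis by simp
    qed
    finally show ?thesis .
  qed
  show ?thesis
  proof (rule that[of "\<bar>A 1\<bar> + (LINT x|HL. \<bar>f x\<bar>)"])
    fix x :: real assume "x > 0"
    then show "\<bar>A x\<bar> \<le> \<bar>A 1\<bar> + (LINT x|HL. \<bar>f x\<bar>)"
      using d[of x 1] d[of 1 x] by (cases "x \<le> 1") auto
  qed
qed

section \<open>Smooth functions with compact support\<close>

abbreviation smooth :: "(real \<Rightarrow> real) \<Rightarrow> bool" where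
  "smooth f \<equiv> \<forall>n x. (deriv ^^ n) f field_differentiable (at x)"

text \<open>Smoothness is treated one order at a time, since closure under products follows by induction on
the order.\<close>

primrec times_differentiable :: "nat \<Rightarrow> (real \<Rightarrow> real) \<Rightarrow> bool" where
  "times_differentiable 0 f \<longleftrightarrow> True"
| "times_differentiable (Suc n) f \<longleftrightarrow> (\<forall>x. f field_differentiable (at x)) \<and> times_differentiable n (deriv f)"

lemma times_differentiable_iff:
  "times_differentiable n f \<longleftrightarrow> (\<forall>m<n. \<forall>x. (deriv ^^ m) f field_differentiable (at x))"
proof (induction n arbitrary: f)
  case (Suc n)
  have "(\<forall>m<Suc n. \<forall>x. (deriv ^^ m) f field_differentiable (at x)) \<longleftrightarrow>
     (\<forall>x. f field_differentiable (at x)) \<and> (\<forall>m<n. \<forall>x. (deriv ^^ Suc m) f field_differentiable (at x))"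
    by (subst All_less_Suc2) auto
  then show ?case by (simp add: Suc.IH funpow_swap1)
qed simp

lemma smooth_iff: "smooth f \<longleftrightarrow> (\<forall>n. times_differentiable n f)"
  unfolding times_differentiable_iff by auto

lemma times_differentiable_Suc_imp: "times_differentiable (Suc n) f \<Longrightarrow> times_differentiable n f"
  unfolding times_differentiable_iff by auto

lemma field_differentiable_DERIV: "f field_differentiable (at x) \<Longrightarrow> (f has_real_derivative deriv f x) (at x)"
  by (simp add: DERIV_deriv_iff_field_differentiable)

lemma times_differentiable_SucI:
  assumes "\<And>x. (f has_real_derivative g x) (at x)" "times_differentiable n g"
  shows "times_differentiable (Suc n) f"
proof -
  have "deriv f = g" using assms(1) by (auto intro: DERIV_imp_deriv)
  then show ?thesis using assms by (auto simp: field_differentiable_def)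
qed

lemma times_differentiable_cmult: "times_differentiable n f \<Longrightarrow> times_differentiable n (\<lambda>x. c * f x)"
proof (induction n arbitrary: f)
  case (Suc n)
  show ?case
    by (rule times_differentiable_SucI[where g="\<lambda>x. c * deriv f x"])
       (use Suc in \<open>auto intro!: derivative_eq_intros field_differentiable_DERIV\<close>)
qed simp

lemma times_differentiable_add:
  "times_differentiable n f \<Longrightarrow> times_differentiable n g \<Longrightarrow> times_differentiable n (\<lambda>x. f x + g x)"
proof (induction n arbitrary: f g)
  case (Suc n)
  show ?case
    by (rule times_differentiable_SucI[where g="\<lambda>x. deriv f x + deriv g x"])
       (use Suc in \<open>auto intro!: derivative_eq_intros field_differentiable_DERIV\<close>)
qed simp

lemma times_differentiable_mult:
  "times_differentiable n f \<Longrightarrow> times_differentiable n g \<Longrightarrow> times_differentiable n (\<lambda>x. f x * g x)"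
proof (induction n arbitrary: f g)
  case (Suc n)
  have fg: "times_differentiable n f" "times_differentiable n g" 
    using Suc.prems times_differentiable_Suc_imp by blast+
  show ?case
  proof (rule times_differentiable_SucI)
    show "((\<lambda>x. f x * g x) has_real_derivative deriv f x * g x + f x * deriv g x) (at x)" for x
      using Suc.prems by (auto intro!: derivative_eq_intros field_differentiable_DERIV)
    show "times_differentiable n (\<lambda>x. deriv f x * g x + f x * deriv g x)"
      using Suc.prems fg by (intro times_differentiable_add Suc.IH) auto
  qed
qed simp

lemma times_differentiable_affine:
  "times_differentiable n f \<Longrightarrow> times_differentiable n (\<lambda>x. f (c * x + d))"
proof (induction n arbitrary: f)
  case (Suc n)
  show ?case
  proof (rule times_differentiable_SucI)
    show "((\<lambda>x. f (c * x + d)) has_real_derivative c * deriv f (c * x + d)) (at x)" for x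
      by (subst mult.commute, rule DERIV_chain2[OF field_differentiable_DERIV])
         (use Suc.prems in \<open>auto intro!: derivative_eq_intros\<close>)
    show "times_differentiable n (\<lambda>x. c * deriv f (c * x + d))"
      using Suc by (intro times_differentiable_cmult) auto
  qed
qed simp

text \<open>The classical flat function exp(-1/x) is the case p = 1; with the factor p(1/x) the family is
closed under differentiation.\<close>

definition flat :: "real poly \<Rightarrow> real \<Rightarrow> real" where
  "flat p x = (if x > 0 then poly p (1 / x) * exp (- (1 / x)) else 0)"

lemma poly_div_exp_tendsto_0: "((\<lambda>t. t ^ m * poly p t * exp (- t)) \<longlongrightarrow> 0) at_top" for p :: "real poly"
proof (induction p arbitrary: m)
  case (pCons a p)
  have "((\<lambda>t. a * (t ^ m / exp t) + t ^ Suc m * poly p t * exp (- t)) \<longlongrightarrow> a * 0 + 0) at_top"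
    by (intro tendsto_intros tendsto_power_div_exp_0 pCons)
  moreover have "(\<lambda>t. a * (t ^ m / exp t) + t ^ Suc m * poly p t * exp (- t)) = (\<lambda>t. t ^ m * poly (pCons a p) t * exp (- t))"
    by (auto simp: exp_minus field_simps)
  ultimately show ?case by simp
qed simp

text \<open>At 0 the difference quotient from the right is, in the variable t = 1/x, a polynomial divided by
an exponential.\<close>

lemma flat_has_derivative:
  "(flat p has_real_derivative flat ([:0, 0, 1:] * (p - pderiv p)) x) (at x)"
proof -
  consider "x > 0" | "x < 0" | "x = 0" by linarith
  then show ?thesis
  proof cases
    case 1
    have "((\<lambda>x. poly p (1 / x) * exp (- (1 / x))) has_real_derivative flat ([:0, 0, 1:] * (p - pderiv p)) x) (at x)"
      using 1 by (auto intro!: derivative_eq_intros DERIV_chain2[OF poly_DERIV]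
          simp: flat_def algebra_simps power2_eq_square divide_simps)
    then show ?thesis
      by (rule has_field_derivative_transform_within_open[of _ _ _ half_line]) (use 1 in \<open>auto simp: flat_def\<close>)
  next
    case 2
    have "((\<lambda>x. 0) has_real_derivative flat ([:0, 0, 1:] * (p - pderiv p)) x) (at x)"
      using 2 by (simp add: flat_def)
    then show ?thesis
      by (rule has_field_derivative_transform_within_open[of _ _ _ "{..<0}"]) (use 2 in \<open>auto simp: flat_def\<close>)
  next
    case 3
    have "((\<lambda>y. flat p y / y) \<longlongrightarrow> 0) (at_left 0)"
    proof -
      have "\<forall>\<^sub>F y in at_left 0. flat p y / y = (0::real)"
        unfolding eventually_at_filter by (simp add: flat_def)
      then show ?thesis by (rule tendsto_eventually)
    qed
    moreover have "((\<lambda>y. flat p y / y) \<longlongrightarrow> 0) (at_right 0)"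
      unfolding filterlim_at_right_to_top
    proof (rule Lim_transform_eventually[OF poly_div_exp_tendsto_0[of 1 p]])
      show "\<forall>\<^sub>F y in at_top. y ^ 1 * poly p y * exp (- y) = flat p (inverse y) / inverse y"
        using eventually_gt_at_top[of 0] by eventually_elim (simp add: flat_def divide_inverse)
    qed
    ultimately have "((\<lambda>y. flat p y / y) \<longlongrightarrow> 0) (at 0)" by (rule filterlim_split_at)
    then show ?thesis using 3 by (simp add: has_field_derivative_iff flat_def)
  qed
qed

lemma times_differentiable_flat: "times_differentiable n (flat p)"
proof (induction n arbitrary: p)
  case (Suc n)
  show ?case by (rule times_differentiable_SucI[OF flat_has_derivative Suc])
qed simp

text \<open>As n grows, these functions converge to the indicator function of the open interval from a to b.\<close>

definition bump :: "real \<Rightarrow> real \<Rightarrow> real \<Rightarrow> real \<Rightarrow> real" where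
  "bump n a b x = flat 1 (n * (x - a)) * flat 1 (n * (b - x))"

lemma smooth_imp_continuous: "smooth f \<Longrightarrow> continuous_on S f"
  by (metis field_differentiable_imp_continuous_at continuous_at_imp_continuous_on funpow_0)

lemma test_function_bump:
  assumes "0 < a" "n > 0"
  shows "test_function (bump n a b)"
  unfolding test_function_def
proof
  have "times_differentiable m (bump n a b)" for m
  proof -
    have "times_differentiable m (\<lambda>x. flat 1 (n * x + - n * a) * flat 1 (- n * x + n * b))"
      by (intro times_differentiable_mult times_differentiable_affine times_differentiable_flat)
    then show ?thesis unfolding bump_def[abs_def] by (simp add: algebra_simps)
  qed
  then show "smooth (bump n a b)" using smooth_iff by blast
  show "\<exists>K. compact K \<and> K \<subseteq> half_line \<and> (\<forall>x. x \<notin> K \<longrightarrow> bump n a b x = 0)"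
    by (rule exI[of _ "{a..b}"]) (use assms in \<open>auto simp: bump_def flat_def zero_less_mult_iff\<close>)
qed

lemma bump_bounds: "0 \<le> bump n a b x" "bump n a b x \<le> 1"
  by (auto simp: bump_def flat_def intro!: mult_le_one)

lemma bump_tendsto_indicator: "(\<lambda>n. bump (real (Suc n)) a b x) \<longlonglongrightarrow> indicator {a<..<b} x"
proof -
  have flat_lim: "(\<lambda>n. flat 1 (real (Suc n) * c)) \<longlonglongrightarrow> (if c > 0 then 1 else 0)" for c
  proof (cases "c > 0")
    case True
    then have "(\<lambda>n. exp (- (1 / (real (Suc n) * c)))) \<longlonglongrightarrow> 1" by real_asymp
    with True show ?thesis by (simp add: flat_def)
  qed (simp add: flat_def zero_less_mult_iff)
  have "(\<lambda>n. bump (real (Suc n)) a b x) \<longlonglongrightarrow> (if x - a > 0 then 1 else 0) * (if b - x > 0 then 1 else 0)"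
    unfolding bump_def by (intro tendsto_mult flat_lim)
  then show ?thesis by (auto simp: indicator_def split: if_splits)
qed

lemma test_function_support:
  assumes "test_function \<phi>"
  obtains a b where "0 < a" "a < b" "\<And>x. x \<le> a \<or> b \<le> x \<Longrightarrow> \<phi> x = 0"
proof -
  obtain K where K: "compact K" "K \<subseteq> half_line" "\<And>x. x \<notin> K \<Longrightarrow> \<phi> x = 0"
    using assms unfolding test_function_def by blast
  show ?thesis
  proof (cases "K = {}")
    case True
    then show ?thesis using K(3) by (intro that[of 1 2]) auto
  next
    case False
    obtain m where m: "m \<in> K" "\<And>x. x \<in> K \<Longrightarrow> m \<le> x" using compact_attains_inf[OF K(1) False] by blast
    obtain M where M: "M \<in> K" "\<And>x. x \<in> K \<Longrightarrow> x \<le> M" using compact_attains_sup[OF K(1) False] by blast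
    have "m > 0" using m K(2) by auto
    show ?thesis
    proof (rule that[of "m / 2" "M + 1"])
      show "\<phi> x = 0" if "x \<le> m / 2 \<or> M + 1 \<le> x" for x
        using m(2)[of x] M(2)[of x] \<open>m > 0\<close> that by (intro K(3)) auto
    qed (use \<open>m > 0\<close> m(2)[OF M(1)] in auto)
  qed
qed

lemma test_function_deriv:
  assumes "test_function \<phi>"
  shows "test_function (deriv \<phi>)"
proof -
  obtain a b where ab: "0 < a" "a < b" "\<And>x. x \<le> a \<or> b \<le> x \<Longrightarrow> \<phi> x = 0"
    using test_function_support[OF assms] by blast
  have "(deriv ^^ n) (deriv \<phi>) field_differentiable (at x)" for n x
  proof -
    have "(deriv ^^ Suc n) \<phi> field_differentiable (at x)" 
      using assms unfolding test_function_def by blast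
    then show ?thesis by (simp add: funpow_swap1)
  qed
  moreover have "deriv \<phi> x = 0" if "x \<notin> {a..b}" for x
  proof (rule DERIV_imp_deriv)
    show "(\<phi> has_real_derivative 0) (at x)"
      by (rule has_field_derivative_transform_within_open[of "\<lambda>x. 0" _ _ "- {a..b}"])
         (use that ab(3) in \<open>auto simp: closed_atLeastAtMost\<close>)
  qed
  ultimately show ?thesis unfolding test_function_def
    by (intro conjI exI[of _ "{a..b}"]) (use ab in auto)
qed

section \<open>The lemma of du Bois-Reymond\<close>

lemma locally_integrableD:
  assumes "locally_integrable w" "0 < a"
  shows "w absolutely_integrable_on {a..b}"
  by (rule assms(1)[unfolded locally_integrable_def, rule_format]) (use assms(2) in auto)

lemma integrable_times_compact_support:
  assumes w: "w absolutely_integrable_on {a..b}" and "0 < a"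
    and \<phi>: "continuous_on {a..b} \<phi>" "\<And>x. x \<notin> {a..b} \<Longrightarrow> \<phi> x = 0"
  shows "integrable HL (\<lambda>x. w x * \<phi> x)" "ip w \<phi> = integral {a..b} (\<lambda>x. w x * \<phi> x)"
proof -
  have ai: "(\<lambda>x. w x * \<phi> x) absolutely_integrable_on {a..b}"
    using continuous_mult_absolutely_integrable[OF w \<phi>(1)] by (simp add: mult.commute)
  have eq: "w x * \<phi> x = indicator {a..b} x * (w x * \<phi> x)" for x
    using \<phi>(2)[of x] by (auto simp: indicator_def)
  have "integrable lebesgue (\<lambda>x. indicator half_line x *\<^sub>R (indicator {a..b} x *\<^sub>R (w x * \<phi> x)))"
    by (rule integrable_mult_indicator) (use ai in \<open>auto simp: set_integrable_def\<close>)
  then show "integrable HL (\<lambda>x. w x * \<phi> x)"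
    by (subst integrable_restrict_space, simp, subst eq) simp
  have "ip w \<phi> = (LINT x|HL. indicator {a..b} x * (w x * \<phi> x))"
    unfolding ip_def by (rule arg_cong[where f="integral\<^sup>L HL"]) (use eq in auto)
  then show "ip w \<phi> = integral {a..b} (\<lambda>x. w x * \<phi> x)"
    using integral_HL_Icc[OF \<open>0 < a\<close> ai] by simp
qed

lemma ip_one_compact_support:
  assumes "0 < a" "continuous_on {a..b} \<phi>" "\<And>x. x \<notin> {a..b} \<Longrightarrow> \<phi> x = 0"
  shows "ip (\<lambda>_. 1) \<phi> = integral {a..b} \<phi>"
  using integrable_times_compact_support(2)[OF absolutely_integrable_continuous_real assms]
  by (simp add: continuous_on_const)

lemma test_function_continuous: "test_function \<phi> \<Longrightarrow> continuous_on S \<phi>"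
  unfolding test_function_def using smooth_imp_continuous by blast

lemma integrable_times_test_function:
  assumes "locally_integrable w" "test_function \<phi>"
  shows "integrable HL (\<lambda>x. w x * \<phi> x)"
proof -
  obtain a b where ab: "0 < a" "a < b" "\<And>x. x \<le> a \<or> b \<le> x \<Longrightarrow> \<phi> x = 0"
    using test_function_support[OF assms(2)] by blast
  show ?thesis
    by (rule integrable_times_compact_support(1)[OF locally_integrableD[OF assms(1) ab(1), of b] ab(1)])
       (use ab assms in \<open>auto intro: test_function_continuous\<close>)
qed

text \<open>At almost every point w is the limit of its averages over short intervals, and these averages
vanish.\<close>

lemma primitive_const_imp_AE_zero:
  assumes "primitive (\<lambda>_. c) w"
  shows "AE x in HL. w x = 0"
proof -
  have ae: "AE x in lebesgue. x \<in> {1 / real (Suc n)..<real (Suc n)} \<longrightarrow> w x = 0" for n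
  proof -
    define I where "I = {1 / real (Suc n)..real (Suc n)}"
    \<comment> \<open>Cut off to a compact interval, w becomes integrable over every interval of the real line.\<close>
    define v where "v x = (if x \<in> I then w x else 0)" for x
    have pos: "0 < 1 / real (Suc n)" "1 / real (Suc n) \<le> real (Suc n)" by (auto simp: divide_le_eq mult_ge1_I)
    have "v integrable_on cbox a b" for a b
    proof -
      have "v integrable_on UNIV"
        using primitiveD(2)[OF assms pos] unfolding v_def I_def by (subst integrable_restrict_UNIV) auto
      then show ?thesis by (rule integrable_on_subcbox) auto
    qed
    then obtain N where N: "negligible N" "\<And>x e. \<lbrakk>x \<notin> N; 0 < e\<rbrakk> \<Longrightarrow>
               \<exists>d>0. \<forall>h. 0 < h \<and> h < d \<longrightarrow> norm (integral (cbox x (x + h *\<^sub>R One)) v /\<^sub>R h ^ DIM(real) - v x) < e"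
      by (rule integrable_ccontinuous_explicit) blast
    have "w x = 0" if x: "x \<notin> N" "x \<in> {1 / real (Suc n)..<real (Suc n)}" for x
    proof (rule ccontr)
      assume nz: "w x \<noteq> 0"
      obtain d where d: "d > 0" "\<And>h. 0 < h \<and> h < d \<Longrightarrow> \<bar>integral {x..x + h} v / h - v x\<bar> < \<bar>w x\<bar>"
        using N(2)[OF x(1), of "\<bar>w x\<bar>"] nz by (auto simp: divide_inverse mult.commute)
      have "x > 0" using x(2) pos(1) by (meson atLeastLessThan_iff less_le_trans)
      define h where "h = min (d / 2) (real (Suc n) - x)"
      have h: "0 < h" "h < d" "x + h \<le> real (Suc n)" using d(1) x(2) by (auto simp: h_def)
      have "integral {x..x + h} v = integral {x..x + h} w"
        using x(2) h by (intro integral_cong) (auto simp: v_def I_def)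
      also have "\<dots> = 0" using primitiveD(3)[OF assms \<open>x > 0\<close>, of "x + h"] h by auto
      finally show False using d(2)[of h] h x(2) by (auto simp: v_def I_def)
    qed
    moreover have "AE x in lebesgue. x \<notin> N"
      using N(1) by (simp add: negligible_iff_null_sets AE_not_in)
    ultimately show ?thesis by (auto elim!: eventually_mono)
  qed
  have "AE x in lebesgue. \<forall>n. x \<in> {1 / real (Suc n)..<real (Suc n)} \<longrightarrow> w x = 0"
    using ae by (simp only: AE_all_countable) simp
  then show ?thesis unfolding AE_HL_iff
  proof (rule eventually_mono, intro impI)
    fix x :: real assume a: "\<forall>n. x \<in> {1 / real (Suc n)..<real (Suc n)} \<longrightarrow> w x = 0" "x > 0"
    have "\<forall>\<^sub>F n in sequentially. 1 / real (Suc n) < x" 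
      by (rule order_tendstoD[OF _ a(2)]) real_asymp
    moreover have "\<forall>\<^sub>F n in sequentially. real (Suc n) > x" by real_asymp
    ultimately have "\<forall>\<^sub>F n in sequentially. w x = 0" by eventually_elim (use a(1) in auto)
    then show "w x = 0" by simp
  qed
qed

text \<open>Testing with bumps that converge to an indicator function shows that the integral of w over every
compact interval is zero.\<close>

lemma fundamental_lemma:
  assumes w: "locally_integrable w" and z: "\<And>\<phi>. test_function \<phi> \<Longrightarrow> ip w \<phi> = 0"
  shows "AE x in HL. w x = 0"
proof (rule primitive_const_imp_AE_zero[where c=0], unfold primitive_def, intro allI impI conjI)
  fix a b :: real assume ab: "0 < a" "a \<le> b"
  show wab: "w absolutely_integrable_on {a..b}" by (rule locally_integrableD[OF w ab(1)])
  define f where "f k x = w x * bump (real (Suc k)) a b x" for k x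
  have "f k absolutely_integrable_on {a..b}" for k
    unfolding f_def[abs_def] using test_function_bump[OF ab(1), of "real (Suc k)" b]
    by (subst mult.commute, intro continuous_mult_absolutely_integrable wab test_function_continuous) auto
  then have fi: "f k integrable_on {a..b}" for k by (simp add: absolutely_integrable_on_def)
  have "(\<lambda>k. integral {a..b} (f k)) \<longlonglongrightarrow> integral {a..b} (\<lambda>x. w x * indicator {a<..<b} x)"
  proof (rule dominated_convergence(2)[OF fi, where h="\<lambda>x. \<bar>w x\<bar>"])
    show "(\<lambda>x. \<bar>w x\<bar>) integrable_on {a..b}" using wab by (simp add: absolutely_integrable_on_def)
    show "norm (f k x) \<le> \<bar>w x\<bar>" for k x
      using bump_bounds[of "real (Suc k)" a b x] by (simp add: f_def abs_mult mult_left_le del: of_nat_Suc)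
    show "(\<lambda>k. f k x) \<longlonglongrightarrow> w x * indicator {a<..<b} x" for x
      unfolding f_def by (intro tendsto_intros bump_tendsto_indicator)
  qed
  moreover have "integral {a..b} (f k) = 0" for k
  proof -
    have "ip w (bump (real (Suc k)) a b) = integral {a..b} (f k)"
      unfolding f_def[abs_def] using test_function_bump[OF ab(1), of "real (Suc k)" b]
      by (intro integrable_times_compact_support(2)[OF wab ab(1)] test_function_continuous)
         (auto simp: bump_def flat_def zero_less_mult_iff)
    then show ?thesis using z[OF test_function_bump[OF ab(1)], of "real (Suc k)" b] by simp
  qed
  ultimately have "integral {a..b} (\<lambda>x. w x * indicator {a<..<b} x) = 0"
    by (simp add: LIMSEQ_const_iff)
  moreover have "integral {a..b} w = integral {a..b} (\<lambda>x. w x * indicator {a<..<b} x)"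
    by (rule integral_spike[of "{a,b}"]) auto
  ultimately show "0 - 0 = integral {a..b} w" by simp
qed

lemma primitive_exists:
  assumes "locally_integrable g"
  shows "\<exists>G. primitive G g"
proof
  define G where "G x = (if x \<ge> 1 then integral {1..x} g else - integral {x..1} g)" for x
  show "primitive G g"
    unfolding primitive_def
  proof (intro allI impI conjI)
    fix a b :: real assume ab: "0 < a" "a \<le> b"
    show "g absolutely_integrable_on {a..b}" using locally_integrableD[OF assms ab(1)] .
    have int: "g integrable_on {s..t}" if "0 < s" for s t
      using locally_integrableD[OF assms that] by (simp add: absolutely_integrable_on_def)
    have comb: "integral {r..s} g + integral {s..t} g = integral {r..t} g" if "0 < r" "r \<le> s" "s \<le> t" for r s t
      by (rule Henstock_Kurzweil_Integration.integral_combine[OF that(2,3) int[OF that(1)]])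
    consider "a \<ge> 1" | "b < 1" | "a < 1" "b \<ge> 1" by linarith
    then show "G b - G a = integral {a..b} g"
    proof cases
      case 1 then show ?thesis using comb[of 1 a b] ab by (simp add: G_def)
    next
      case 2 then show ?thesis using comb[of a b 1] ab by (simp add: G_def)
    next
      case 3 then show ?thesis using comb[of a 1 b] ab by (simp add: G_def)
    qed
  qed
qed

lemma primitive_imp_locally_integrable:
  assumes "primitive G g" "0 < a"
  shows "G absolutely_integrable_on {a..b}"
  by (rule absolutely_integrable_continuous_real[OF primitive_continuous_Icc[OF assms]])

lemma locally_integrableI:
  assumes "\<And>a b. 0 < a \<Longrightarrow> w absolutely_integrable_on {a..b}"
  shows "locally_integrable w"
  unfolding locally_integrable_def
proof (intro allI impI)
  fix K :: "real set" assume K: "compact K \<and> K \<subseteq> half_line"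
  show "w absolutely_integrable_on K"
  proof (cases "K = {}")
    case False
    obtain m where m: "m \<in> K" "\<And>x. x \<in> K \<Longrightarrow> m \<le> x" using compact_attains_inf[of K] False K by blast
    obtain M where M: "M \<in> K" "\<And>x. x \<in> K \<Longrightarrow> x \<le> M" using compact_attains_sup[of K] False K by blast
    show ?thesis
      by (rule set_integrable_subset[OF assms[of m M]])
         (use m M K in \<open>auto intro!: lmeasurable_compact fmeasurableD\<close>)
  qed (simp add: set_integrable_def)
qed

lemma primitive_locally_integrable:
  assumes "primitive G g" shows "locally_integrable g"
proof (rule locally_integrableI)
  fix a b :: real assume "0 < a"
  then show "g absolutely_integrable_on {a..b}"
    using primitiveD(1)[OF assms, of a b] by (cases "a \<le> b") (auto simp: set_integrable_def)
qed

lemma test_function_by_parts: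
  assumes "primitive G g" "test_function \<phi>"
  shows "ip G (deriv \<phi>) = - ip g \<phi>"
proof -
  obtain a b where ab: "0 < a" "a < b" "\<And>x. x \<le> a \<or> b \<le> x \<Longrightarrow> \<phi> x = 0"
    using test_function_support[OF assms(2)] by blast
  have d\<phi>: "test_function (deriv \<phi>)" by (rule test_function_deriv[OF assms(2)])
  have D: "(\<phi> has_real_derivative deriv \<phi> x) (at x)" for x
    using assms(2) unfolding test_function_def by (metis field_differentiable_DERIV funpow_0)
  have z: "deriv \<phi> x = 0" if "x \<notin> {a..b}" for x
  proof (rule DERIV_imp_deriv)
    show "(\<phi> has_real_derivative 0) (at x)"
      by (rule has_field_derivative_transform_within_open[of "\<lambda>x. 0" _ _ "- {a..b}"])
         (use that ab(3) in \<open>auto simp: closed_atLeastAtMost\<close>)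
  qed
  have "primitive \<phi> (deriv \<phi>)"
    by (rule primitive_C1) (use D d\<phi> test_function_continuous in auto)
  from primitiveD[OF primitive_mult[OF assms(1) this] ab(1) less_imp_le[OF ab(2)]]
  have "integral {a..b} (\<lambda>x. g x * \<phi> x + G x * deriv \<phi> x) = 0" using ab(3)[of a] ab(3)[of b] by simp
  moreover have "(\<lambda>x. g x * \<phi> x) absolutely_integrable_on {a..b}" "(\<lambda>x. G x * deriv \<phi> x) absolutely_integrable_on {a..b}"
    using continuous_mult_absolutely_integrable[OF primitiveD(1)[OF assms(1) ab(1) less_imp_le[OF ab(2)]] test_function_continuous[OF assms(2)]]
     continuous_mult_absolutely_integrable[OF primitive_imp_locally_integrable[OF assms(1) ab(1)] test_function_continuous[OF d\<phi>]]
    by (auto simp: mult.commute)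
  ultimately have "integral {a..b} (\<lambda>x. g x * \<phi> x) + integral {a..b} (\<lambda>x. G x * deriv \<phi> x) = 0"
    by (subst (asm) Henstock_Kurzweil_Integration.integral_add) (auto simp: absolutely_integrable_on_def)
  moreover have "ip g \<phi> = integral {a..b} (\<lambda>x. g x * \<phi> x)"
    by (rule integrable_times_compact_support(2)[OF primitiveD(1)[OF assms(1) ab(1) less_imp_le[OF ab(2)]] ab(1)])
       (use ab assms(2) test_function_continuous in auto)
  moreover have "ip G (deriv \<phi>) = integral {a..b} (\<lambda>x. G x * deriv \<phi> x)"
    by (rule integrable_times_compact_support(2)[OF primitive_imp_locally_integrable[OF assms(1) ab(1)] ab(1)])
       (use z d\<phi> test_function_continuous in auto)
  ultimately show ?thesis by simp
qed

text \<open>The antiderivative that starts at 0 is constant to the right of the support, and that constant is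
the integral of \<open>\<rho>\<close>.\<close>

lemma test_function_antiderivative:
  assumes \<rho>: "test_function \<rho>" and "ip (\<lambda>_. 1) \<rho> = 0"
  obtains \<Phi> where "test_function \<Phi>" "deriv \<Phi> = \<rho>"
proof -
  obtain a b where ab: "0 < a" "a < b" "\<And>x. x \<le> a \<or> b \<le> x \<Longrightarrow> \<rho> x = 0"
    using test_function_support[OF assms(1)] by blast
  define \<Phi> where "\<Phi> x = integral {0..x} \<rho>" for x
  have cont: "continuous_on S \<rho>" for S using \<rho> by (rule test_function_continuous)
  have zero: "\<Phi> x = 0" if "x \<le> a" for x
    unfolding \<Phi>_def by (rule integral_eq_zero_null_sets[THEN trans, rotated] | rule integral_unique, rule has_integral_is_0) (use that ab(3) in auto)
  have D: "(\<Phi> has_real_derivative \<rho> x) (at x)" for x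
  proof (cases "x < a")
    case True
    show ?thesis
      by (rule has_field_derivative_transform_within_open[of "\<lambda>x. 0" _ _ "{..<a}"])
         (use True zero ab(3)[of x] in auto)
  next
    case False
    have "(\<Phi> has_real_derivative \<rho> x) (at x within {0..x+1})"
      unfolding \<Phi>_def[abs_def] by (rule integral_has_real_derivative) (use False ab cont in auto)
    moreover have "at x within {0..x+1} = at x"
      using False ab by (intro at_within_interior) auto
    ultimately show ?thesis by simp
  qed
  have "ip (\<lambda>_. 1) \<rho> = integral {a..b} \<rho>"
    by (rule ip_one_compact_support[OF ab(1) cont]) (use ab(3) in auto)
  then have "integral {a..b} \<rho> = 0" using assms(2) by simp
  have zero': "\<Phi> x = 0" if "x \<ge> b" for x
  proof -
    have "\<Phi> x = integral {0..a} \<rho> + integral {a..x} \<rho>"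
      unfolding \<Phi>_def using ab that
      by (subst Henstock_Kurzweil_Integration.integral_combine) (auto intro: integrable_continuous_real cont)
    also have "integral {a..x} \<rho> = integral {a..b} \<rho> + integral {b..x} \<rho>"
      using ab that
      by (subst Henstock_Kurzweil_Integration.integral_combine) (auto intro: integrable_continuous_real cont)
    also have "integral {b..x} \<rho> = 0"
      by (rule integral_unique, rule has_integral_is_0) (use ab(3) in auto)
    finally show ?thesis using zero[of a] \<open>integral {a..b} \<rho> = 0\<close> by (simp add: \<Phi>_def)
  qed
  have dd: "deriv \<Phi> = \<rho>" using D by (auto intro: DERIV_imp_deriv)
  have "times_differentiable n \<Phi>" for n
  proof (cases n)
    case (Suc m)
    have "times_differentiable m \<rho>" using \<rho> unfolding test_function_def smooth_iff by blast
    then show ?thesis unfolding Suc by (rule times_differentiable_SucI[OF D])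
  qed simp
  then have "smooth \<Phi>" using smooth_iff by blast
  then have "test_function \<Phi>" unfolding test_function_def
    by (intro conjI exI[of _ "{a..b}"]) (use ab zero zero' in auto)
  with dd that show ?thesis by blast
qed

lemma test_function_lincomb:
  assumes "test_function \<phi>" "test_function \<psi>"
  shows "test_function (\<lambda>x. \<phi> x + c * \<psi> x)"
proof -
  obtain K L where K: "compact K" "K \<subseteq> half_line" "\<And>x. x \<notin> K \<Longrightarrow> \<phi> x = 0"
    and L: "compact L" "L \<subseteq> half_line" "\<And>x. x \<notin> L \<Longrightarrow> \<psi> x = 0"
    using assms unfolding test_function_def by metis
  have "times_differentiable n (\<lambda>x. \<phi> x + c * \<psi> x)" for n
    using assms unfolding test_function_def smooth_iff
    by (intro times_differentiable_add times_differentiable_cmult) auto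
  then have "smooth (\<lambda>x. \<phi> x + c * \<psi> x)" using smooth_iff by blast
  then show ?thesis unfolding test_function_def
    by (intro conjI exI[of _ "K \<union> L"]) (use K L in auto)
qed

lemma locally_integrable_lincomb:
  assumes "locally_integrable v" "locally_integrable w"
  shows "locally_integrable (\<lambda>x. v x + c * w x)"
  using assms unfolding locally_integrable_def by (auto intro!: set_integral_add)

lemma locally_integrable_const: "locally_integrable (\<lambda>_. c)"
  by (rule locally_integrableI) (auto intro: absolutely_integrable_continuous_real)

lemma locally_integrable_primitive: "primitive G g \<Longrightarrow> locally_integrable G"
  by (rule locally_integrableI) (rule primitive_imp_locally_integrable)

lemma ip_lincomb_left:
  assumes "locally_integrable v" "locally_integrable w" "test_function \<phi>"
  shows "ip (\<lambda>x. v x + c * w x) \<phi> = ip v \<phi> + c * ip w \<phi>"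
proof -
  have "ip (\<lambda>x. v x + c * w x) \<phi> = (LINT x|HL. v x * \<phi> x + c * (w x * \<phi> x))"
    unfolding ip_def by (simp add: algebra_simps)
  also have "\<dots> = ip v \<phi> + c * ip w \<phi>"
    using assms by (simp add: ip_def integrable_times_test_function)
  finally show ?thesis .
qed

lemma ip_lincomb_right:
  assumes "locally_integrable v" "test_function \<phi>" "test_function \<psi>"
  shows "ip v (\<lambda>x. \<phi> x + c * \<psi> x) = ip v \<phi> + c * ip v \<psi>"
proof -
  have "ip v (\<lambda>x. \<phi> x + c * \<psi> x) = (LINT x|HL. v x * \<phi> x + c * (v x * \<psi> x))"
    unfolding ip_def by (simp add: algebra_simps)
  also have "\<dots> = ip v \<phi> + c * ip v \<psi>"
    using assms by (simp add: ip_def integrable_times_test_function)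
  finally show ?thesis .
qed

lemma test_function_unit_mass:
  obtains \<psi> where "test_function \<psi>" "ip (\<lambda>_. 1) \<psi> = 1"
proof -
  define \<theta> where "\<theta> = bump 1 1 2"
  have \<theta>: "test_function \<theta>" unfolding \<theta>_def by (rule test_function_bump) auto
  have ipi: "ip (\<lambda>_. 1) \<theta> = integral {1..2} \<theta>"
    by (rule ip_one_compact_support) (use test_function_continuous[OF \<theta>] in \<open>auto simp: \<theta>_def bump_def flat_def\<close>)
  have "ip (\<lambda>_. 1) \<theta> \<noteq> 0"
  proof
    assume "ip (\<lambda>_. 1) \<theta> = 0"
    then have "(\<theta> has_integral 0) (cbox 1 2)"
      using ipi integrable_continuous_real[OF test_function_continuous[OF \<theta>]] by (simp add: has_integral_iff)
    then have "\<theta> (3/2) = 0"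
      by (rule has_integral_0_cbox_imp_0[rotated 2])
         (use test_function_continuous[OF \<theta>] in \<open>auto simp: \<theta>_def bump_bounds\<close>)
    then show False by (simp add: \<theta>_def bump_def flat_def)
  qed
  moreover have "test_function (\<lambda>x. \<theta> x + (1 / ip (\<lambda>_. 1) \<theta> - 1) * \<theta> x)"
    by (rule test_function_lincomb[OF \<theta> \<theta>])
  moreover have "ip (\<lambda>_. 1) (\<lambda>x. \<theta> x + (1 / ip (\<lambda>_. 1) \<theta> - 1) * \<theta> x) = 1"
    using \<open>ip (\<lambda>_. 1) \<theta> \<noteq> 0\<close>
    by (subst ip_lincomb_right[OF locally_integrable_const \<theta> \<theta>]) (simp add: left_diff_distrib)
  ultimately show ?thesis using that by blast
qed

text \<open>If G is an indefinite integral of g, then v - G annihilates the derivatives of all test functions.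
These are the test functions of mean zero, so v - G acts on test functions like a constant.\<close>

theorem weak_deriv_imp_primitive:
  assumes "has_weak_deriv 1 v g"
  obtains V where "primitive V g" "AE x in HL. v x = V x"
proof -
  have v: "locally_integrable v" and g: "locally_integrable g"
    and vg: "\<And>\<phi>. test_function \<phi> \<Longrightarrow> ip v (deriv \<phi>) = - ip g \<phi>"
    using assms by (auto simp: has_weak_deriv_def)
  obtain G where G: "primitive G g" using primitive_exists[OF g] by blast
  note lG = locally_integrable_primitive[OF G]
  define w where "w x = v x + (-1) * G x" for x
  have w: "locally_integrable w" unfolding w_def using v lG by (rule locally_integrable_lincomb)
  have w0: "ip w (deriv \<phi>) = 0" if "test_function \<phi>" for \<phi>
    unfolding w_def[abs_def] ip_lincomb_left[OF v lG test_function_deriv[OF that]]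
    using vg[OF that] test_function_by_parts[OF G that] by simp
  \<comment> \<open>c is the constant that w turns out to be.\<close>
  obtain \<psi> where \<psi>: "test_function \<psi>" "ip (\<lambda>_. 1) \<psi> = 1" by (rule test_function_unit_mass)
  define c where "c = ip w \<psi>"
  have "AE x in HL. w x + (-c) * 1 = 0"
  proof (rule fundamental_lemma)
    show "locally_integrable (\<lambda>x. w x + (-c) * 1)" using w locally_integrable_const by (rule locally_integrable_lincomb)
    fix \<phi> assume \<phi>: "test_function \<phi>"
    define \<rho> where "\<rho> x = \<phi> x + (- ip (\<lambda>_. 1) \<phi>) * \<psi> x" for x
    have \<rho>: "test_function \<rho>" unfolding \<rho>_def by (rule test_function_lincomb[OF \<phi> \<psi>(1)])
    have "ip (\<lambda>_. 1) \<rho> = 0" unfolding \<rho>_def[abs_def] 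
      using \<psi>(2) by (subst ip_lincomb_right[OF locally_integrable_const \<phi> \<psi>(1)]) simp
    then obtain \<Phi> where "test_function \<Phi>" "deriv \<Phi> = \<rho>" by (rule test_function_antiderivative[OF \<rho>])
    then have "ip w \<rho> = 0" using w0 by blast
    then have "ip w \<phi> = ip (\<lambda>_. 1) \<phi> * c"
      unfolding \<rho>_def[abs_def] by (subst (asm) ip_lincomb_right[OF w \<phi> \<psi>(1)]) (simp add: c_def)
    then show "ip (\<lambda>x. w x + (-c) * 1) \<phi> = 0"
      by (subst ip_lincomb_left[OF w locally_integrable_const \<phi>]) simp
  qed
  then have "AE x in HL. v x = G x + c" by eventually_elim (simp add: w_def)
  moreover have "primitive (\<lambda>x. G x + c) g" using primitive_add[OF G primitive_zero[of c]] by simp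
  ultimately show ?thesis using that by blast
qed

lemma has_weak_deriv_unique:
  assumes "has_weak_deriv k v g" "has_weak_deriv k v h"
  shows "AE x in HL. g x = h x"
proof -
  have "AE x in HL. g x + (-1) * h x = 0"
  proof (rule fundamental_lemma)
    show "locally_integrable (\<lambda>x. g x + (-1) * h x)"
      using assms by (intro locally_integrable_lincomb) (auto simp: has_weak_deriv_def)
    fix \<phi> assume "test_function \<phi>"
    with assms show "ip (\<lambda>x. g x + (-1) * h x) \<phi> = 0"
      by (subst ip_lincomb_left) (auto simp: has_weak_deriv_def)
  qed
  then show ?thesis by eventually_elim simp
qed

text \<open>Iterating this along the orders of differentiation splits a Sobolev condition of order r into r
conditions of order one.\<close>

lemma has_weak_deriv_step:
  assumes "has_weak_deriv k v g" "has_weak_deriv (Suc k) v h"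
  shows "has_weak_deriv 1 g h"
  unfolding has_weak_deriv_def
proof (intro conjI allI impI)
  fix \<phi> assume \<phi>: "test_function \<phi>"
  have "(-1) ^ k * ip g (deriv \<phi>) = ip v ((deriv ^^ k) (deriv \<phi>))"
    using assms(1) test_function_deriv[OF \<phi>] by (simp add: has_weak_deriv_def)
  also have "\<dots> = (-1) ^ Suc k * ip h \<phi>"
    using assms(2) \<phi> by (simp add: has_weak_deriv_def funpow_swap1)
  finally have "(-1) ^ k * (ip g (deriv \<phi>) + ip h \<phi>) = 0" by (simp add: distrib_left)
  then show "ip g ((deriv ^^ 1) \<phi>) = (-1) ^ 1 * ip h \<phi>" by simp
qed (use assms in \<open>auto simp: has_weak_deriv_def\<close>)

lemma primitive_imp_has_weak_deriv:
  assumes "primitive V g" "AE x in HL. v x = V x" "locally_integrable v"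
  shows "has_weak_deriv 1 v g"
  unfolding has_weak_deriv_def
proof (intro conjI allI impI)
  show "locally_integrable g" by (rule primitive_locally_integrable[OF assms(1)])
  fix \<phi> assume \<phi>: "test_function \<phi>"
  have "ip v (deriv \<phi>) = ip V (deriv \<phi>)"
    unfolding ip_def 
  proof (rule integral_cong_AE)
    show "(\<lambda>x. v x * deriv \<phi> x) \<in> borel_measurable HL" "(\<lambda>x. V x * deriv \<phi> x) \<in> borel_measurable HL"
      using integrable_times_test_function[OF assms(3) test_function_deriv[OF \<phi>]]
       integrable_times_test_function[OF locally_integrable_primitive[OF assms(1)] test_function_deriv[OF \<phi>]] by auto
  qed (use assms(2) in \<open>auto elim!: eventually_mono\<close>)
  then show "ip v ((deriv ^^ 1) \<phi>) = (-1) ^ 1 * ip g \<phi>"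
    using test_function_by_parts[OF assms(1) \<phi>] by simp
qed (rule assms)

section \<open>Square integrable functions\<close>

text \<open>Weighted norms are covered by absorbing the square root of the weight into f.\<close>

definition sqint :: "'a measure \<Rightarrow> ('a \<Rightarrow> real) \<Rightarrow> bool" where
  "sqint M f \<longleftrightarrow> f \<in> borel_measurable M \<and> integrable M (\<lambda>x. (f x)\<^sup>2)"

lemma sqint_measurable [measurable_dest]: "sqint M f \<Longrightarrow> f \<in> borel_measurable M"
  by (simp add: sqint_def)

lemma sqint_integrable: "sqint M f \<Longrightarrow> integrable M (\<lambda>x. (f x)\<^sup>2)"
  by (simp add: sqint_def)

lemma sqint_mult_integrable:
  assumes "sqint M f" "sqint M g"
  shows "integrable M (\<lambda>x. f x * g x)"
proof (rule Bochner_Integration.integrable_bound)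
  show "integrable M (\<lambda>x. (f x)\<^sup>2 + (g x)\<^sup>2)" using assms by (auto simp: sqint_def)
  show "(\<lambda>x. f x * g x) \<in> borel_measurable M" using assms by (auto simp: sqint_def)
  have "\<bar>f x * g x\<bar> \<le> (f x)\<^sup>2 + (g x)\<^sup>2" for x
  proof -
    have "0 \<le> (\<bar>f x\<bar> - \<bar>g x\<bar>)\<^sup>2" by simp
    then have "2 * (\<bar>f x\<bar> * \<bar>g x\<bar>) \<le> (f x)\<^sup>2 + (g x)\<^sup>2" unfolding power2_diff by simp
    moreover have "0 \<le> \<bar>f x\<bar> * \<bar>g x\<bar>" by simp
    ultimately show ?thesis unfolding abs_mult by linarith
  qed
  then show "AE x in M. norm (f x * g x) \<le> norm ((f x)\<^sup>2 + (g x)\<^sup>2)" by auto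
qed

lemma sqint_cmult: "sqint M f \<Longrightarrow> sqint M (\<lambda>x. c * f x)"
  by (auto simp: sqint_def power_mult_distrib)

lemma sqint_add:
  assumes "sqint M f" "sqint M g"
  shows "sqint M (\<lambda>x. f x + g x)"
  using assms sqint_mult_integrable[OF assms] unfolding sqint_def power2_sum
  by (auto simp: mult.assoc)

lemma sqint_diff: "sqint M f \<Longrightarrow> sqint M g \<Longrightarrow> sqint M (\<lambda>x. f x - g x)"
  using sqint_add[of M f "\<lambda>x. (-1) * g x"] sqint_cmult[of M g "-1"] by simp

lemma sqint_zero: "sqint M (\<lambda>_. 0)"
  by (simp add: sqint_def)

lemma sqint_sum: "(\<And>i. i \<in> A \<Longrightarrow> sqint M (f i)) \<Longrightarrow> sqint M (\<lambda>x. \<Sum>i\<in>A. f i x)"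
  by (induction A rule: infinite_finite_induct) (auto intro: sqint_zero sqint_add)

lemma sqint_bound:
  assumes "sqint M g" "f \<in> borel_measurable M" "AE x in M. \<bar>f x\<bar> \<le> \<bar>g x\<bar>"
  shows "sqint M f"
  unfolding sqint_def
proof
  show "integrable M (\<lambda>x. (f x)\<^sup>2)"
  proof (rule Bochner_Integration.integrable_bound[OF sqint_integrable[OF assms(1)]])
    show "AE x in M. norm ((f x)\<^sup>2) \<le> norm ((g x)\<^sup>2)"
      using assms(3) by eventually_elim (simp add: abs_le_square_iff)
  qed (use assms(2) in simp)
qed (rule assms)

lemma sqint_cong_AE:
  assumes "sqint M g" "f \<in> borel_measurable M" "AE x in M. f x = g x"
  shows "sqint M f"
  by (rule sqint_bound[OF assms(1,2)]) (use assms(3) in \<open>auto elim: eventually_mono\<close>)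

section \<open>Continuous representatives, traces and the energy form\<close>

lemma locally_integrable_measurable:
  assumes "locally_integrable v" shows "v \<in> borel_measurable HL"
  using primitive_exists[OF assms] primitive_measurable by blast

text \<open>The distance of h and k is continuous, nonnegative and has integral zero over a neighbourhood of
x.\<close>

lemma continuous_AE_eq_imp_eq:
  fixes h k :: "real \<Rightarrow> real"
  assumes "continuous_on half_line h" "continuous_on half_line k" "AE x in HL. h x = k x" "x > 0"
  shows "h x = k x"
proof -
  have c: "continuous_on {x/2..x+1} (\<lambda>y. \<bar>h y - k y\<bar>)"
    using assms by (intro continuous_intros; elim continuous_on_subset) auto
  have "AE y in HL. 0 = \<bar>h y - k y\<bar>" using assms(3) by eventually_elim simp
  from primitive_cong_AE[OF primitive_zero[of 0] this]
  have p: "primitive (\<lambda>_. 0) (\<lambda>y. \<bar>h y - k y\<bar>)" .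
  have "((\<lambda>y. \<bar>h y - k y\<bar>) has_integral 0) (cbox (x/2) (x+1))"
    using primitiveD(2,3)[OF p, of "x/2" "x+1"] \<open>x > 0\<close> by (simp add: has_integral_iff)
  then have "\<bar>h x - k x\<bar> = 0"
    by (rule has_integral_0_cbox_imp_0[rotated 2]) (use c \<open>x > 0\<close> in auto)
  then show ?thesis by simp
qed

lemma continuous_tendsto_at_right_0:
  assumes "continuous_on {0..} h" shows "(h \<longlongrightarrow> h 0) (at_right (0::real))"
  using assms unfolding continuous_on by (auto intro: tendsto_within_subset)

lemma continuous_rep_trace0:
  assumes "continuous_rep v h"
  shows "trace0 v = h 0"
  unfolding trace0_def
proof (rule the_equality)
  show "\<exists>k. continuous_rep v k \<and> k 0 = h 0" using assms by blast
  fix c assume "\<exists>k. continuous_rep v k \<and> k 0 = c"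
  then obtain k where k: "continuous_rep v k" "k 0 = c" by blast
  have "AE x in HL. h x = k x"
    using assms k(1) unfolding continuous_rep_def by (auto elim: eventually_elim2)
  moreover have ch: "continuous_on {0..} h" and ck: "continuous_on {0..} k"
    using assms k(1) unfolding continuous_rep_def by auto
  ultimately have eq: "h x = k x" if "x > 0" for x
    using that by (intro continuous_AE_eq_imp_eq) (auto elim: continuous_on_subset)
  have "(k \<longlongrightarrow> h 0) (at_right 0)"
    by (rule Lim_transform_eventually[OF continuous_tendsto_at_right_0[OF ch]])
       (use eq in \<open>auto simp: eventually_at_filter\<close>)
  then have "h 0 = k 0"
    using continuous_tendsto_at_right_0[OF ck] tendsto_unique trivial_limit_at_right_real by blast
  with k show "c = h 0" by simp
qed

lemma has_weak_deriv_weak_deriv: "has_weak_deriv k v g \<Longrightarrow> has_weak_deriv k v (weak_deriv k v)"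
  unfolding weak_deriv_def by (rule someI[where P="has_weak_deriv k v"])

lemma weak_deriv_AE: "has_weak_deriv k v g \<Longrightarrow> AE x in HL. weak_deriv k v x = g x"
  using has_weak_deriv_unique has_weak_deriv_weak_deriv by blast

lemma sobolev_weak_deriv:
  assumes "v \<in> sobolev r \<omega>" "k \<le> r"
  shows "has_weak_deriv k v (weak_deriv k v)" 
    and "\<exists>g \<in> L2w \<omega>. AE x in HL. weak_deriv k v x = g x"
proof -
  obtain g where g: "g \<in> L2w \<omega>" "has_weak_deriv k v g" using assms unfolding sobolev_def by blast
  show "has_weak_deriv k v (weak_deriv k v)" using g(2) by (rule has_weak_deriv_weak_deriv)
  show "\<exists>g \<in> L2w \<omega>. AE x in HL. weak_deriv k v x = g x" using g weak_deriv_AE by blast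
qed

lemma integrable_cong_AE_measurable:
  fixes f g :: "'a \<Rightarrow> real"
  assumes "integrable M f" "g \<in> borel_measurable M" "AE x in M. g x = f x"
  shows "integrable M g"
  using assms(1) by (subst integrable_cong_AE[OF assms(2) borel_measurable_integrable[OF assms(1)] assms(3)])

lemma sobolev_weighted_integrable:
  assumes "v \<in> sobolev r \<omega>" "k \<le> r" "\<omega> \<in> borel_measurable HL"
  shows "weak_deriv k v \<in> borel_measurable HL" "integrable HL (\<lambda>x. (weak_deriv k v x)\<^sup>2 * \<omega> x)"
proof -
  show m: "weak_deriv k v \<in> borel_measurable HL"
    using sobolev_weak_deriv(1)[OF assms(1,2)] by (auto simp: has_weak_deriv_def intro: locally_integrable_measurable)
  obtain g where g: "g \<in> L2w \<omega>" "AE x in HL. weak_deriv k v x = g x"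
    using sobolev_weak_deriv(2)[OF assms(1,2)] by blast
  show "integrable HL (\<lambda>x. (weak_deriv k v x)\<^sup>2 * \<omega> x)"
  proof (rule integrable_cong_AE_measurable)
    show "integrable HL (\<lambda>x. (g x)\<^sup>2 * \<omega> x)" using g by (simp add: L2w_def)
  qed (use g(2) m assms(3) in \<open>auto elim: eventually_mono\<close>)
qed

lemma H1_sqint:
  assumes "u \<in> H1" "k \<le> 1" shows "sqint HL (weak_deriv k u)"
  using sobolev_weighted_integrable[OF assms] by (simp add: sqint_def)

text \<open>A function of class H1 in its continuous version, with its derivative. The proof works with such
pairs because traces and weak derivatives are defined by description and choice.\<close>

definition H1_pair :: "(real \<Rightarrow> real) \<Rightarrow> (real \<Rightarrow> real) \<Rightarrow> bool" where
  "H1_pair h g \<longleftrightarrow> continuous_on {0..} h \<and> primitive h g \<and> sqint HL h \<and> sqint HL g \<and> (h \<longlongrightarrow> 0) at_top"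

definition represents :: "(real \<Rightarrow> real) \<Rightarrow> (real \<Rightarrow> real) \<Rightarrow> (real \<Rightarrow> real) \<Rightarrow> bool" where
  "represents v h g \<longleftrightarrow> locally_integrable v \<and> continuous_rep v h \<and> H1_pair h g"

lemma weak_deriv_0_AE:
  assumes "locally_integrable v" shows "AE x in HL. weak_deriv 0 v x = v x"
  by (rule weak_deriv_AE) (use assms in \<open>simp add: has_weak_deriv_def\<close>)

text \<open>The limit condition provides a representative that is continuous up to 0, the lemma of du
Bois-Reymond one that is an indefinite integral. Both are continuous on the open half-line and
hence equal there.\<close>

lemma H1_represents:
  assumes u: "u \<in> H1" and van: "vanishes_at_infinity u"
  shows "\<exists>h. represents u h (weak_deriv 1 u)"
proof -
  have wd: "has_weak_deriv 1 u (weak_deriv 1 u)" using sobolev_weak_deriv(1)[OF u] by simp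
  then have lu: "locally_integrable u" by (simp add: has_weak_deriv_def)
  obtain V where V: "primitive V (weak_deriv 1 u)" "AE x in HL. u x = V x"
    using weak_deriv_imp_primitive[OF wd] by blast
  obtain h where h: "continuous_rep u h" "(h \<longlongrightarrow> 0) at_top"
    using van unfolding vanishes_at_infinity_def by blast
  then have ch: "continuous_on {0..} h" and uh: "AE x in HL. u x = h x" by (auto simp: continuous_rep_def)
  have ae: "AE x in HL. h x = V x" using V(2) uh by eventually_elim simp
  have "h x = V x" if "x > 0" for x
    by (rule continuous_AE_eq_imp_eq[OF _ primitive_continuous[OF V(1)] ae that])
       (use ch in \<open>auto elim: continuous_on_subset\<close>)
  then have ph: "primitive h (weak_deriv 1 u)" using primitive_cong[OF V(1)] by auto
  have "AE x in HL. h x = weak_deriv 0 u x" using uh weak_deriv_0_AE[OF lu] by eventually_elim simp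
  then have "sqint HL h"
    using sqint_cong_AE[OF H1_sqint[OF u, of 0] continuous_HL_measurable[OF primitive_continuous[OF ph]]] by simp
  then have "H1_pair h (weak_deriv 1 u)"
    using ch ph h(2) H1_sqint[OF u, of 1] by (simp add: H1_pair_def)
  with lu h(1) show ?thesis by (auto simp: represents_def)
qed

lemma H1_pair_lincomb:
  assumes "H1_pair h g" "H1_pair k l"
  shows "H1_pair (\<lambda>x. h x + c * k x) (\<lambda>x. g x + c * l x)"
proof -
  have "((\<lambda>x. h x + c * k x) \<longlongrightarrow> 0 + c * 0) at_top"
    using assms unfolding H1_pair_def by (intro tendsto_intros) auto
  with assms show ?thesis unfolding H1_pair_def
    by (auto intro!: continuous_intros primitive_add primitive_cmult sqint_add sqint_cmult)
qed

lemma H1_pair_diff: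
  "H1_pair h g \<Longrightarrow> H1_pair k l \<Longrightarrow> H1_pair (\<lambda>x. h x - k x) (\<lambda>x. g x - l x)"
  using H1_pair_lincomb[of h g k l "-1"] by simp

lemma represents_diff:
  assumes "represents v h g" "represents w k l"
  shows "represents (\<lambda>x. v x - w x) (\<lambda>x. h x - k x) (\<lambda>x. g x - l x)"
proof -
  have "AE x in HL. v x = h x" "AE x in HL. w x = k x"
    using assms by (auto simp: represents_def continuous_rep_def)
  then have "AE x in HL. v x - w x = h x - k x" by eventually_elim simp
  moreover have "locally_integrable (\<lambda>x. v x - w x)"
    using locally_integrable_lincomb[of v w "-1"] assms by (simp add: represents_def)
  ultimately show ?thesis
    using assms H1_pair_diff unfolding represents_def continuous_rep_def by (auto intro!: continuous_intros)
qed

lemma represents_has_weak_deriv: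
  assumes "represents v h g" shows "has_weak_deriv 1 v g"
  using assms unfolding represents_def continuous_rep_def H1_pair_def
  by (blast intro: primitive_imp_has_weak_deriv)

lemma represents_AE:
  assumes "represents v h g"
  shows "AE x in HL. v x = h x" "AE x in HL. weak_deriv 1 v x = g x"
  using assms weak_deriv_AE[OF represents_has_weak_deriv[OF assms]]
  by (auto simp: represents_def continuous_rep_def)

lemma represents_trace0: "represents v h g \<Longrightarrow> trace0 v = h 0"
  by (simp add: represents_def continuous_rep_trace0)

lemma represents_measurable:
  assumes "represents v h g"
  shows "v \<in> borel_measurable HL" "weak_deriv 1 v \<in> borel_measurable HL"
    "h \<in> borel_measurable HL" "g \<in> borel_measurable HL"
  using assms has_weak_deriv_weak_deriv[OF represents_has_weak_deriv[OF assms]]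
  by (auto simp: represents_def H1_pair_def has_weak_deriv_def sqint_def intro: locally_integrable_measurable)

lemma represents_H1:
  assumes "represents v h g" shows "v \<in> H1"
  unfolding sobolev_def
proof (intro CollectI allI impI)
  fix k :: nat assume "k \<le> 1"
  then consider "k = 0" | "k = 1" by linarith
  then show "\<exists>g\<in>L2w (\<lambda>_. 1). has_weak_deriv k v g"
  proof cases
    case 1
    have "sqint HL v"
      using sqint_cong_AE[OF _ represents_measurable(1)[OF assms] represents_AE(1)[OF assms]] assms
      by (simp add: represents_def H1_pair_def)
    then show ?thesis using assms 1 by (intro bexI[of _ v]) (auto simp: has_weak_deriv_def represents_def L2w_def sqint_def)
  next
    case 2
    then show ?thesis using represents_has_weak_deriv[OF assms] assms
      by (intro bexI[of _ g]) (auto simp: represents_def H1_pair_def L2w_def sqint_def)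
  qed
qed

text \<open>The bilinear form of the boundary value problem, with the derivatives as explicit arguments.\<close>

definition energy :: "real \<Rightarrow> real \<Rightarrow> (real \<Rightarrow> real) \<Rightarrow> (real \<Rightarrow> real) \<Rightarrow> (real \<Rightarrow> real) \<Rightarrow> (real \<Rightarrow> real) \<Rightarrow> real" where
  "energy \<gamma> \<mu> h g k l = \<mu> * h 0 * k 0 + (LINT x|HL. g x * l x) + \<gamma> * (LINT x|HL. h x * k x)"

lemma represents_bilinear_form:
  assumes "represents v h g" "represents w k l"
  shows "bilinear_form \<gamma> \<mu> v w = energy \<gamma> \<mu> h g k l"
proof -
  note ae = represents_AE[OF assms(1)] represents_AE[OF assms(2)]
  note meas = represents_measurable[OF assms(1)] represents_measurable[OF assms(2)]
  have "ip (weak_deriv 1 v) (weak_deriv 1 w) = (LINT x|HL. g x * l x)"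
    unfolding ip_def by (rule integral_cong_AE) (use ae(2,4) meas in auto)
  moreover have "ip v w = (LINT x|HL. h x * k x)"
    unfolding ip_def by (rule integral_cong_AE) (use ae(1,3) meas in auto)
  ultimately show ?thesis
    using assms by (simp add: bilinear_form_def energy_def represents_trace0)
qed

lemma wnorm_cong_AE:
  assumes "AE x in HL. v x = h x" "v \<in> borel_measurable HL" "h \<in> borel_measurable HL" "\<omega> \<in> borel_measurable HL"
  shows "wnorm \<omega> v = wnorm \<omega> h"
proof -
  have "(LINT x|HL. (v x)\<^sup>2 * \<omega> x) = (LINT x|HL. (h x)\<^sup>2 * \<omega> x)"
    by (rule integral_cong_AE) (use assms in auto)
  then show ?thesis by (simp add: wnorm_def)
qed

lemma wnorm_power2:
  assumes "\<And>x. x > 0 \<Longrightarrow> \<omega> x \<ge> 0"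
  shows "(wnorm \<omega> v)\<^sup>2 = (LINT x|HL. (v x)\<^sup>2 * \<omega> x)"
proof -
  have "0 \<le> (LINT x|HL. (v x)\<^sup>2 * \<omega> x)" by (rule integral_nonneg_AE) (auto intro!: AE_I2 simp: assms)
  then show ?thesis by (simp add: wnorm_def)
qed

lemma represents_energy_norm:
  assumes "represents v h g"
  shows "\<mu> * \<bar>trace0 v\<bar>\<^sup>2 + (L2norm (weak_deriv 1 v))\<^sup>2 + \<gamma> * (L2norm v)\<^sup>2 = energy \<gamma> \<mu> h g h g"
proof -
  note m = represents_measurable[OF assms]
  have "wnorm (\<lambda>_. 1) (weak_deriv 1 v) = wnorm (\<lambda>_. 1) g" "wnorm (\<lambda>_. 1) v = wnorm (\<lambda>_. 1) h"
    by (intro wnorm_cong_AE represents_AE[OF assms] m; simp)+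
  moreover have "(L2norm f)\<^sup>2 = (LINT x|HL. f x * f x)" for f
    by (subst wnorm_power2) (auto simp: power2_eq_square)
  moreover have "\<mu> * \<bar>trace0 v\<bar>\<^sup>2 = \<mu> * h 0 * h 0"
    by (simp add: represents_trace0[OF assms] power2_eq_square)
  ultimately show ?thesis by (simp add: energy_def)
qed

lemma energy_nonneg:
  assumes "\<mu> \<ge> 0" "\<gamma> \<ge> 0" shows "energy \<gamma> \<mu> h g h g \<ge> 0"
  unfolding energy_def using assms by (auto simp: mult.assoc intro!: add_nonneg_nonneg mult_nonneg_nonneg integral_nonneg_AE AE_I2)

lemma energy_commute: "energy \<gamma> \<mu> h g k l = energy \<gamma> \<mu> k l h g"
  by (simp add: energy_def mult_ac)

lemma energy_lincomb_right:
  assumes "H1_pair h g" "H1_pair k l" "H1_pair m n"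
  shows "energy \<gamma> \<mu> h g (\<lambda>x. k x + c * m x) (\<lambda>x. l x + c * n x) = energy \<gamma> \<mu> h g k l + c * energy \<gamma> \<mu> h g m n"
proof -
  have i: "integrable HL (\<lambda>x. g x * l x)" "integrable HL (\<lambda>x. g x * n x)" "integrable HL (\<lambda>x. h x * k x)" "integrable HL (\<lambda>x. h x * m x)"
    using assms by (auto simp: H1_pair_def intro: sqint_mult_integrable)
  have "(LINT x|HL. g x * (l x + c * n x)) = (LINT x|HL. g x * l x + c * (g x * n x))"
    "(LINT x|HL. h x * (k x + c * m x)) = (LINT x|HL. h x * k x + c * (h x * m x))"
    by (simp_all add: algebra_simps)
  then show ?thesis using i by (simp add: energy_def algebra_simps)
qed

lemma energy_diff_right:
  assumes "H1_pair h g" "H1_pair k l" "H1_pair m n"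
  shows "energy \<gamma> \<mu> h g (\<lambda>x. k x - m x) (\<lambda>x. l x - n x) = energy \<gamma> \<mu> h g k l - energy \<gamma> \<mu> h g m n"
  using energy_lincomb_right[OF assms, where c="-1"] by simp

text \<open>The discriminant of the nonnegative quadratic polynomial that maps t to the energy of h + t k.\<close>

lemma energy_Cauchy_Schwarz:
  assumes "\<mu> \<ge> 0" "\<gamma> \<ge> 0" "H1_pair h g" "H1_pair k l"
  shows "(energy \<gamma> \<mu> h g k l)\<^sup>2 \<le> energy \<gamma> \<mu> h g h g * energy \<gamma> \<mu> k l k l"
proof -
  define A where "A = energy \<gamma> \<mu> h g h g"
  define B where "B = energy \<gamma> \<mu> h g k l"
  define C where "C = energy \<gamma> \<mu> k l k l"
  have q: "0 \<le> A + t * (2 * B) + t\<^sup>2 * C" for t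
  proof -
    note p = H1_pair_lincomb[OF assms(3,4), of t]
    have "0 \<le> energy \<gamma> \<mu> (\<lambda>x. h x + t * k x) (\<lambda>x. g x + t * l x) (\<lambda>x. h x + t * k x) (\<lambda>x. g x + t * l x)"
      by (rule energy_nonneg[OF assms(1,2)])
    also have "\<dots> = energy \<gamma> \<mu> h g (\<lambda>x. h x + t * k x) (\<lambda>x. g x + t * l x)
       + t * energy \<gamma> \<mu> k l (\<lambda>x. h x + t * k x) (\<lambda>x. g x + t * l x)"
      by (subst energy_lincomb_right[OF p assms(3,4)])
         (simp add: energy_commute[of _ _ "\<lambda>x. h x + t * k x"])
    also have "\<dots> = A + t * B + t * (B + t * C)"
      unfolding A_def B_def C_def using assms(3,4)
      by (simp add: energy_lincomb_right energy_commute[of _ _ k l h g])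
    finally show ?thesis by (simp add: power2_eq_square algebra_simps)
  qed
  have "B\<^sup>2 \<le> A * C"
  proof (cases "C = 0")
    case True
    have "B = 0"
    proof (rule ccontr)
      assume "B \<noteq> 0"
      with q[of "- (A + 1) / (2 * B)"] True show False by simp
    qed
    with True show ?thesis by simp
  next
    case False
    moreover have "C \<ge> 0" unfolding C_def by (rule energy_nonneg[OF assms(1,2)])
    ultimately have "C > 0" by simp
    have "A + (- B / C) * (2 * B) + (- B / C)\<^sup>2 * C = A - B\<^sup>2 / C"
      using \<open>C > 0\<close> by (simp add: field_simps power2_eq_square)
    with q[of "- B / C"] have "B\<^sup>2 / C \<le> A" by simp
    then show ?thesis using \<open>C > 0\<close> by (simp add: field_simps)
  qed
  then show ?thesis by (simp add: A_def B_def C_def)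
qed

section \<open>The spectral space\<close>

lemma poly_exp_tendsto_0:
  fixes p :: "real poly"
  assumes "b > 0" shows "((\<lambda>x. poly p x * exp (- (b * x))) \<longlongrightarrow> 0) at_top"
proof -
  have "((\<lambda>t. t ^ 0 * poly (pcompose p [:0, 1 / b:]) t * exp (- t)) \<longlongrightarrow> 0) at_top"
    by (rule poly_div_exp_tendsto_0)
  moreover have "filterlim (\<lambda>x. b * x) at_top at_top" using assms by real_asymp
  ultimately have "((\<lambda>x. (b * x) ^ 0 * poly (pcompose p [:0, 1 / b:]) (b * x) * exp (- (b * x))) \<longlongrightarrow> 0) at_top"
    by (rule filterlim_compose)
  then show ?thesis using assms by (simp add: poly_pcompose)
qed

lemma continuous_tendsto_0_bounded:
  fixes f :: "real \<Rightarrow> real"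
  assumes "continuous_on {0..} f" "(f \<longlongrightarrow> 0) at_top"
  obtains C where "C > 0" "\<And>x. x \<ge> 0 \<Longrightarrow> \<bar>f x\<bar> \<le> C"
proof -
  have "\<forall>\<^sub>F x in at_top. \<bar>f x\<bar> < 1" using tendstoD[OF assms(2), of 1] by (simp add: dist_real_def)
  then obtain X where X: "\<And>x. x \<ge> X \<Longrightarrow> \<bar>f x\<bar> < 1" by (auto simp: eventually_at_top_linorder)
  have "bounded (f ` {0..X})"
    by (rule compact_imp_bounded[OF compact_continuous_image]) (use assms(1) in \<open>auto elim: continuous_on_subset\<close>)
  then obtain B where B: "\<forall>x\<in>{0..X}. \<bar>f x\<bar> \<le> B" by (auto simp: bounded_iff)
  show ?thesis
  proof (rule that[of "max 1 B"])
    fix x :: real assume "x \<ge> 0"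
    then show "\<bar>f x\<bar> \<le> max 1 B" using X[of x] B by (cases "x \<le> X") force+
  qed simp
qed

lemma integrable_exp_decay:
  assumes "b > 0" shows "integrable HL (\<lambda>x. exp (- (b * x)))"
proof (rule integrable_HL_primitive)
  show "primitive (\<lambda>x. - exp (- (b * x)) / b) (\<lambda>x. exp (- (b * x)))"
    by (rule primitive_C1) (use assms in \<open>auto intro!: derivative_eq_intros continuous_intros\<close>)
  show "\<bar>- exp (- (b * x)) / b\<bar> \<le> 1 / b" if "x > 0" for x using assms that by (simp add: divide_right_mono)
qed simp

lemma integrable_poly_exp:
  fixes p :: "real poly"
  assumes "b > 0" shows "integrable HL (\<lambda>x. poly p x * exp (- (b * x)))"
proof -
  obtain C where C: "C > 0" "\<And>x. x \<ge> 0 \<Longrightarrow> \<bar>poly p x * exp (- (b/2 * x))\<bar> \<le> C"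
    by (rule continuous_tendsto_0_bounded[OF _ poly_exp_tendsto_0[of "b/2" p]]) (use assms in \<open>auto intro!: continuous_intros\<close>)
  show ?thesis
  proof (rule Bochner_Integration.integrable_bound)
    show "integrable HL (\<lambda>x. C * exp (- (b/2 * x)))" using integrable_exp_decay[of "b/2"] assms by simp
    show "(\<lambda>x. poly p x * exp (- (b * x))) \<in> borel_measurable HL"
      by (intro continuous_HL_measurable continuous_intros)
    show "AE x in HL. norm (poly p x * exp (- (b * x))) \<le> norm (C * exp (- (b/2 * x)))"
    proof (rule AE_I2)
      fix x assume "x \<in> space HL"
      then have "\<bar>poly p x * exp (- (b/2 * x))\<bar> * exp (- (b/2 * x)) \<le> C * exp (- (b/2 * x))"
        by (intro mult_right_mono C(2)) auto
      moreover have "exp (- (b * x)) = exp (- (b/2 * x)) * exp (- (b/2 * x))"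
        by (simp flip: exp_add)
      ultimately show "norm (poly p x * exp (- (b * x))) \<le> norm (C * exp (- (b/2 * x)))"
        using C(1) by (simp add: abs_mult mult.assoc)
    qed
  qed
qed

lemma sqint_poly_exp:
  fixes p :: "real poly"
  assumes "b > 0" shows "sqint HL (\<lambda>x. exp (- (b * x / 2)) * poly p x)"
proof -
  have "(exp (- (b * x / 2)) * poly p x)\<^sup>2 = poly (p * p) x * exp (- (b * x))" for x
    by (simp add: power_mult_distrib power2_eq_square flip: exp_add)
  then show ?thesis unfolding sqint_def
    using integrable_poly_exp[OF assms, of "p * p"]
    by (auto intro!: continuous_HL_measurable continuous_intros)
qed

text \<open>The general element of the spectral space.\<close>

definition laguerre_fun :: "real \<Rightarrow> real poly \<Rightarrow> real \<Rightarrow> real" where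
  "laguerre_fun b p x = exp (- (b * x / 2)) * poly p x"

lemma H1_pair_laguerre_fun:
  assumes "b > 0"
  shows "H1_pair (laguerre_fun b p) (laguerre_fun b (pderiv p - smult (b/2) p))"
  unfolding H1_pair_def
proof (intro conjI)
  show "primitive (laguerre_fun b p) (laguerre_fun b (pderiv p - smult (b/2) p))"
    unfolding laguerre_fun_def[abs_def]
    by (rule primitive_C1)
       (auto intro!: derivative_eq_intros continuous_intros poly_DERIV simp: algebra_simps)
  show "(laguerre_fun b p \<longlongrightarrow> 0) at_top"
    using poly_exp_tendsto_0[of "b/2" p] assms unfolding laguerre_fun_def[abs_def]
    by (simp add: mult.commute)
  show "continuous_on {0..} (laguerre_fun b p)" 
    unfolding laguerre_fun_def[abs_def] by (intro continuous_intros) auto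
  show "sqint HL (laguerre_fun b p)" "sqint HL (laguerre_fun b (pderiv p - smult (b/2) p))"
    using sqint_poly_exp[OF assms] unfolding laguerre_fun_def[abs_def] by blast+
qed

lemma represents_self:
  assumes "H1_pair h g" shows "represents h h g"
  using assms locally_integrable_primitive by (auto simp: represents_def continuous_rep_def H1_pair_def)

lemma X_space_iff: "v \<in> X_space b N \<longleftrightarrow> (\<exists>p. degree p \<le> N \<and> v = laguerre_fun b p)"
  by (auto simp: X_space_def laguerre_fun_def[abs_def])

section \<open>Rodrigues' formula\<close>

lemma integral_monomial_exp:
  assumes "b > 0"
  shows "(LINT x|HL. x ^ n * exp (- (b * x))) = fact n / b ^ Suc n"
proof (induction n)
  have int: "integrable HL (\<lambda>x. x ^ n * exp (- (b * x)))" for n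
    using integrable_poly_exp[OF assms, of "monom 1 n"] by (simp add: poly_monom)
  have lim: "((\<lambda>x. x ^ n * exp (- (b * x))) \<longlongrightarrow> 0) at_top" for n
    using poly_exp_tendsto_0[OF assms, of "monom 1 n"] by (simp add: poly_monom)
  have lim0: "((\<lambda>x. x ^ n * exp (- (b * x))) \<longlongrightarrow> 0 ^ n * exp (- (b * 0))) (at_right 0)" for n
    by (intro tendsto_intros)
  {
    case 0
    have "(LINT x|HL. (-b) * (x ^ 0 * exp (- (b * x)))) = 0 - 1"
    proof (rule integral_HL_primitive)
      show "primitive (\<lambda>x. x ^ 0 * exp (- (b * x))) (\<lambda>x. (-b) * (x ^ 0 * exp (- (b * x))))"
        by (rule primitive_C1) (auto intro!: derivative_eq_intros continuous_intros)
      show "integrable HL (\<lambda>x. (-b) * (x ^ 0 * exp (- (b * x))))" by (intro integrable_mult_right int)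
    qed (use lim[of 0] lim0[of 0] in auto)
    then have "b * (LINT x|HL. x ^ 0 * exp (- (b * x))) = 1" by simp
    then show ?case using assms by (simp add: field_simps)
  next
    case (Suc n)
    have "(LINT x|HL. real (Suc n) * (x ^ n * exp (- (b * x))) - b * (x ^ Suc n * exp (- (b * x)))) = 0 - 0"
    proof (rule integral_HL_primitive)
      show "primitive (\<lambda>x. x ^ Suc n * exp (- (b * x))) (\<lambda>x. real (Suc n) * (x ^ n * exp (- (b * x))) - b * (x ^ Suc n * exp (- (b * x))))"
      proof (rule primitive_C1)
        fix x :: real
        have "((\<lambda>x. exp (- (b * x))) has_real_derivative - b * exp (- (b * x))) (at x)"
          by (auto intro!: derivative_eq_intros)
        from DERIV_mult[OF DERIV_pow[of "Suc n" x UNIV] this]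
        show "((\<lambda>x. x ^ Suc n * exp (- (b * x))) has_real_derivative real (Suc n) * (x ^ n * exp (- (b * x))) - b * (x ^ Suc n * exp (- (b * x)))) (at x)"
          by (rule DERIV_cong) (simp add: algebra_simps)
      qed (intro continuous_intros)
      show "integrable HL (\<lambda>x. real (Suc n) * (x ^ n * exp (- (b * x))) - b * (x ^ Suc n * exp (- (b * x))))"
        by (intro Bochner_Integration.integrable_diff integrable_mult_right int)
    qed (use lim[of "Suc n"] lim0[of "Suc n"] in auto)
    moreover have "(LINT x|HL. real (Suc n) * (x ^ n * exp (- (b * x))) - b * (x ^ Suc n * exp (- (b * x))))
      = real (Suc n) * (LINT x|HL. x ^ n * exp (- (b * x))) - b * (LINT x|HL. x ^ Suc n * exp (- (b * x)))"
      by (subst Bochner_Integration.integral_diff) (auto intro!: integrable_mult_right int simp del: power_Suc of_nat_Suc)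
    ultimately have "b * (LINT x|HL. x ^ Suc n * exp (- (b * x))) = real (Suc n) * (fact n / b ^ Suc n)"
      using Suc by simp
    then have "(LINT x|HL. x ^ Suc n * exp (- (b * x))) = real (Suc n) * (fact n / b ^ Suc n) / b"
      using assms by (simp add: field_simps)
    then show ?case by (simp del: of_nat_Suc power_Suc add: power_Suc2[of b "Suc n"])
  }
qed

text \<open>For j \<le> n, the j-th derivative of x^n e^(-bx) is x^(n-j) e^(-bx) times the polynomial defined
here.\<close>

primrec rodrigues :: "real \<Rightarrow> nat \<Rightarrow> nat \<Rightarrow> real poly" where
  "rodrigues b n 0 = 1"
| "rodrigues b n (Suc j) = smult (real n - real j) (rodrigues b n j)
     + [:0, 1:] * (pderiv (rodrigues b n j) - smult b (rodrigues b n j))"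

text \<open>The index k is the power of x that remains, rather than the number of derivatives taken. These
polynomials are multiples of the associated Laguerre polynomials of order k and degree n - k,
evaluated at bx.\<close>

definition rodrigues_poly :: "real \<Rightarrow> nat \<Rightarrow> nat \<Rightarrow> real poly" where
  "rodrigues_poly b n k = smult (1 / fact n) (rodrigues b n (n - k))"

definition rodrigues_fun :: "real \<Rightarrow> nat \<Rightarrow> nat \<Rightarrow> real \<Rightarrow> real" where
  "rodrigues_fun b n k x = x ^ k * exp (- (b * x)) * poly (rodrigues_poly b n k) x"

lemma rodrigues_degree:
  "degree (rodrigues b n j) \<le> j \<and> coeff (rodrigues b n j) j = (- b) ^ j"
proof (induction j)
  case (Suc j)
  let ?R = "rodrigues b n j"
  have z: "coeff ?R i = 0" if "i > j" for i using Suc that by (auto intro: coeff_eq_0)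
  have "coeff (rodrigues b n (Suc j)) i = 0" if "i > Suc j" for i
    using that z by (cases i) (auto simp: coeff_pCons coeff_pderiv)
  then have "degree (rodrigues b n (Suc j)) \<le> Suc j" by (intro degree_le) auto
  moreover have "coeff (rodrigues b n (Suc j)) (Suc j) = (- b) ^ Suc j"
    using Suc z[of "Suc j"] by (simp add: coeff_pCons coeff_pderiv)
  ultimately show ?case by blast
qed simp

lemma rodrigues_poly_degree:
  assumes "k \<le> n"
  shows "degree (rodrigues_poly b n k) \<le> n - k" "coeff (rodrigues_poly b n k) (n - k) = (- b) ^ (n - k) / fact n"
  using rodrigues_degree[of b n "n - k"] by (auto simp: rodrigues_poly_def)

lemma rodrigues_fun_has_derivative:
  assumes "k < n"
  shows "(rodrigues_fun b n (Suc k) has_real_derivative rodrigues_fun b n k x) (at x)"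
proof -
  define j where "j = n - Suc k"
  have j: "n - k = Suc j" "n - Suc k = j" "real n - real j = real (Suc k)" using assms by (auto simp: j_def)
  have "((\<lambda>x. x ^ Suc k * exp (- (b * x)) * poly (smult (1 / fact n) (rodrigues b n j)) x) has_real_derivative
     x ^ k * exp (- (b * x)) * poly (smult (1 / fact n) (rodrigues b n (Suc j))) x) (at x)"
    by (rule derivative_eq_intros poly_DERIV refl | simp)+
       (simp add: j(3) pderiv_smult field_simps)
  then show ?thesis unfolding rodrigues_fun_def[abs_def] rodrigues_poly_def j .
qed

lemma rodrigues_fun_continuous: "continuous_on S (rodrigues_fun b n k)"
  unfolding rodrigues_fun_def[abs_def] by (intro continuous_intros)

section \<open>Growth that makes boundary terms vanish\<close>

text \<open>The borderline for integrability of G against x^m e^(-bx) is x^(-m-1) at 0 and e^(bx) at infinity.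
The exponents used here stay strictly below it at both ends, and antidifferentiation leads from
index m + 1 to index m.\<close>

definition tame :: "real \<Rightarrow> nat \<Rightarrow> (real \<Rightarrow> real) \<Rightarrow> bool" where
  "tame b m G \<longleftrightarrow> (\<exists>C\<ge>0. \<forall>x>0. \<bar>G x\<bar> \<le> C * (1 / (x ^ m * sqrt x) + exp (b * x / 2)))"

lemma tameI:
  assumes "\<And>x. x > 0 \<Longrightarrow> \<bar>G x\<bar> \<le> C * (1 / (x ^ m * sqrt x) + exp (b * x / 2))"
  shows "tame b m G"
  unfolding tame_def
proof (intro exI[of _ "\<bar>C\<bar>"] conjI allI impI)
  fix x :: real assume "x > 0"
  then have "C * (1 / (x ^ m * sqrt x) + exp (b * x / 2)) \<le> \<bar>C\<bar> * (1 / (x ^ m * sqrt x) + exp (b * x / 2))"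
    by (intro mult_right_mono) (auto intro!: add_nonneg_nonneg)
  with assms[OF \<open>x > 0\<close>] show "\<bar>G x\<bar> \<le> \<bar>C\<bar> * (1 / (x ^ m * sqrt x) + exp (b * x / 2))" by linarith
qed simp

lemma tame_exp_bound:
  assumes "\<And>x. x > 0 \<Longrightarrow> \<bar>G x\<bar> \<le> C * exp (b * x / 2)"
  shows "tame b m G"
proof (rule tameI)
  fix x :: real assume x: "x > 0"
  have "0 \<le> C * exp (b * x / 2)" using assms[OF x] abs_ge_zero order_trans by blast
  then have "C \<ge> 0" by (simp add: zero_le_mult_iff)
  then have "C * exp (b * x / 2) \<le> C * (1 / (x ^ m * sqrt x) + exp (b * x / 2))"
    using x by (intro mult_left_mono) auto
  with assms[OF x] show "\<bar>G x\<bar> \<le> C * (1 / (x ^ m * sqrt x) + exp (b * x / 2))" by linarith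
qed

lemma tame_poly:
  assumes "b > 0" shows "tame b m (poly p)"
proof -
  obtain C where C: "C > 0" "\<And>x. x \<ge> 0 \<Longrightarrow> \<bar>poly p x * exp (- (b/2 * x))\<bar> \<le> C"
    by (rule continuous_tendsto_0_bounded[OF _ poly_exp_tendsto_0[of "b/2" p]]) (use assms in \<open>auto intro!: continuous_intros\<close>)
  show ?thesis
  proof (rule tame_exp_bound)
    fix x :: real assume "x > 0"
    then show "\<bar>poly p x\<bar> \<le> C * exp (b * x / 2)"
      using C(2)[of x] by (simp add: abs_mult exp_minus field_simps)
  qed
qed

text \<open>A majorant for the singularity x^(-1/2) that has an elementary bounded antiderivative.\<close>

lemma integrable_inverse_sqrt: "integrable HL (\<lambda>x. 1 / (sqrt x * (1 + x)))"
proof (rule integrable_HL_primitive)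
  show "primitive (\<lambda>x. 2 * arctan (sqrt x)) (\<lambda>x. 1 / (sqrt x * (1 + x)))"
  proof (rule primitive_C1)
    fix x :: real assume x: "x > 0"
    have "((\<lambda>x. 2 * arctan (sqrt x)) has_real_derivative 2 * (inverse (1 + (sqrt x)\<^sup>2) * (inverse (sqrt x) / 2))) (at x)"
      by (intro DERIV_cmult DERIV_chain2[OF DERIV_arctan DERIV_real_sqrt[OF x]])
    moreover have "2 * (inverse t * (inverse s / 2)) = 1 / (s * t)" for s t :: real
      by (simp add: inverse_eq_divide)
    ultimately show "((\<lambda>x. 2 * arctan (sqrt x)) has_real_derivative 1 / (sqrt x * (1 + x))) (at x)"
      using x by (simp only:) simp
  qed (auto intro!: continuous_intros)
  show "\<bar>2 * arctan (sqrt x)\<bar> \<le> pi" if "x > 0" for x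
    using arctan_bounded[of "sqrt x"] by (auto simp: abs_le_iff)
qed simp

lemma tame_pointwise:
  assumes "\<bar>G x\<bar> \<le> C * (1 / (x ^ m * sqrt x) + exp (b * x / 2))" "x > 0"
  shows "\<bar>G x * (x ^ m * exp (- (b * x)) * poly p x)\<bar>
     \<le> C * (1 / sqrt x * \<bar>poly p x * exp (- (b * x))\<bar> + \<bar>x ^ m * poly p x * exp (- (b/2 * x))\<bar>)"
proof -
  have "\<bar>G x * (x ^ m * exp (- (b * x)) * poly p x)\<bar> = \<bar>G x\<bar> * (x ^ m * exp (- (b * x)) * \<bar>poly p x\<bar>)"
    using assms(2) by (simp add: abs_mult)
  also have "\<dots> \<le> (C * (1 / (x ^ m * sqrt x) + exp (b * x / 2))) * (x ^ m * exp (- (b * x)) * \<bar>poly p x\<bar>)"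
    using assms by (intro mult_right_mono) auto
  also have "\<dots> = C * (1 / sqrt x * (\<bar>poly p x\<bar> * exp (- (b * x))) + x ^ m * \<bar>poly p x\<bar> * (exp (b * x / 2) * exp (- (b * x))))"
    using assms(2) by (simp add: field_simps)
  also have "exp (b * x / 2) * exp (- (b * x)) = exp (- (b/2 * x))" by (simp flip: exp_add)
  finally show ?thesis using assms(2) by (simp add: abs_mult)
qed

lemma tame_integrable:
  assumes "b > 0" "tame b m G" "G \<in> borel_measurable HL"
  shows "integrable HL (\<lambda>x. G x * (x ^ m * exp (- (b * x)) * poly p x))"
proof -
  obtain C where C: "C \<ge> 0" "\<And>x. x > 0 \<Longrightarrow> \<bar>G x\<bar> \<le> C * (1 / (x ^ m * sqrt x) + exp (b * x / 2))"
    using assms(2) unfolding tame_def by blast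
  obtain D where D: "D > 0" "\<And>x. x \<ge> 0 \<Longrightarrow> \<bar>poly ([:1, 1:] * p) x * exp (- (b * x))\<bar> \<le> D"
    by (rule continuous_tendsto_0_bounded[OF _ poly_exp_tendsto_0[OF assms(1), of "[:1, 1:] * p"]]) (auto intro!: continuous_intros)
  show ?thesis
  proof (rule Bochner_Integration.integrable_bound)
    have "integrable HL (\<lambda>x. \<bar>poly (monom 1 m * p) x * exp (- (b/2 * x))\<bar>)"
      by (rule integrable_abs[OF integrable_poly_exp]) (use assms(1) in simp)
    then show "integrable HL (\<lambda>x. C * (D * (1 / (sqrt x * (1 + x))) + \<bar>x ^ m * poly p x * exp (- (b/2 * x))\<bar>))"
      using integrable_inverse_sqrt by (intro integrable_mult_right Bochner_Integration.integrable_add) (auto simp: poly_monom)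
    show "(\<lambda>x. G x * (x ^ m * exp (- (b * x)) * poly p x)) \<in> borel_measurable HL"
      by (intro borel_measurable_times assms(3) continuous_HL_measurable continuous_intros)
    show "AE x in HL. norm (G x * (x ^ m * exp (- (b * x)) * poly p x))
       \<le> norm (C * (D * (1 / (sqrt x * (1 + x))) + \<bar>x ^ m * poly p x * exp (- (b/2 * x))\<bar>))"
    proof (rule AE_I2)
      fix x assume "x \<in> space HL" then have x: "x > 0" by simp
      have "1 / sqrt x * \<bar>poly p x * exp (- (b * x))\<bar> = 1 / (sqrt x * (1 + x)) * \<bar>poly ([:1, 1:] * p) x * exp (- (b * x))\<bar>"
      proof -
        have "poly ([:1, 1:] * p) x = (1 + x) * poly p x" by (simp add: algebra_simps)
        then have "\<bar>poly ([:1, 1:] * p) x * exp (- (b * x))\<bar> = (1 + x) * \<bar>poly p x * exp (- (b * x))\<bar>"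
          using x by (simp only: abs_mult)
        moreover have "1 / s * q = 1 / (s * t) * (t * q)" if "s > 0" "t > 0" for s t q :: real
          using that by (simp add: field_simps)
        ultimately show ?thesis using x by (metis add_pos_pos real_sqrt_gt_zero zero_less_one)
      qed
      also have "\<dots> \<le> 1 / (sqrt x * (1 + x)) * D"
        using x by (intro mult_left_mono D(2)) auto
      finally have "C * (1 / sqrt x * \<bar>poly p x * exp (- (b * x))\<bar> + \<bar>x ^ m * poly p x * exp (- (b/2 * x))\<bar>)
         \<le> C * (D * (1 / (sqrt x * (1 + x))) + \<bar>x ^ m * poly p x * exp (- (b/2 * x))\<bar>)"
        using C(1) by (intro mult_left_mono) (auto simp: mult.commute)
      with tame_pointwise[where p=p and G=G and m=m and b=b and C=C and x=x, OF C(2)[OF x] x]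
      show "norm (G x * (x ^ m * exp (- (b * x)) * poly p x))
       \<le> norm (C * (D * (1 / (sqrt x * (1 + x))) + \<bar>x ^ m * poly p x * exp (- (b/2 * x))\<bar>))"
        by (simp only: real_norm_def)
    qed
  qed
qed

lemma tame_tendsto_0:
  assumes "b > 0" "tame b m G"
  shows "((\<lambda>x. G x * (x ^ Suc m * exp (- (b * x)) * poly p x)) \<longlongrightarrow> 0) at_top"
    "((\<lambda>x. G x * (x ^ Suc m * exp (- (b * x)) * poly p x)) \<longlongrightarrow> 0) (at_right 0)"
proof -
  obtain C where C: "C \<ge> 0" "\<And>x. x > 0 \<Longrightarrow> \<bar>G x\<bar> \<le> C * (1 / (x ^ m * sqrt x) + exp (b * x / 2))"
    using assms(2) unfolding tame_def by blast
  define B where "B x = C * (sqrt x * \<bar>poly p x * exp (- (b * x))\<bar> + \<bar>x ^ Suc m * poly p x * exp (- (b/2 * x))\<bar>)" for x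
  have le: "norm (G x * (x ^ Suc m * exp (- (b * x)) * poly p x)) \<le> B x" if x: "x > 0" for x
  proof -
    have "\<bar>G x * (x ^ m * exp (- (b * x)) * poly ([:0, 1:] * p) x)\<bar>
     \<le> C * (1 / sqrt x * \<bar>poly ([:0, 1:] * p) x * exp (- (b * x))\<bar> + \<bar>x ^ m * poly ([:0, 1:] * p) x * exp (- (b/2 * x))\<bar>)"
      using x by (intro tame_pointwise C(2))
    moreover have "1 / sqrt x * \<bar>poly ([:0, 1:] * p) x * exp (- (b * x))\<bar> = sqrt x * \<bar>poly p x * exp (- (b * x))\<bar>"
    proof -
      have "1 / sqrt x * \<bar>poly ([:0, 1:] * p) x * exp (- (b * x))\<bar> = x / sqrt x * \<bar>poly p x * exp (- (b * x))\<bar>"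
        using x by (simp add: abs_mult)
      then show ?thesis using x by (simp only: real_div_sqrt[OF less_imp_le[OF x]])
    qed
    ultimately show ?thesis unfolding B_def by (simp add: mult_ac)
  qed
  have "((\<lambda>x. C * (\<bar>poly ([:1, 1:] * p) x * exp (- (b * x))\<bar> + \<bar>poly (monom 1 (Suc m) * p) x * exp (- (b/2 * x))\<bar>)) \<longlongrightarrow> C * (\<bar>0\<bar> + \<bar>0\<bar>)) at_top"
    using assms(1) by (intro tendsto_intros poly_exp_tendsto_0) auto
  then have z: "((\<lambda>x. C * (\<bar>poly ([:1, 1:] * p) x * exp (- (b * x))\<bar> + \<bar>x ^ Suc m * poly p x * exp (- (b/2 * x))\<bar>)) \<longlongrightarrow> 0) at_top"
    by (simp add: poly_monom mult_ac)
  show "((\<lambda>x. G x * (x ^ Suc m * exp (- (b * x)) * poly p x)) \<longlongrightarrow> 0) at_top"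
  proof (rule Lim_null_comparison[OF _ z])
    show "\<forall>\<^sub>F x in at_top. norm (G x * (x ^ Suc m * exp (- (b * x)) * poly p x)) \<le>
      C * (\<bar>poly ([:1, 1:] * p) x * exp (- (b * x))\<bar> + \<bar>x ^ Suc m * poly p x * exp (- (b/2 * x))\<bar>)"
      using eventually_gt_at_top[of 0]
    proof eventually_elim
      case (elim x)
      have "sqrt x \<le> 1 + x"
        using elim by (intro real_le_lsqrt) (auto simp: power2_eq_square algebra_simps)
      then have "sqrt x * \<bar>poly p x * exp (- (b * x))\<bar> \<le> (1 + x) * \<bar>poly p x * exp (- (b * x))\<bar>"
        by (intro mult_right_mono) auto
      also have "\<dots> = \<bar>poly ([:1, 1:] * p) x * exp (- (b * x))\<bar>"
      proof -
        have "poly ([:1, 1:] * p) x = (1 + x) * poly p x" by (simp add: algebra_simps)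
        then show ?thesis using elim by (simp only: abs_mult)
      qed
      finally have "B x \<le> C * (\<bar>poly ([:1, 1:] * p) x * exp (- (b * x))\<bar> + \<bar>x ^ Suc m * poly p x * exp (- (b/2 * x))\<bar>)"
        unfolding B_def using C(1) by (intro mult_left_mono) auto
      with le[OF elim] show ?case by linarith
    qed
  qed
  have "(B \<longlongrightarrow> C * (sqrt 0 * \<bar>poly p 0 * exp (- (b * 0))\<bar> + \<bar>0 ^ Suc m * poly p 0 * exp (- (b/2 * 0))\<bar>)) (at_right 0)"
    unfolding B_def by (intro tendsto_intros)
  then have z0: "(B \<longlongrightarrow> 0) (at_right 0)" by simp
  show "((\<lambda>x. G x * (x ^ Suc m * exp (- (b * x)) * poly p x)) \<longlongrightarrow> 0) (at_right 0)"
    by (rule Lim_null_comparison[OF _ z0]) (use le in \<open>auto simp: eventually_at_filter\<close>)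
qed

lemma power_sqrt_powr:
  assumes "x > 0" shows "x powr (- (real m + 1 / 2)) = 1 / (x ^ m * sqrt x)"
  using assms by (simp only: powr_minus powr_add powr_realpow powr_half_sqrt[OF less_imp_le] inverse_eq_divide)

text \<open>An explicit antiderivative of the bound for index m + 1; its terms have the shape of the bound for
index m.\<close>

lemma primitive_tame_bound:
  assumes "b > 0"
  shows "primitive (\<lambda>x. - (1 / (x ^ m * sqrt x)) / (real m + 1 / 2) + 2 / b * exp (b * x / 2))
    (\<lambda>x. 1 / (x ^ Suc m * sqrt x) + exp (b * x / 2))"
proof (rule primitive_cong)
  show "primitive (\<lambda>x. - (x powr (- (real m + 1 / 2))) / (real m + 1 / 2) + 2 / b * exp (b * x / 2))
    (\<lambda>x. x powr (- (real (Suc m) + 1 / 2)) + exp (b * x / 2))"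
  proof (rule primitive_C1)
    fix x :: real assume x: "x > 0"
    have 1: "((\<lambda>x. x powr (- (real m + 1 / 2))) has_real_derivative (- (real m + 1 / 2)) * x powr (- (real m + 1 / 2) - 1)) (at x)"
      by (rule has_real_derivative_powr[OF x])
    have "((\<lambda>x. - (x powr (- (real m + 1 / 2))) / (real m + 1 / 2)) has_real_derivative
       - ((- (real m + 1 / 2)) * x powr (- (real m + 1 / 2) - 1)) / (real m + 1 / 2)) (at x)"
      by (intro DERIV_cdivide DERIV_minus 1)
    moreover have "- ((- (real m + 1 / 2)) * x powr (- (real m + 1 / 2) - 1)) / (real m + 1 / 2) = x powr (- (real m + 1 / 2) - 1)"
      by (simp add: field_simps)
    moreover have "- (real m + 1 / 2) - 1 = - (real (Suc m) + 1 / 2)" by simp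
    ultimately have d1: "((\<lambda>x. - (x powr (- (real m + 1 / 2))) / (real m + 1 / 2)) has_real_derivative x powr (- (real (Suc m) + 1 / 2))) (at x)"
      by (simp only:)
    have d2: "((\<lambda>x. 2 / b * exp (b * x / 2)) has_real_derivative exp (b * x / 2)) (at x)"
      using assms by (auto intro!: derivative_eq_intros)
    show "((\<lambda>x. - (x powr (- (real m + 1 / 2))) / (real m + 1 / 2) + 2 / b * exp (b * x / 2)) has_real_derivative
       x powr (- (real (Suc m) + 1 / 2)) + exp (b * x / 2)) (at x)"
      by (rule DERIV_add[OF d1 d2])
  qed (auto intro!: continuous_intros)
qed (simp_all only: power_sqrt_powr)

lemma tame_antiderivative:
  assumes b: "b > 0" and G: "primitive G g" and t: "tame b (Suc m) g"
  shows "tame b m G"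
proof -
  obtain C where C: "C \<ge> 0" "\<And>x. x > 0 \<Longrightarrow> \<bar>g x\<bar> \<le> C * (1 / (x ^ Suc m * sqrt x) + exp (b * x / 2))"
    using t unfolding tame_def by blast
  define F where "F x = - (1 / (x ^ m * sqrt x)) / (real m + 1 / 2) + 2 / b * exp (b * x / 2)" for x
  have F: "primitive (\<lambda>x. C * F x) (\<lambda>x. C * (1 / (x ^ Suc m * sqrt x) + exp (b * x / 2)))"
    unfolding F_def by (rule primitive_cmult[OF primitive_tame_bound[OF b]])
  have diff: "\<bar>G x - G 1\<bar> \<le> C * \<bar>F x - F 1\<bar>" if x: "x > 0" for x
  proof (cases "x \<ge> 1")
    case True
    have "\<bar>G x - G 1\<bar> \<le> C * F x - C * F 1" by (rule primitive_comparison[OF G F _ True]) (use C in auto)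
    also have "\<dots> \<le> C * \<bar>F x - F 1\<bar>" unfolding right_diff_distrib[symmetric] using C(1) by (intro mult_left_mono) auto
    finally show ?thesis .
  next
    case False
    have "\<bar>G 1 - G x\<bar> \<le> C * F 1 - C * F x" by (rule primitive_comparison[OF G F x]) (use False C x in auto)
    also have "\<dots> \<le> C * \<bar>F x - F 1\<bar>" unfolding right_diff_distrib[symmetric] using C(1) by (intro mult_left_mono) auto
    finally show ?thesis by (simp add: abs_minus_commute)
  qed
  define K where "K = \<bar>G 1\<bar> + C * \<bar>F 1\<bar>"
  show ?thesis
  proof (rule tameI)
    fix x :: real assume x: "x > 0"
    define P E where "P = 1 / (x ^ m * sqrt x)" and "E = exp (b * x / 2)"
    have PE: "P \<ge> 0" "E \<ge> 1" using x b by (auto simp: P_def E_def)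
    have "P / (real m + 1 / 2) \<le> P / (1 / 2)" using PE by (intro divide_left_mono) auto
    moreover have "\<bar>F x\<bar> \<le> P / (real m + 1 / 2) + 2 / b * E"
    proof -
      have "F x = - (P / (real m + 1 / 2)) + 2 / b * E" by (simp add: F_def P_def E_def)
      moreover have "0 \<le> P / (real m + 1 / 2)" "0 \<le> 2 / b * E" using PE b by auto
      ultimately show ?thesis by linarith
    qed
    ultimately have "\<bar>F x\<bar> \<le> 2 * P + 2 / b * E" by simp
    then have Fx: "C * \<bar>F x\<bar> \<le> C * (2 * P + 2 / b * E)" using C(1) by (rule mult_left_mono)
    have "C * \<bar>F x - F 1\<bar> \<le> C * (\<bar>F x\<bar> + \<bar>F 1\<bar>)" using C(1) by (intro mult_left_mono) auto
    with diff[OF x] Fx have "\<bar>G x\<bar> \<le> C * (2 * P + 2 / b * E) + K" unfolding K_def distrib_left by linarith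
    also have "K \<le> K * E"
    proof -
      have "K \<ge> 0" using C(1) by (simp add: K_def)
      from mult_left_mono[OF PE(2) this] show ?thesis by simp
    qed
    also have "C * (2 * P + 2 / b * E) + K * E \<le> (2 * C + C * (2 / b) + K) * (P + E)"
    proof -
      have "(2 * C + C * d + K) * (P + E) = C * (2 * P + d * E) + K * E + (2 * C * E + C * d * P + K * P)" for d
        by (simp add: algebra_simps)
      moreover have "0 \<le> 2 * C * E + C * (2 / b) * P + K * P" using PE C(1) b by (simp add: K_def)
      ultimately show ?thesis by (simp only:)
    qed
    finally show "\<bar>G x\<bar> \<le> (2 * C + C * (2 / b) + K) * (1 / (x ^ m * sqrt x) + exp (b * x / 2))"
      by (simp add: P_def E_def)
  qed
qed

text \<open>For every l > 0, Young's inequality gives \<open>\<bar>g\<bar>\<close> \<le> (l g^2 y^(m+1)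
e^(-by) + y^(-m-1) e^(by) / l) / 2, which is integrated between 1 and x. Close to 0 the value l =
1 is good enough. For large x the two terms balance when l = e^(bx/2).\<close>

lemma tame_of_weighted_sqint:
  assumes b: "b > 0" and G: "primitive G g"
    and i: "integrable HL (\<lambda>x. (g x)\<^sup>2 * (x ^ Suc m * exp (- (b * x))))"
  shows "tame b m G"
proof -
  define \<rho> where "\<rho> x = (g x)\<^sup>2 * (x ^ Suc m * exp (- (b * x)))" for x
  define S where "S = (LINT x|HL. \<rho> x)"
  have \<rho>nn: "\<rho> x \<ge> 0" if "x > 0" for x using that by (simp add: \<rho>_def)
  have loc: "\<rho> absolutely_integrable_on {s..t}" if "0 < s" for s t
  proof -
    have "set_integrable lebesgue half_line \<rho>" using i by (simp add: integrable_HL_iff \<rho>_def[abs_def])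
    then show ?thesis by (rule set_integrable_subset) (use that in auto)
  qed
  then obtain A where A: "primitive A \<rho>" using primitive_exists[OF locally_integrableI] by blast
  have AS: "A t - A s \<le> S" if "0 < s" "s \<le> t" for s t
  proof -
    have "A t - A s = (LINT x|HL. indicator {s..t} x * \<rho> x)"
      using primitiveD(3)[OF A that] integral_HL_Icc[OF that(1) loc[OF that(1)]] by simp
    also have "\<dots> \<le> S" unfolding S_def
    proof (rule integral_mono_AE')
      show "integrable HL \<rho>" using i by (simp add: \<rho>_def[abs_def])
    qed (use \<rho>nn in \<open>auto intro!: AE_I2 simp: indicator_def\<close>)
    finally show ?thesis .
  qed
  have S: "S \<ge> 0" using AS[of 1 1] by simp
  have young: "\<bar>g y\<bar> \<le> (\<rho> y * l + exp (b * y) / y ^ Suc m / l) / 2" if y: "y > 0" and l: "l > 0" for y l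
  proof -
    define w where "w = y ^ Suc m * exp (- (b * y)) * l"
    have w: "w > 0" using y l by (simp add: w_def)
    have "0 \<le> (\<bar>g y\<bar> * w - 1)\<^sup>2 / w" using w by simp
    also have "\<dots> = (g y)\<^sup>2 * w + 1 / w - 2 * \<bar>g y\<bar>" using w by (simp add: field_simps power2_eq_square)
    finally have "\<bar>g y\<bar> \<le> ((g y)\<^sup>2 * w + 1 / w) / 2" by simp
    also have "1 / w = exp (b * y) / y ^ Suc m / l" by (simp add: w_def exp_minus field_simps)
    finally show ?thesis by (simp add: w_def \<rho>_def mult_ac)
  qed
  define K where "K = \<bar>G 1\<bar> + S + 1 / b + exp b"
  show ?thesis
  proof (rule tameI)
    fix x :: real assume x: "x > 0"
    define P E where "P = 1 / (x ^ m * sqrt x)" and "E = exp (b * x / 2)"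
    have PE: "P \<ge> 0" "E \<ge> 1" using x b by (auto simp: P_def E_def)
    have "\<bar>G x - G 1\<bar> \<le> (S + 1 / b) * E + exp b * P"
    proof (cases "x \<ge> 1")
      case True
      have "primitive (\<lambda>y. exp (b * y) / b) (\<lambda>y. exp (b * y))"
        by (rule primitive_C1) (use b in \<open>auto intro!: derivative_eq_intros continuous_intros\<close>)
      note p = primitive_cmult[OF primitive_add[OF primitive_cmult[OF A, of E] primitive_cmult[OF this, of "1 / E"]], of "1 / 2"]
      have "\<bar>G x - G 1\<bar> \<le> 1 / 2 * (E * A x + 1 / E * (exp (b * x) / b)) - 1 / 2 * (E * A 1 + 1 / E * (exp (b * 1) / b))"
      proof (rule primitive_comparison[OF G p _ True])
        fix y assume y: "y \<in> {1..x}"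
        then have "1 \<le> y ^ Suc m" by (intro one_le_power) auto
        then have "exp (b * y) / y ^ Suc m \<le> exp (b * y) / 1" by (intro divide_left_mono) auto
        then have "exp (b * y) / y ^ Suc m / E \<le> exp (b * y) / E" using PE by (intro divide_right_mono) auto
        with young[of y E] y PE show "\<bar>g y\<bar> \<le> 1 / 2 * (E * \<rho> y + 1 / E * exp (b * y))" by (auto simp: mult.commute)
      qed simp
      also have "\<dots> \<le> 1 / 2 * (E * (A x - A 1) + 1 / E * (exp (b * x) / b))"
      proof -
        have "0 \<le> 1 / E * (exp (b * 1) / b)" using PE b by simp
        moreover have "1 / 2 * (p + u) - 1 / 2 * (q + v) \<le> 1 / 2 * (p - q + u)" if "0 \<le> v" for p q u v :: real
          using that by (simp add: field_simps)
        ultimately show ?thesis unfolding right_diff_distrib[of E] by blast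
      qed
      also have "\<dots> \<le> 1 / 2 * (E * S + 1 / E * (exp (b * x) / b))"
        using AS[of 1 x] True PE by simp
      also have "exp (b * x) = E * E" by (simp add: E_def flip: exp_add)
      also have "1 / 2 * (E * S + 1 / E * (E * E / b)) \<le> E * S + E / b"
      proof -
        have "1 / E * (E * E / b) = E / b" using PE by simp
        moreover have "1 / 2 * (p + q) \<le> p + q" if "0 \<le> p" "0 \<le> q" for p q :: real using that by simp
        moreover have "0 \<le> E * S" "0 \<le> E / b" using PE S b by auto
        ultimately show ?thesis by (simp only:)
      qed
      also have "\<dots> = (S + 1 / b) * E" by (simp add: algebra_simps)
      finally show ?thesis using PE by (smt (verit) exp_ge_zero mult_nonneg_nonneg)
    next
      case False
      define q where "q = real m + 1 / 2"
      have q: "q \<ge> 1 / 2" by (simp add: q_def)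
      note p = primitive_cmult[OF primitive_add[OF A primitive_cmult[OF primitive_diff[OF primitive_tame_bound[OF b, of m] primitive_C1[of "\<lambda>x. 2 / b * exp (b * x / 2)" "\<lambda>x. exp (b * x / 2)"]], of "exp b"]], of "1 / 2"]
      have "\<bar>G 1 - G x\<bar> \<le> 1 / 2 * (A 1 + exp b * (- (1 / (1 ^ m * sqrt 1)) / (real m + 1 / 2) + 2 / b * exp (b * 1 / 2) - 2 / b * exp (b * 1 / 2)))
         - 1 / 2 * (A x + exp b * (- (1 / (x ^ m * sqrt x)) / (real m + 1 / 2) + 2 / b * exp (b * x / 2) - 2 / b * exp (b * x / 2)))"
      proof (rule primitive_comparison[OF G p x])
        fix y assume y: "y \<in> {x..1}"
        then have y0: "y > 0" using x by simp
        have "exp (b * y) / y ^ Suc m \<le> exp b * (1 / (y ^ Suc m * sqrt y))"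
        proof -
          have "sqrt y \<le> 1" using y by simp
          then have "y ^ Suc m * sqrt y \<le> y ^ Suc m" using y0 by (simp add: mult_left_le)
          then have "1 / y ^ Suc m \<le> 1 / (y ^ Suc m * sqrt y)" using y0 by (intro divide_left_mono) auto
          moreover have "exp (b * y) \<le> exp b" using y b by simp
          ultimately have "exp (b * y) * (1 / y ^ Suc m) \<le> exp b * (1 / (y ^ Suc m * sqrt y))"
            using y0 by (intro mult_mono) auto
          then show ?thesis by simp
        qed
        with young[OF y0, of 1] show "\<bar>g y\<bar> \<le> 1 / 2 * (\<rho> y + exp b * (1 / (y ^ Suc m * sqrt y) + exp (b * y / 2) - exp (b * y / 2)))" by simp
      qed (use False b in \<open>auto intro!: derivative_eq_intros continuous_intros\<close>)
      also have "\<dots> = 1 / 2 * ((A 1 - A x) + exp b * (P / q - 1 / q))" by (simp add: P_def q_def[symmetric] algebra_simps)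
      also have "\<dots> \<le> 1 / 2 * (S + exp b * (2 * P))"
      proof -
        have "P / q \<le> P / (1 / 2)" using q PE by (intro divide_left_mono) auto
        moreover have "1 / q \<ge> 0" using q by simp
        moreover have "u - v \<le> w" if "u \<le> w" "0 \<le> v" for u v w :: real using that by simp
        ultimately have "P / q - 1 / q \<le> P / (1 / 2)" by blast
        then have "P / q - 1 / q \<le> 2 * P" by simp
        then have "exp b * (P / q - 1 / q) \<le> exp b * (2 * P)" by (intro mult_left_mono) auto
        moreover have "A 1 - A x \<le> S" by (rule AS) (use False x in auto)
        ultimately show ?thesis by (intro mult_left_mono add_mono) auto
      qed
      also have "\<dots> \<le> S + exp b * P" using S by simp
      also have "S \<le> (S + 1 / b) * E"
        using S PE b mult_mono[of S "S + 1 / b" 1 E] by simp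
      finally show ?thesis by (simp add: abs_minus_commute)
    qed
    moreover have "(S + 1 / b) * E + exp b * P + \<bar>G 1\<bar> \<le> K * (P + E)"
    proof -
      have "\<bar>G 1\<bar> * 1 \<le> \<bar>G 1\<bar> * E" using PE by (intro mult_left_mono) auto
      moreover have "0 \<le> \<bar>G 1\<bar> * P" "0 \<le> (S + 1 / b) * P" "0 \<le> exp b * E" using PE S b by auto
      moreover have "(g + S + d + e) * (P + E) = (S + d) * E + e * P + g * E + (g * P + (S + d) * P + e * E)" for g d e
        by (simp add: algebra_simps)
      ultimately show ?thesis unfolding K_def by (smt (verit))
    qed
    ultimately show "\<bar>G x\<bar> \<le> K * (1 / (x ^ m * sqrt x) + exp (b * x / 2))"
      unfolding P_def[symmetric] E_def[symmetric] by linarith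
  qed
qed

text \<open>Only the last function of the chain is controlled directly. Each antiderivative gains one power of
x at 0 and keeps the growth at infinity.\<close>

lemma tame_chain:
  assumes b: "b > 0" and chain: "\<And>i. i < k \<Longrightarrow> primitive (G i) (G (Suc i))"
    and i: "integrable HL (\<lambda>x. (G k x)\<^sup>2 * (x ^ k * exp (- (b * x))))" and "j < k"
  shows "tame b j (G j)"
proof -
  have "d < k \<Longrightarrow> tame b (k - Suc d) (G (k - Suc d))" for d
  proof (induction d)
    case 0
    then have k: "Suc (k - 1) = k" by simp
    have "tame b (k - 1) (G (k - 1))"
      by (rule tame_of_weighted_sqint[OF b chain[of "k - 1"]]) (use i 0 k in auto)
    then show ?case by simp
  next
    case (Suc d)
    then have d: "d < k" by simp
    define l where "l = k - Suc (Suc d)"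
    have l: "k - Suc d = Suc l" "l < k" using Suc.prems by (auto simp: l_def)
    have "tame b (Suc l) (G (Suc l))" using Suc.IH[OF d] unfolding l .
    then have "tame b l (G l)" by (rule tame_antiderivative[OF b chain[OF l(2)]])
    then show ?case by (simp only: l_def)
  qed
  from this[of "k - Suc j"] show ?thesis using assms(4) by simp
qed

section \<open>Orthogonality of the Rodrigues polynomials\<close>

lemma rodrigues_by_parts:
  assumes b: "b > 0" and G: "primitive G g" and t: "tame b k G" and k: "k < n"
    and i: "integrable HL (\<lambda>x. g x * rodrigues_fun b n (Suc k) x)"
  shows "(LINT x|HL. G x * rodrigues_fun b n k x) = - (LINT x|HL. g x * rodrigues_fun b n (Suc k) x)"
proof -
  have i2: "integrable HL (\<lambda>x. G x * rodrigues_fun b n k x)"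
    unfolding rodrigues_fun_def by (intro tame_integrable[OF b t] continuous_HL_measurable primitive_continuous[OF G])
  have "primitive (rodrigues_fun b n (Suc k)) (rodrigues_fun b n k)"
    by (intro primitive_C1 rodrigues_fun_has_derivative[OF k] rodrigues_fun_continuous)
  note p = primitive_mult[OF G this]
  have "(LINT x|HL. g x * rodrigues_fun b n (Suc k) x + G x * rodrigues_fun b n k x) = 0 - 0"
    by (rule integral_HL_primitive[OF p])
       (use i i2 tame_tendsto_0[OF b t, of "rodrigues_poly b n (Suc k)"] in \<open>auto simp: rodrigues_fun_def\<close>)
  then show ?thesis using i i2 by simp
qed

text \<open>Each step raises the remaining power of x by one, which matches the growth at 0 allowed for the
next function of the chain.\<close>

lemma rodrigues_by_parts_iterated:
  assumes b: "b > 0" and "k \<le> n"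
    and chain: "\<And>i. i < k \<Longrightarrow> primitive (G i) (G (Suc i))"
    and t: "\<And>i. i < k \<Longrightarrow> tame b i (G i)"
    and i: "integrable HL (\<lambda>x. G k x * rodrigues_fun b n k x)"
  shows "(LINT x|HL. G 0 x * rodrigues_fun b n 0 x) = (- 1) ^ k * (LINT x|HL. G k x * rodrigues_fun b n k x)"
proof -
  have int: "integrable HL (\<lambda>x. G j x * rodrigues_fun b n j x)" if "j \<le> k" for j
  proof (cases "j = k")
    case False
    with that have "j < k" by simp
    then show ?thesis unfolding rodrigues_fun_def
      by (intro tame_integrable[OF b t] continuous_HL_measurable primitive_continuous[OF chain])
  qed (use i in simp)
  have "j \<le> k \<Longrightarrow> (LINT x|HL. G 0 x * rodrigues_fun b n 0 x) = (- 1) ^ j * (LINT x|HL. G j x * rodrigues_fun b n j x)" for j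
  proof (induction j)
    case (Suc j)
    then have j: "j < k" "j < n" using assms(2) by auto
    have "(LINT x|HL. G j x * rodrigues_fun b n j x) = - (LINT x|HL. G (Suc j) x * rodrigues_fun b n (Suc j) x)"
      by (rule rodrigues_by_parts[OF b chain[OF j(1)] t[OF j(1)] j(2) int]) (use j in simp)
    with Suc j show ?case by simp
  qed simp
  then show ?thesis by blast
qed

lemma poly_rodrigues_by_parts:
  assumes b: "b > 0" and "k + i \<le> n"
  shows "(LINT x|HL. poly q x * rodrigues_fun b n k x) = (- 1) ^ i * (LINT x|HL. poly ((pderiv ^^ i) q) x * rodrigues_fun b n (k + i) x)"
  using assms(2)
proof (induction i)
  case (Suc i)
  let ?p = "(pderiv ^^ i) q"
  have "primitive (poly ?p) (poly (pderiv ?p))"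
    by (intro primitive_C1 poly_DERIV continuous_intros)
  moreover have "integrable HL (\<lambda>x. poly (pderiv ?p) x * rodrigues_fun b n (Suc (k + i)) x)"
    unfolding rodrigues_fun_def by (intro tame_integrable[OF b tame_poly[OF b]] continuous_HL_measurable continuous_intros)
  ultimately have "(LINT x|HL. poly ?p x * rodrigues_fun b n (k + i) x) = - (LINT x|HL. poly (pderiv ?p) x * rodrigues_fun b n (Suc (k + i)) x)"
    using Suc.prems by (intro rodrigues_by_parts[OF b _ tame_poly[OF b]]) auto
  with Suc show ?case by simp
qed simp

lemma pderiv_iterate_degree: "degree q \<le> d \<Longrightarrow> (pderiv ^^ d) q = [:fact d * coeff q d:]" for q :: "real poly"
proof (induction d arbitrary: q)
  case 0 then show ?case by (auto elim!: degree_eq_zeroE)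
next
  case (Suc d)
  have "degree (pderiv q) \<le> d" using Suc.prems by (simp add: degree_pderiv)
  from Suc.IH[OF this] show ?case by (simp add: funpow_swap1 coeff_pderiv mult_ac)
qed

lemma poly_rodrigues_integral:
  assumes b: "b > 0" and "k \<le> n" "degree q \<le> n - k"
  shows "(LINT x|HL. poly q x * rodrigues_fun b n k x) = (- 1) ^ (n - k) * (fact (n - k) * coeff q (n - k)) / b ^ Suc n"
proof -
  have "(LINT x|HL. poly q x * rodrigues_fun b n k x) = (- 1) ^ (n - k) * (LINT x|HL. (fact (n - k) * coeff q (n - k)) * rodrigues_fun b n n x)"
    using poly_rodrigues_by_parts[OF b, of k "n - k" n q] assms(2,3) by (simp add: pderiv_iterate_degree)
  also have "(LINT x|HL. (fact (n - k) * coeff q (n - k)) * rodrigues_fun b n n x) = (fact (n - k) * coeff q (n - k)) * (LINT x|HL. x ^ n * exp (- (b * x)) * (1 / fact n))"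
    by (subst Bochner_Integration.integral_mult_right_zero[symmetric]) (simp add: rodrigues_fun_def rodrigues_poly_def)
  also have "\<dots> = fact (n - k) * coeff q (n - k) / b ^ Suc n"
    by (simp add: integral_monomial_exp[OF b])
  finally show ?thesis by simp
qed

text \<open>For m < n, n - k integrations by parts annihilate the polynomial of degree m - k. For m = n they
leave its leading coefficient.\<close>

lemma rodrigues_poly_orthogonal:
  assumes b: "b > 0" and "k \<le> m" "k \<le> n"
  shows "(LINT x|HL. x ^ k * exp (- (b * x)) * (poly (rodrigues_poly b m k) x * poly (rodrigues_poly b n k) x))
    = (if m = n then fact (n - k) / fact n / b ^ Suc k else 0)"
proof -
  have less: "(LINT x|HL. poly (rodrigues_poly b m k) x * rodrigues_fun b n k x) = 0" if "m < n" "k \<le> m" "k \<le> n" for m n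
  proof -
    have "degree (rodrigues_poly b m k) < n - k" using rodrigues_poly_degree(1)[OF that(2), of b] that by linarith
    then show ?thesis using poly_rodrigues_integral[OF b that(3), of "rodrigues_poly b m k"] by (simp add: coeff_eq_0)
  qed
  have comm: "x ^ k * exp (- (b * x)) * (poly (rodrigues_poly b m k) x * poly (rodrigues_poly b n k) x) = poly (rodrigues_poly b m k) x * rodrigues_fun b n k x"
    "x ^ k * exp (- (b * x)) * (poly (rodrigues_poly b m k) x * poly (rodrigues_poly b n k) x) = poly (rodrigues_poly b n k) x * rodrigues_fun b m k x" for x
    by (simp_all add: rodrigues_fun_def)
  consider "m < n" | "n < m" | "m = n" by linarith
  then show ?thesis
  proof cases
    case 1 then show ?thesis using less[OF 1] assms unfolding comm(1) by simp
  next
    case 2 then show ?thesis using less[OF 2] assms unfolding comm(2) by simp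
  next
    case 3
    have "(- 1) ^ (n - k) * (- b) ^ (n - k) = b ^ (n - k)" by (simp flip: power_mult_distrib)
    then have "(LINT x|HL. poly (rodrigues_poly b n k) x * rodrigues_fun b n k x) = fact (n - k) / fact n * (b ^ (n - k) / b ^ Suc n)"
      using poly_rodrigues_integral[OF b assms(3) rodrigues_poly_degree(1)[OF assms(3)]] rodrigues_poly_degree(2)[OF assms(3), of b] by (simp add: mult_ac)
    also have "b ^ (n - k) / b ^ Suc n = 1 / b ^ Suc k"
      using b assms(3) by (simp add: field_simps flip: power_add)
    finally show ?thesis using 3 unfolding comm(1) by simp
  qed
qed

section \<open>Finite orthogonal expansions\<close>

lemma orthogonal_expansion:
  assumes "finite A" and f: "sqint M f" and e: "\<And>i. i \<in> A \<Longrightarrow> sqint M (e i)"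
    and orth: "\<And>i j. i \<in> A \<Longrightarrow> j \<in> A \<Longrightarrow> (LINT x|M. e i x * e j x) = (if i = j then \<nu> i else 0)"
  shows "(LINT x|M. (f x - (\<Sum>i\<in>A. a i * e i x))\<^sup>2)
     = (LINT x|M. (f x)\<^sup>2) - 2 * (\<Sum>i\<in>A. a i * (LINT x|M. f x * e i x)) + (\<Sum>i\<in>A. (a i)\<^sup>2 * \<nu> i)"
proof -
  have s: "sqint M (\<lambda>x. \<Sum>i\<in>A. a i * e i x)" by (intro sqint_sum sqint_cmult e)
  have "(LINT x|M. (f x - (\<Sum>i\<in>A. a i * e i x))\<^sup>2)
     = (LINT x|M. (f x)\<^sup>2 - 2 * (f x * (\<Sum>i\<in>A. a i * e i x)) + (\<Sum>i\<in>A. a i * e i x)\<^sup>2)"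
    by (simp add: power2_diff algebra_simps)
  also have "\<dots> = (LINT x|M. (f x)\<^sup>2) - 2 * (LINT x|M. f x * (\<Sum>i\<in>A. a i * e i x)) + (LINT x|M. (\<Sum>i\<in>A. a i * e i x)\<^sup>2)"
    using sqint_integrable[OF f] sqint_integrable[OF s] sqint_mult_integrable[OF f s] by simp
  also have "(LINT x|M. f x * (\<Sum>i\<in>A. a i * e i x)) = (\<Sum>i\<in>A. a i * (LINT x|M. f x * e i x))"
  proof -
    have "(LINT x|M. f x * (\<Sum>i\<in>A. a i * e i x)) = (LINT x|M. (\<Sum>i\<in>A. a i * (f x * e i x)))"
      by (simp add: sum_distrib_left mult_ac)
    also have "\<dots> = (\<Sum>i\<in>A. a i * (LINT x|M. f x * e i x))"
      by (subst Bochner_Integration.integral_sum) (auto intro!: integrable_mult_right sqint_mult_integrable f e)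
    finally show ?thesis .
  qed
  also have "(LINT x|M. (\<Sum>i\<in>A. a i * e i x)\<^sup>2) = (\<Sum>i\<in>A. (a i)\<^sup>2 * \<nu> i)"
  proof -
    have "(LINT x|M. (\<Sum>i\<in>A. a i * e i x)\<^sup>2) = (LINT x|M. (\<Sum>i\<in>A. \<Sum>j\<in>A. (a i * a j) * (e i x * e j x)))"
      by (simp add: power2_eq_square sum_product mult_ac)
    also have "\<dots> = (\<Sum>i\<in>A. LINT x|M. (\<Sum>j\<in>A. (a i * a j) * (e i x * e j x)))"
      by (rule Bochner_Integration.integral_sum) (auto intro!: Bochner_Integration.integrable_sum integrable_mult_right sqint_mult_integrable e)
    also have "\<dots> = (\<Sum>i\<in>A. \<Sum>j\<in>A. (a i * a j) * (LINT x|M. e i x * e j x))"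
    proof (rule sum.cong[OF refl])
      fix i assume "i \<in> A"
      then show "(LINT x|M. (\<Sum>j\<in>A. (a i * a j) * (e i x * e j x))) = (\<Sum>j\<in>A. (a i * a j) * (LINT x|M. e i x * e j x))"
        by (subst Bochner_Integration.integral_sum) (auto intro!: integrable_mult_right sqint_mult_integrable e)
    qed
    also have "\<dots> = (\<Sum>i\<in>A. \<Sum>j\<in>A. if i = j then (a i)\<^sup>2 * \<nu> i else 0)"
      by (intro sum.cong refl) (auto simp: orth power2_eq_square)
    finally show ?thesis using assms(1) by simp
  qed
  finally show ?thesis .
qed

text \<open>Completing the square in each coefficient.\<close>

lemma best_approximation:
  assumes "finite A" and f: "sqint M f" and e: "\<And>i. i \<in> A \<Longrightarrow> sqint M (e i)"
    and orth: "\<And>i j. i \<in> A \<Longrightarrow> j \<in> A \<Longrightarrow> (LINT x|M. e i x * e j x) = (if i = j then \<nu> i else 0)"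
    and \<nu>: "\<And>i. i \<in> A \<Longrightarrow> \<nu> i > 0"
  shows "(LINT x|M. (f x)\<^sup>2) - (\<Sum>i\<in>A. (LINT x|M. f x * e i x)\<^sup>2 / \<nu> i) \<le> (LINT x|M. (f x - (\<Sum>i\<in>A. a i * e i x))\<^sup>2)"
    and "(LINT x|M. (f x - (\<Sum>i\<in>A. (LINT x|M. f x * e i x) / \<nu> i * e i x))\<^sup>2)
      = (LINT x|M. (f x)\<^sup>2) - (\<Sum>i\<in>A. (LINT x|M. f x * e i x)\<^sup>2 / \<nu> i)"
proof -
  let ?c = "\<lambda>i. LINT x|M. f x * e i x"
  have "2 * (a i * ?c i) - (a i)\<^sup>2 * \<nu> i \<le> (?c i)\<^sup>2 / \<nu> i" if "i \<in> A" for i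
  proof -
    have "0 \<le> (?c i - a i * \<nu> i)\<^sup>2 / \<nu> i" using \<nu>[OF that] by simp
    also have "\<dots> = (?c i)\<^sup>2 / \<nu> i - 2 * (a i * ?c i) + (a i)\<^sup>2 * \<nu> i"
      using \<nu>[OF that] by (simp add: field_simps power2_eq_square)
    finally show ?thesis by linarith
  qed
  then have "(\<Sum>i\<in>A. 2 * (a i * ?c i) - (a i)\<^sup>2 * \<nu> i) \<le> (\<Sum>i\<in>A. (?c i)\<^sup>2 / \<nu> i)" by (rule sum_mono)
  then show "(LINT x|M. (f x)\<^sup>2) - (\<Sum>i\<in>A. (?c i)\<^sup>2 / \<nu> i) \<le> (LINT x|M. (f x - (\<Sum>i\<in>A. a i * e i x))\<^sup>2)"
    unfolding orthogonal_expansion[OF assms(1) f e orth, simplified] sum_subtractf sum_distrib_left by linarith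
  have "(\<Sum>i\<in>A. ?c i / \<nu> i * ?c i) = (\<Sum>i\<in>A. (?c i)\<^sup>2 / \<nu> i)"
    by (simp add: power2_eq_square)
  moreover have "(\<Sum>i\<in>A. (?c i / \<nu> i)\<^sup>2 * \<nu> i) = (\<Sum>i\<in>A. (?c i)\<^sup>2 / \<nu> i)"
    using \<nu> by (intro sum.cong refl) (fastforce simp: field_simps power2_eq_square)
  ultimately show "(LINT x|M. (f x - (\<Sum>i\<in>A. (LINT x|M. f x * e i x) / \<nu> i * e i x))\<^sup>2)
      = (LINT x|M. (f x)\<^sup>2) - (\<Sum>i\<in>A. (?c i)\<^sup>2 / \<nu> i)"
    using orthogonal_expansion[OF assms(1) f e orth, where a="\<lambda>i. ?c i / \<nu> i"] by linarith
qed

lemma Bessel_inequality: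
  assumes "finite A" and f: "sqint M f" and e: "\<And>i. i \<in> A \<Longrightarrow> sqint M (e i)"
    and orth: "\<And>i j. i \<in> A \<Longrightarrow> j \<in> A \<Longrightarrow> (LINT x|M. e i x * e j x) = (if i = j then \<nu> i else 0)"
    and \<nu>: "\<And>i. i \<in> A \<Longrightarrow> \<nu> i > 0"
  shows "(\<Sum>i\<in>A. (LINT x|M. f x * e i x)\<^sup>2 / \<nu> i) \<le> (LINT x|M. (f x)\<^sup>2)"
proof -
  have "0 \<le> (LINT x|M. (f x - (\<Sum>i\<in>A. (LINT x|M. f x * e i x) / \<nu> i * e i x))\<^sup>2)" by simp
  then show ?thesis using best_approximation(2)[OF assms(1) f e orth \<nu>] by linarith
qed

section \<open>Completeness of the Laguerre functions\<close>

definition laguerre :: "real \<Rightarrow> nat \<Rightarrow> real poly" where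
  "laguerre b n = rodrigues_poly b n 0"

lemma laguerre_fun_mult: "laguerre_fun b p x * laguerre_fun b q x = exp (- (b * x)) * (poly p x * poly q x)"
proof -
  have "exp (- (b * x / 2)) * exp (- (b * x / 2)) = exp (- (b * x))" by (simp flip: exp_add)
  moreover have "laguerre_fun b p x * laguerre_fun b q x = (exp (- (b * x / 2)) * exp (- (b * x / 2))) * (poly p x * poly q x)"
    by (simp only: laguerre_fun_def mult_ac)
  ultimately show ?thesis by (simp only:)
qed

lemma laguerre_orthogonal:
  assumes "b > 0"
  shows "(LINT x|HL. laguerre_fun b (laguerre b m) x * laguerre_fun b (laguerre b n) x) = (if m = n then 1 / b else 0)"
  using rodrigues_poly_orthogonal[OF assms, of 0 m n] by (simp add: laguerre_fun_mult laguerre_def)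

lemma sqint_laguerre_fun: "b > 0 \<Longrightarrow> sqint HL (laguerre_fun b p)"
  using sqint_poly_exp[of b p] by (simp add: laguerre_fun_def[abs_def])

text \<open>The n-th Laguerre polynomial has degree exactly n, so leading coefficients can be removed one
after the other.\<close>

lemma laguerre_span:
  assumes b: "b \<noteq> 0" and "\<And>i. i \<ge> M \<Longrightarrow> coeff q i = 0"
  shows "\<exists>a. q = (\<Sum>n<M. smult (a n) (laguerre b n))"
  using assms(2)
proof (induction M arbitrary: q)
  case 0
  then have "q = 0" by (intro poly_eqI) auto
  then show ?case by simp
next
  case (Suc M)
  define c where "c = coeff q M / coeff (laguerre b M) M"
  have nz: "coeff (laguerre b M) M \<noteq> 0" using rodrigues_poly_degree(2)[of 0 M b] b by (simp add: laguerre_def)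
  have "coeff (q - smult c (laguerre b M)) i = 0" if "i \<ge> M" for i
  proof (cases "i = M")
    case True then show ?thesis using nz by (simp add: c_def)
  next
    case False
    then have "coeff (laguerre b M) i = 0"
      using that rodrigues_poly_degree(1)[of 0 M b] by (intro coeff_eq_0) (simp add: laguerre_def)
    then show ?thesis using Suc.prems[of i] that False by simp
  qed
  from Suc.IH[OF this] obtain a where a: "q - smult c (laguerre b M) = (\<Sum>n<M. smult (a n) (laguerre b n))" by blast
  have "q = (\<Sum>n<Suc M. smult ((a(M := c)) n) (laguerre b n))"
    using a by (simp add: algebra_simps)
  then show ?case by blast
qed

lemma laguerre_fun_sum: "laguerre_fun b (\<Sum>n\<in>A. smult (a n) (p n)) x = (\<Sum>n\<in>A. a n * laguerre_fun b (p n) x)"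
  by (simp add: laguerre_fun_def poly_sum sum_distrib_left mult_ac)

lemma laguerre_best_approximation:
  assumes b: "b > 0" and f: "sqint HL f"
  shows "(LINT x|HL. (f x)\<^sup>2) - (\<Sum>n<M. b * (LINT x|HL. f x * laguerre_fun b (laguerre b n) x)\<^sup>2)
      \<le> (LINT x|HL. (f x - laguerre_fun b (\<Sum>n<M. smult (a n) (laguerre b n)) x)\<^sup>2)"
    and "(LINT x|HL. (f x - laguerre_fun b (\<Sum>n<M. smult (b * (LINT x|HL. f x * laguerre_fun b (laguerre b n) x)) (laguerre b n)) x)\<^sup>2)
      = (LINT x|HL. (f x)\<^sup>2) - (\<Sum>n<M. b * (LINT x|HL. f x * laguerre_fun b (laguerre b n) x)\<^sup>2)"
  using best_approximation[OF finite_lessThan[of M] f sqint_laguerre_fun[OF b] laguerre_orthogonal[OF b]] b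
  by (simp_all add: laguerre_fun_sum mult_ac)

text \<open>The closure of the spectral spaces of all degrees in the mean square sense.\<close>

definition poly_approximable :: "real \<Rightarrow> (real \<Rightarrow> real) \<Rightarrow> bool" where
  "poly_approximable b f \<longleftrightarrow> sqint HL f \<and> (\<forall>\<epsilon>>0. \<exists>q. (LINT x|HL. (f x - laguerre_fun b q x)\<^sup>2) < \<epsilon>)"

lemma integral_square_sum_le:
  assumes "sqint M f" "sqint M g"
  shows "(LINT x|M. (f x + g x)\<^sup>2) \<le> 2 * (LINT x|M. (f x)\<^sup>2) + 2 * (LINT x|M. (g x)\<^sup>2)"
proof -
  have "(LINT x|M. (f x + g x)\<^sup>2) \<le> (LINT x|M. 2 * (f x)\<^sup>2 + 2 * (g x)\<^sup>2)"
  proof (rule integral_mono)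
    show "(f x + g x)\<^sup>2 \<le> 2 * (f x)\<^sup>2 + 2 * (g x)\<^sup>2" for x
    proof -
      have "0 \<le> (f x - g x)\<^sup>2" by simp
      then show ?thesis by (simp add: power2_sum power2_diff)
    qed
  qed (use assms sqint_add[OF assms] in \<open>auto simp: sqint_def\<close>)
  also have "\<dots> = 2 * (LINT x|M. (f x)\<^sup>2) + 2 * (LINT x|M. (g x)\<^sup>2)"
    using assms by (simp add: sqint_def)
  finally show ?thesis .
qed

lemma poly_approximable_limit:
  assumes b: "b > 0" and f: "sqint HL f"
    and "\<And>\<epsilon>. \<epsilon> > 0 \<Longrightarrow> \<exists>g. poly_approximable b g \<and> (LINT x|HL. (f x - g x)\<^sup>2) < \<epsilon>"
  shows "poly_approximable b f"
  unfolding poly_approximable_def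
proof (intro conjI allI impI f)
  fix \<epsilon> :: real assume "\<epsilon> > 0"
  then obtain g where g: "poly_approximable b g" "(LINT x|HL. (f x - g x)\<^sup>2) < \<epsilon> / 4" using assms(3)[of "\<epsilon> / 4"] by auto
  then obtain q where q: "(LINT x|HL. (g x - laguerre_fun b q x)\<^sup>2) < \<epsilon> / 4"
    using \<open>\<epsilon> > 0\<close> unfolding poly_approximable_def by (meson divide_pos_pos zero_less_numeral)
  have "sqint HL g" using g by (simp add: poly_approximable_def)
  then have "(LINT x|HL. ((f x - g x) + (g x - laguerre_fun b q x))\<^sup>2) \<le> 2 * (LINT x|HL. (f x - g x)\<^sup>2) + 2 * (LINT x|HL. (g x - laguerre_fun b q x)\<^sup>2)"
    by (intro integral_square_sum_le sqint_diff f sqint_laguerre_fun b)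
  with g(2) q show "\<exists>q. (LINT x|HL. (f x - laguerre_fun b q x)\<^sup>2) < \<epsilon>"
    by (intro exI[of _ q]) simp
qed

lemma poly_approximable_add:
  assumes b: "b > 0" and f: "poly_approximable b f" and g: "poly_approximable b g"
  shows "poly_approximable b (\<lambda>x. f x + g x)"
  unfolding poly_approximable_def
proof (intro conjI allI impI)
  show "sqint HL (\<lambda>x. f x + g x)" using f g by (auto simp: poly_approximable_def intro: sqint_add)
  fix \<epsilon> :: real assume "\<epsilon> > 0"
  then have e4: "\<epsilon> / 4 > 0" by simp
  obtain p where p: "(LINT x|HL. (f x - laguerre_fun b p x)\<^sup>2) < \<epsilon> / 4" using f e4 unfolding poly_approximable_def by blast
  obtain q where q: "(LINT x|HL. (g x - laguerre_fun b q x)\<^sup>2) < \<epsilon> / 4" using g e4 unfolding poly_approximable_def by blast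
  have "(LINT x|HL. (f x + g x - laguerre_fun b (p + q) x)\<^sup>2) = (LINT x|HL. ((f x - laguerre_fun b p x) + (g x - laguerre_fun b q x))\<^sup>2)"
    by (simp add: laguerre_fun_def algebra_simps)
  also have "\<dots> \<le> 2 * (LINT x|HL. (f x - laguerre_fun b p x)\<^sup>2) + 2 * (LINT x|HL. (g x - laguerre_fun b q x)\<^sup>2)"
    using f g by (intro integral_square_sum_le sqint_diff sqint_laguerre_fun b) (auto simp: poly_approximable_def)
  finally show "\<exists>q. (LINT x|HL. (f x + g x - laguerre_fun b q x)\<^sup>2) < \<epsilon>"
    using p q by (intro exI[of _ "p + q"]) simp
qed

lemma poly_approximable_cmult:
  assumes f: "poly_approximable b f"
  shows "poly_approximable b (\<lambda>x. c * f x)"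
  unfolding poly_approximable_def
proof (intro conjI allI impI)
  show "sqint HL (\<lambda>x. c * f x)" using f by (auto simp: poly_approximable_def intro: sqint_cmult)
  fix \<epsilon> :: real assume "\<epsilon> > 0"
  then have "\<epsilon> / (c\<^sup>2 + 1) > 0" by (simp add: add_nonneg_pos)
  then obtain p where p: "(LINT x|HL. (f x - laguerre_fun b p x)\<^sup>2) < \<epsilon> / (c\<^sup>2 + 1)" using f unfolding poly_approximable_def by blast
  have "(LINT x|HL. (c * f x - laguerre_fun b (smult c p) x)\<^sup>2) = (LINT x|HL. c\<^sup>2 * (f x - laguerre_fun b p x)\<^sup>2)"
    by (rule Bochner_Integration.integral_cong[OF refl]) (simp add: laguerre_fun_def power2_eq_square algebra_simps)
  also have "\<dots> = c\<^sup>2 * (LINT x|HL. (f x - laguerre_fun b p x)\<^sup>2)" by simp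
  also have "\<dots> \<le> (c\<^sup>2 + 1) * (LINT x|HL. (f x - laguerre_fun b p x)\<^sup>2)" by (intro mult_right_mono) auto
  also have "\<dots> < (c\<^sup>2 + 1) * (\<epsilon> / (c\<^sup>2 + 1))" using p by (intro mult_strict_left_mono) (auto simp: add_nonneg_pos)
  also have "\<dots> = \<epsilon>" using zero_le_power2[of c] by (simp add: add_nonneg_eq_0_iff)
  finally show "\<exists>q. (LINT x|HL. (c * f x - laguerre_fun b q x)\<^sup>2) < \<epsilon>" by blast
qed

lemma poly_approximable_sum:
  assumes "b > 0" "\<And>i. i \<in> A \<Longrightarrow> poly_approximable b (f i)"
  shows "poly_approximable b (\<lambda>x. \<Sum>i\<in>A. f i x)"
  using assms(2)
proof (induction A rule: infinite_finite_induct)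
  case (insert i A)
  then show ?case by (simp add: poly_approximable_add[OF assms(1)])
next
  have "poly_approximable b (\<lambda>x. 0)"
    unfolding poly_approximable_def by (intro conjI sqint_zero allI impI exI[of _ 0]) (simp add: laguerre_fun_def)
  then show "poly_approximable b (\<lambda>x. \<Sum>i\<in>{}. f i x)" "\<And>A. infinite A \<Longrightarrow> poly_approximable b (\<lambda>x. \<Sum>i\<in>A. f i x)" by simp_all
qed

lemma laguerre_fun_times: "exp (- (b * x / 2)) * g x * laguerre_fun b (laguerre b n) x = g x * rodrigues_fun b n 0 x"
proof -
  have "exp (- (b * x / 2)) * exp (- (b * x / 2)) = exp (- (b * x))" by (simp flip: exp_add)
  moreover have "exp (- (b * x / 2)) * g x * laguerre_fun b (laguerre b n) x
     = g x * ((exp (- (b * x / 2)) * exp (- (b * x / 2))) * poly (rodrigues_poly b n 0) x)"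
    by (simp only: laguerre_fun_def laguerre_def mult_ac)
  ultimately show ?thesis by (simp add: rodrigues_fun_def)
qed

text \<open>After n integrations by parts only a Gamma integral is left.\<close>

lemma laguerre_coeff_exp:
  assumes b: "b > 0" and s: "s \<ge> 0"
  shows "(LINT x|HL. (exp (- (b * x / 2)) * exp (- (s * x))) * laguerre_fun b (laguerre b n) x) = s ^ n / (b + s) ^ Suc n"
proof -
  define G where "G i x = (- s) ^ i * exp (- (s * x))" for i x
  have chain: "primitive (G i) (G (Suc i))" for i
    unfolding G_def[abs_def] by (rule primitive_C1) (auto intro!: derivative_eq_intros continuous_intros)
  have tame: "tame b i (G i)" for i
  proof (rule tame_exp_bound)
    fix x :: real assume "x > 0"
    then have "exp (- (s * x)) \<le> 1" "1 \<le> exp (b * x / 2)" using b s by auto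
    then have "exp (- (s * x)) \<le> exp (b * x / 2)" by linarith
    then show "\<bar>G i x\<bar> \<le> s ^ i * exp (b * x / 2)" using s by (simp add: G_def abs_mult power_abs mult_left_mono)
  qed
  have "(LINT x|HL. G 0 x * rodrigues_fun b n 0 x) = (- 1) ^ n * (LINT x|HL. G n x * rodrigues_fun b n n x)"
  proof (rule rodrigues_by_parts_iterated[OF b order_refl chain tame])
    show "integrable HL (\<lambda>x. G n x * rodrigues_fun b n n x)" unfolding rodrigues_fun_def
      by (intro tame_integrable[OF b tame] continuous_HL_measurable primitive_continuous[OF chain])
  qed
  also have "(LINT x|HL. G n x * rodrigues_fun b n n x) = (- s) ^ n / fact n * (LINT x|HL. x ^ n * exp (- ((b + s) * x)))"
  proof -
    have "G n x * rodrigues_fun b n n x = (- s) ^ n / fact n * (x ^ n * exp (- ((b + s) * x)))" for x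
    proof -
      have "exp (- ((b + s) * x)) = exp (- (b * x)) * exp (- (s * x))"
        by (simp add: distrib_right flip: exp_add)
      then show ?thesis by (simp add: G_def rodrigues_fun_def rodrigues_poly_def)
    qed
    then show ?thesis by (simp only:) simp
  qed
  also have "(LINT x|HL. x ^ n * exp (- ((b + s) * x))) = fact n / (b + s) ^ Suc n"
    by (rule integral_monomial_exp) (use b s in simp)
  also have "(- 1) ^ n * ((- s) ^ n / fact n * (fact n / (b + s) ^ Suc n)) = s ^ n / (b + s) ^ Suc n"
    by (simp flip: power_mult_distrib)
  finally show ?thesis
    unfolding laguerre_fun_times[of b _ "\<lambda>x. exp (- (s * x))"] by (simp add: G_def)
qed

text \<open>The squared Laguerre coefficients form a geometric series, and its sum 1 / (b + 2s) is the squared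
norm of the function. Hence Parseval's identity holds and the partial sums converge.\<close>

lemma poly_approximable_exp:
  assumes b: "b > 0" and s: "s \<ge> 0"
  shows "poly_approximable b (\<lambda>x. exp (- (b * x / 2)) * exp (- (s * x)))"
  unfolding poly_approximable_def
proof (intro conjI allI impI)
  let ?f = "\<lambda>x. exp (- (b * x / 2)) * exp (- (s * x))"
  have sq: "(?f x)\<^sup>2 = exp (- ((b + 2 * s) * x))" for x
    by (simp add: power2_eq_square algebra_simps flip: exp_add)
  show f: "sqint HL ?f"
    unfolding sqint_def sq using b s
    by (auto intro!: integrable_exp_decay continuous_HL_measurable continuous_intros)
  have S: "(LINT x|HL. (?f x)\<^sup>2) = 1 / (b + 2 * s)"
    unfolding sq using integral_monomial_exp[of "b + 2 * s" 0] b s by simp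
  define \<theta> where "\<theta> = s\<^sup>2 / (b + s)\<^sup>2"
  have bs: "b + s > 0" using b s by simp
  have \<theta>: "0 \<le> \<theta>" "\<theta> < 1"
  proof -
    have "s\<^sup>2 < (b + s)\<^sup>2" using b s by (intro power_strict_mono) auto
    then show "\<theta> < 1" using bs by (simp add: \<theta>_def)
  qed (simp add: \<theta>_def)
  have "(\<lambda>n. b / (b + s)\<^sup>2 * \<theta> ^ n) sums (b / (b + s)\<^sup>2 * (1 / (1 - \<theta>)))"
    by (intro sums_mult geometric_sums) (use \<theta> in auto)
  moreover have "b / (b + s)\<^sup>2 * (1 / (1 - \<theta>)) = 1 / (b + 2 * s)"
  proof -
    have "(b + s)\<^sup>2 * (1 - \<theta>) = (b + s)\<^sup>2 - s\<^sup>2" using bs by (simp add: \<theta>_def right_diff_distrib)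
    also have "\<dots> = b * (b + 2 * s)" by (simp add: power2_eq_square algebra_simps)
    finally have "b / (b + s)\<^sup>2 * (1 / (1 - \<theta>)) = b / (b * (b + 2 * s))" by simp
    then show ?thesis using b by simp
  qed
  moreover have "b / (b + s)\<^sup>2 * \<theta> ^ n = b * (s ^ n / (b + s) ^ Suc n)\<^sup>2" for n
  proof -
    have "\<theta> ^ n = (s ^ n)\<^sup>2 / ((b + s) ^ n)\<^sup>2"
      by (simp add: \<theta>_def power_divide mult.commute flip: power_mult)
    moreover have "((b + s) ^ Suc n)\<^sup>2 = (b + s)\<^sup>2 * ((b + s) ^ n)\<^sup>2" by (simp add: power_mult_distrib)
    ultimately show ?thesis by (simp only: power_divide) simp
  qed
  ultimately have "(\<lambda>M. \<Sum>n<M. b * (s ^ n / (b + s) ^ Suc n)\<^sup>2) \<longlonglongrightarrow> 1 / (b + 2 * s)"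
    by (simp add: sums_def)
  then have lim: "(\<lambda>M. 1 / (b + 2 * s) - (\<Sum>n<M. b * (s ^ n / (b + s) ^ Suc n)\<^sup>2)) \<longlonglongrightarrow> 1 / (b + 2 * s) - 1 / (b + 2 * s)"
    by (intro tendsto_intros)
  fix \<epsilon> :: real assume "\<epsilon> > 0"
  with lim have "\<forall>\<^sub>F M in sequentially. 1 / (b + 2 * s) - (\<Sum>n<M. b * (s ^ n / (b + s) ^ Suc n)\<^sup>2) < \<epsilon>"
    by (intro order_tendstoD(2)) auto
  then obtain M where M: "1 / (b + 2 * s) - (\<Sum>n<M. b * (s ^ n / (b + s) ^ Suc n)\<^sup>2) < \<epsilon>"
    by (auto simp: eventually_sequentially)
  have "(LINT x|HL. (?f x - laguerre_fun b (\<Sum>n<M. smult (b * (LINT x|HL. ?f x * laguerre_fun b (laguerre b n) x)) (laguerre b n)) x)\<^sup>2)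
     = 1 / (b + 2 * s) - (\<Sum>n<M. b * (s ^ n / (b + s) ^ Suc n)\<^sup>2)"
    by (subst laguerre_best_approximation(2)[OF b f]) (simp only: laguerre_coeff_exp[OF b s] S)
  from ord_eq_less_trans[OF this M]
  show "\<exists>q. (LINT x|HL. (?f x - laguerre_fun b q x)\<^sup>2) < \<epsilon>" by (rule exI)
qed

text \<open>A continuous cutoff to the interval from 1/n to n.\<close>

definition tent :: "real \<Rightarrow> real \<Rightarrow> real" where
  "tent n x = max 0 (min 1 (n * x - 1)) * max 0 (min 1 (n - x))"

lemma tent_bounds: "0 \<le> tent n x" "tent n x \<le> 1"
  by (auto simp: tent_def intro!: mult_le_one)

lemma tent_continuous: "continuous_on S (tent n)"
  unfolding tent_def[abs_def] by (intro continuous_intros)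

lemma tent_eventually_1:
  assumes "x > 0" shows "\<forall>\<^sub>F n in sequentially. tent (real (Suc n)) x = 1"
proof -
  have "\<forall>\<^sub>F n in sequentially. real (Suc n) * x \<ge> 2" using assms by real_asymp
  moreover have "\<forall>\<^sub>F n in sequentially. real (Suc n) \<ge> x + 1" by real_asymp
  ultimately show ?thesis by eventually_elim (simp add: tent_def)
qed

lemma poly_approximable_exp_poly:
  assumes b: "b > 0"
  shows "poly_approximable b (\<lambda>x. exp (- (b * x / 2)) * (\<Sum>i\<le>m. a i * exp (- x) ^ i))"
proof -
  have "poly_approximable b (\<lambda>x. \<Sum>i\<le>m. a i * (exp (- (b * x / 2)) * exp (- (real i * x))))"
    by (intro poly_approximable_sum b poly_approximable_cmult poly_approximable_exp) auto
  moreover have "exp (- (real i * x)) = exp (- x) ^ i" for i x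
    by (simp flip: exp_of_nat_mult)
  ultimately show ?thesis by (simp add: sum_distrib_left mult_ac)
qed

text \<open>After division by e^(-bx/2) the function is continuous in t = e^(-x) on the closed unit interval.
A Weierstrass polynomial in t is a combination of exponentials in x.\<close>

lemma poly_approximable_compact_support:
  assumes b: "b > 0" and cont: "continuous_on half_line f" and f: "sqint HL (\<lambda>x. f x * tent n x)" and n: "n \<ge> 1"
  shows "poly_approximable b (\<lambda>x. f x * tent n x)"
proof (rule poly_approximable_limit[OF b f])
  fix \<epsilon> :: real assume \<epsilon>: "\<epsilon> > 0"
  \<comment> \<open>X inverts t = e^(-x) as far as x = n, beyond which the tent vanishes. The clamp keeps the
    argument of f inside the open half-line, where f is continuous.\<close>
  define X where "X t = - ln (max t (exp (- n)))" for t
  define clamp where "clamp x = max (1 / n) (min x n)" for x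
  define K where "K t = exp (b * X t / 2) * f (clamp (X t)) * tent n (X t)" for t
  have "continuous_on S X" for S
    unfolding X_def[abs_def] by (intro continuous_intros) (auto simp: max_def)
  moreover have "continuous_on S clamp" for S unfolding clamp_def[abs_def] by (intro continuous_intros)
  moreover have "clamp x > 0" for x
  proof -
    have "1 / n > 0" using n by simp
    then show ?thesis unfolding clamp_def less_max_iff_disj by (rule disjI1)
  qed
  ultimately have "continuous_on {0..1} K"
    unfolding K_def[abs_def]
    by (intro continuous_intros continuous_on_compose2[OF cont] continuous_on_compose2[OF tent_continuous[of UNIV]]
        continuous_on_compose2[of UNIV clamp _ X]) auto
  then obtain P where P: "real_polynomial_function P" "\<And>t. t \<in> {0..1} \<Longrightarrow> \<bar>K t - P t\<bar> < sqrt (\<epsilon> * b / 2)"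
    using Stone_Weierstrass_real_polynomial_function[of "{0..1}" K "sqrt (\<epsilon> * b / 2)"] \<epsilon> b by auto
  then obtain a m where am: "P = (\<lambda>t. \<Sum>i\<le>m. a i * t ^ i)" using real_polynomial_function_iff_sum by auto
  define g where "g x = exp (- (b * x / 2)) * P (exp (- x))" for x
  have g: "poly_approximable b g" unfolding g_def[abs_def] am using poly_approximable_exp_poly[OF b] .
  have K: "K (exp (- x)) = exp (b * x / 2) * (f x * tent n x)" if x: "x > 0" for x
  proof -
    consider "x < n" "x > 1 / n" | "x \<ge> n" | "x \<le> 1 / n" by linarith
    then show ?thesis
    proof cases
      case 1
      then have "X (exp (- x)) = x" "clamp x = x" by (auto simp: X_def clamp_def max_def)
      then show ?thesis by (simp add: K_def)
    next
      case 2
      then have "X (exp (- x)) = n" by (simp add: X_def max_def)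
      then show ?thesis using 2 by (simp add: K_def tent_def)
    next
      case 3
      then have nx: "n * x \<le> 1" using n by (simp add: field_simps)
      have "x \<le> n" using 3 n by (meson divide_le_eq_1_pos less_le_trans mult_left_le order_trans zero_less_one le_divide_eq_1_pos order.trans divide_le_eq_1)
      then have "X (exp (- x)) = x" by (auto simp: X_def max_def)
      then show ?thesis using nx by (simp add: K_def tent_def)
    qed
  qed
  have "(LINT x|HL. (f x * tent n x - g x)\<^sup>2) \<le> (LINT x|HL. \<epsilon> * b / 2 * exp (- (b * x)))"
  proof (rule integral_mono_AE)
    show "integrable HL (\<lambda>x. (f x * tent n x - g x)\<^sup>2)"
      using sqint_diff[OF f, of g] g by (simp add: sqint_def poly_approximable_def)
    show "integrable HL (\<lambda>x. \<epsilon> * b / 2 * exp (- (b * x)))" using integrable_exp_decay[OF b] by simp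
    show "AE x in HL. (f x * tent n x - g x)\<^sup>2 \<le> \<epsilon> * b / 2 * exp (- (b * x))"
    proof (rule AE_I2)
      fix x assume "x \<in> space HL" then have x: "x > 0" by simp
      have e1: "exp (- (b * x / 2)) * exp (b * x / 2) = 1" by (simp flip: exp_add)
      have e2: "(exp (- (b * x / 2)))\<^sup>2 = exp (- (b * x))" by (simp add: power2_eq_square flip: exp_add)
      have "f x * tent n x - g x = exp (- (b * x / 2)) * (K (exp (- x)) - P (exp (- x)))"
        unfolding K[OF x] g_def right_diff_distrib by (simp add: mult.assoc[symmetric] e1)
      then have "(f x * tent n x - g x)\<^sup>2 = exp (- (b * x)) * (K (exp (- x)) - P (exp (- x)))\<^sup>2"
        by (simp add: power_mult_distrib e2)
      also have "(K (exp (- x)) - P (exp (- x)))\<^sup>2 \<le> (sqrt (\<epsilon> * b / 2))\<^sup>2"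
        unfolding abs_le_square_iff[symmetric] using P(2)[of "exp (- x)"] x \<epsilon> b by auto
      also have "(sqrt (\<epsilon> * b / 2))\<^sup>2 = \<epsilon> * b / 2" using \<epsilon> b by simp
      finally show "(f x * tent n x - g x)\<^sup>2 \<le> \<epsilon> * b / 2 * exp (- (b * x))" by (simp add: mult.commute)
    qed
  qed
  also have "\<dots> = \<epsilon> / 2" using integral_monomial_exp[OF b, of 0] b by simp
  also have "\<dots> < \<epsilon>" using \<epsilon> by simp
  finally show "\<exists>g. poly_approximable b g \<and> (LINT x|HL. (f x * tent n x - g x)\<^sup>2) < \<epsilon>" using g by blast
qed

theorem poly_approximable_continuous:
  assumes b: "b > 0" and cont: "continuous_on half_line f" and f: "sqint HL f"
  shows "poly_approximable b f"
proof (rule poly_approximable_limit[OF b f])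
  fix \<epsilon> :: real assume \<epsilon>: "\<epsilon> > 0"
  have ft: "sqint HL (\<lambda>x. f x * tent n x)" for n
  proof (rule sqint_bound[OF f])
    show "(\<lambda>x. f x * tent n x) \<in> borel_measurable HL"
      using f by (intro borel_measurable_times[OF _ continuous_HL_measurable[OF tent_continuous]]) (simp add: sqint_def)
  qed (use tent_bounds in \<open>auto simp: abs_mult mult_left_le\<close>)
  have "(\<lambda>n. LINT x|HL. (f x - f x * tent (real (Suc n)) x)\<^sup>2) \<longlonglongrightarrow> (LINT x|HL. 0)"
  proof (rule integral_dominated_convergence[where w="\<lambda>x. (f x)\<^sup>2"])
    show "(\<lambda>x. (f x - f x * tent (real (Suc n)) x)\<^sup>2) \<in> borel_measurable HL" for n
      by (intro borel_measurable_power sqint_measurable sqint_diff f ft)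
    show "integrable HL (\<lambda>x. (f x)\<^sup>2)" using f by (simp add: sqint_def)
    show "AE x in HL. (\<lambda>n. (f x - f x * tent (real (Suc n)) x)\<^sup>2) \<longlonglongrightarrow> 0"
    proof (rule AE_I2)
      fix x assume "x \<in> space HL"
      then have "\<forall>\<^sub>F n in sequentially. tent (real (Suc n)) x = 1" by (intro tent_eventually_1) simp
      then have "\<forall>\<^sub>F n in sequentially. (f x - f x * tent (real (Suc n)) x)\<^sup>2 = 0" by eventually_elim simp
      then show "(\<lambda>n. (f x - f x * tent (real (Suc n)) x)\<^sup>2) \<longlonglongrightarrow> 0" by (rule tendsto_eventually)
    qed
    show "AE x in HL. norm ((f x - f x * tent (real (Suc n)) x)\<^sup>2) \<le> (f x)\<^sup>2" for n
    proof (rule AE_I2)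
      fix x
      have "f x - f x * tent (real (Suc n)) x = f x * (1 - tent (real (Suc n)) x)"
        by (simp add: right_diff_distrib)
      then have "\<bar>f x - f x * tent (real (Suc n)) x\<bar> = \<bar>f x\<bar> * (1 - tent (real (Suc n)) x)"
        using tent_bounds[of "real (Suc n)" x] by (simp add: abs_mult del: of_nat_Suc)
      also have "\<dots> \<le> \<bar>f x\<bar>" using tent_bounds[of "real (Suc n)" x] by (simp add: mult_left_le del: of_nat_Suc)
      finally show "norm ((f x - f x * tent (real (Suc n)) x)\<^sup>2) \<le> (f x)\<^sup>2" by (simp add: abs_le_square_iff)
    qed
  qed simp
  then have "\<forall>\<^sub>F n in sequentially. (LINT x|HL. (f x - f x * tent (real (Suc n)) x)\<^sup>2) < \<epsilon>"
    using \<epsilon> by (intro order_tendstoD(2)) auto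
  then obtain n where n: "(LINT x|HL. (f x - f x * tent (real (Suc n)) x)\<^sup>2) < \<epsilon>"
    by (auto simp: eventually_sequentially)
  have "poly_approximable b (\<lambda>x. f x * tent (real (Suc n)) x)"
    by (rule poly_approximable_compact_support[OF b cont ft]) simp
  with n show "\<exists>g. poly_approximable b g \<and> (LINT x|HL. (f x - g x)\<^sup>2) < \<epsilon>" by blast
qed

section \<open>Truncation of Laguerre expansions\<close>

lemma fact_ge_power: "real m ^ k * fact m \<le> (fact (m + k) :: real)"
proof (induction k)
  case (Suc k)
  have "real m ^ Suc k * fact m = real m * (real m ^ k * fact m)" by simp
  also have "\<dots> \<le> real (Suc (m + k)) * fact (m + k)" by (intro mult_mono Suc) auto
  finally show ?case by simp
qed simp

lemma fact_ratio_le: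
  assumes "2 * k \<le> N" "N \<le> n" "N > 0"
  shows "(fact (n - k) / fact n :: real) \<le> (2 / real N) ^ k"
proof -
  have "(real N / 2) ^ k * fact (n - k) \<le> real (n - k) ^ k * fact (n - k)"
    using assms by (intro mult_right_mono power_mono) auto
  also have "\<dots> \<le> fact n" using fact_ge_power[of "n - k" k] assms by simp
  finally have "(fact (n - k) / fact n :: real) \<le> 1 / (real N / 2) ^ k"
    using assms(3) by (simp add: field_simps)
  then show ?thesis by (simp add: power_divide)
qed

text \<open>Up to sign, the n-th Laguerre coefficient of G 0 is the coefficient of its k-th derivative with
respect to the Rodrigues polynomial with remaining power k. The squared norm of that polynomial
contains the factor (n-k)! / n!, which is at most (2/N)^k, so Bessel's inequality for the k-th
derivative gives the rate.\<close>

lemma laguerre_coeff_tail: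
  assumes b: "b > 0" and N: "2 * k \<le> N" "0 < k"
    and chain: "\<And>i. i < k \<Longrightarrow> primitive (G i) (G (Suc i))"
    and i: "integrable HL (\<lambda>x. (G k x)\<^sup>2 * (x ^ k * exp (- (b * x))))"
  shows "(\<Sum>n\<in>{N..<M}. b * (LINT x|HL. G 0 x * rodrigues_fun b n 0 x)\<^sup>2)
    \<le> (2 / (b * real N)) ^ k * (LINT x|HL. (G k x)\<^sup>2 * (x ^ k * exp (- (b * x))))"
proof -
  \<comment> \<open>The square root of the weight, so that Bessel's inequality applies without a weight.\<close>
  define w where "w x = sqrt (x ^ k * exp (- (b * x)))" for x
  have w: "w x * w x = x ^ k * exp (- (b * x))" if "x > 0" for x using that by (simp add: w_def)
  have wm: "w \<in> borel_measurable HL" unfolding w_def[abs_def] by (intro continuous_HL_measurable continuous_intros)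
  have Gm: "G k \<in> borel_measurable HL" using primitive_measurable[OF chain[of "k - 1"]] N(2) by simp
  let ?f = "\<lambda>x. G k x * w x" and ?e = "\<lambda>n x. poly (rodrigues_poly b n k) x * w x" and ?\<nu> = "\<lambda>n. fact (n - k) / fact n / b ^ Suc k"
  let ?c = "\<lambda>n. LINT x|HL. G 0 x * rodrigues_fun b n 0 x"
  have sq: "(g x * w x)\<^sup>2 = (g x)\<^sup>2 * (x ^ k * exp (- (b * x)))" if "x \<in> space HL" for g :: "real \<Rightarrow> real" and x
    using w[of x] that by (simp add: power_mult_distrib power2_eq_square)
  have f: "sqint HL ?f"
    unfolding sqint_def
  proof
    show "integrable HL (\<lambda>x. (G k x * w x)\<^sup>2)"
      by (rule iffD2[OF Bochner_Integration.integrable_cong[OF refl sq[where g="G k"]] i])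
  qed (use Gm wm in simp)
  have e: "sqint HL (?e n)" for n
  proof -
    have "integrable HL (\<lambda>x. poly (rodrigues_poly b n k * rodrigues_poly b n k * monom 1 k) x * exp (- (b * x)))" by (rule integrable_poly_exp[OF b])
    then have "integrable HL (\<lambda>x. (poly (rodrigues_poly b n k) x)\<^sup>2 * (x ^ k * exp (- (b * x))))"
      by (simp add: poly_monom power2_eq_square mult_ac)
    moreover have "poly (rodrigues_poly b n k) \<in> borel_measurable HL" by (intro continuous_HL_measurable continuous_intros)
    ultimately have "integrable HL (\<lambda>x. (?e n x)\<^sup>2)" "?e n \<in> borel_measurable HL"
      using wm by (auto intro: iffD2[OF Bochner_Integration.integrable_cong[OF refl sq[where g="poly (rodrigues_poly b n k)"]]])
    then show ?thesis unfolding sqint_def by blast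
  qed
  have orth: "(LINT x|HL. ?e m x * ?e n x) = (if m = n then ?\<nu> m else 0)" if "m \<in> {N..<M}" "n \<in> {N..<M}" for m n
  proof -
    have "(LINT x|HL. ?e m x * ?e n x) = (LINT x|HL. x ^ k * exp (- (b * x)) * (poly (rodrigues_poly b m k) x * poly (rodrigues_poly b n k) x))"
    proof (rule Bochner_Integration.integral_cong[OF refl])
      fix x assume x: "x \<in> space HL"
      have "?e m x * ?e n x = (w x * w x) * (poly (rodrigues_poly b m k) x * poly (rodrigues_poly b n k) x)" by (simp only: mult_ac)
      then show "?e m x * ?e n x = x ^ k * exp (- (b * x)) * (poly (rodrigues_poly b m k) x * poly (rodrigues_poly b n k) x)"
        using w[of x] x by simp
    qed
    also have "\<dots> = (if m = n then ?\<nu> m else 0)" using rodrigues_poly_orthogonal[OF b, of k m n] that N by simp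
    finally show ?thesis .
  qed
  have c: "(LINT x|HL. ?f x * ?e n x)\<^sup>2 = (?c n)\<^sup>2" if "n \<in> {N..<M}" for n
  proof -
    have eq: "?f x * ?e n x = G k x * rodrigues_fun b n k x" if "x \<in> space HL" for x
    proof -
      have "?f x * ?e n x = G k x * poly (rodrigues_poly b n k) x * (w x * w x)" by (simp only: mult_ac)
      then show ?thesis using that by (simp add: w rodrigues_fun_def)
    qed
    have int: "integrable HL (\<lambda>x. G k x * rodrigues_fun b n k x)"
      using sqint_mult_integrable[OF f e[of n]] by (simp only: eq cong: Bochner_Integration.integrable_cong)
    have "(LINT x|HL. ?f x * ?e n x) = (LINT x|HL. G k x * rodrigues_fun b n k x)"
      by (rule Bochner_Integration.integral_cong[OF refl eq])
    moreover have "?c n = (- 1) ^ k * (LINT x|HL. G k x * rodrigues_fun b n k x)"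
      using that N by (intro rodrigues_by_parts_iterated[OF b _ chain tame_chain[OF b chain i] int]) auto
    moreover have "((- 1 :: real) ^ k)\<^sup>2 = 1" by (simp flip: power_mult)
    ultimately show ?thesis by (simp add: power_mult_distrib)
  qed
  have "(\<Sum>n\<in>{N..<M}. b * (?c n)\<^sup>2) \<le> (\<Sum>n\<in>{N..<M}. (2 / (b * real N)) ^ k * ((?c n)\<^sup>2 / ?\<nu> n))"
  proof (rule sum_mono)
    fix n assume n: "n \<in> {N..<M}"
    have "b * ?\<nu> n = (1 / b) ^ k * (fact (n - k) / fact n)" using b by (simp add: power_one_over)
    also have "\<dots> \<le> (1 / b) ^ k * (2 / real N) ^ k"
      using fact_ratio_le[of k N n] N n b by (intro mult_left_mono) auto
    also have "\<dots> = (2 / (b * real N)) ^ k" by (simp flip: power_mult_distrib)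
    finally have "b * ?\<nu> n * ((?c n)\<^sup>2 / ?\<nu> n) \<le> (2 / (b * real N)) ^ k * ((?c n)\<^sup>2 / ?\<nu> n)"
      using b by (intro mult_right_mono) auto
    moreover have cancel: "b * v * (z / v) = b * z" if "v \<noteq> 0" for v z :: real using that by simp
    moreover have "?\<nu> n \<noteq> 0" using b by simp
    ultimately show "b * (?c n)\<^sup>2 \<le> (2 / (b * real N)) ^ k * ((?c n)\<^sup>2 / ?\<nu> n)"
      by (subst cancel[symmetric, where v="?\<nu> n"]) assumption+
  qed
  also have "\<dots> = (2 / (b * real N)) ^ k * (\<Sum>n\<in>{N..<M}. (LINT x|HL. ?f x * ?e n x)\<^sup>2 / ?\<nu> n)"
    unfolding sum_distrib_left using c by (intro sum.cong) auto
  also have "\<dots> \<le> (2 / (b * real N)) ^ k * (LINT x|HL. (?f x)\<^sup>2)"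
    using b by (intro mult_left_mono Bessel_inequality f e orth) auto
  also have "(LINT x|HL. (?f x)\<^sup>2) = (LINT x|HL. (G k x)\<^sup>2 * (x ^ k * exp (- (b * x))))"
    by (rule Bochner_Integration.integral_cong[OF refl sq])
  finally show ?thesis .
qed

text \<open>For k = 0 the zero polynomial is good enough. For k > 0 the function G 0 is continuous, so that
its Laguerre expansion converges and the error equals the tail of the squared coefficients.\<close>

theorem laguerre_projection_error:
  assumes b: "b > 0" and N: "2 * k \<le> N"
    and chain: "\<And>i. i < k \<Longrightarrow> primitive (G i) (G (Suc i))"
    and f: "sqint HL (\<lambda>x. exp (- (b * x / 2)) * G 0 x)"
    and i: "integrable HL (\<lambda>x. (G k x)\<^sup>2 * (x ^ k * exp (- (b * x))))"
  shows "\<exists>q. (\<forall>i\<ge>N. coeff q i = 0) \<and> (LINT x|HL. (exp (- (b * x / 2)) * G 0 x - laguerre_fun b q x)\<^sup>2)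
    \<le> (2 / (b * real N)) ^ k * (LINT x|HL. (G k x)\<^sup>2 * (x ^ k * exp (- (b * x))))"
proof (cases "k = 0")
  case True
  have e2: "(exp (- (b * x / 2)))\<^sup>2 = exp (- (b * x))" for x by (simp add: power2_eq_square flip: exp_add)
  have "(exp (- (b * x / 2)) * G 0 x)\<^sup>2 = (G 0 x)\<^sup>2 * exp (- (b * x))" for x
    by (simp add: power_mult_distrib e2)
  then show ?thesis
    by (intro exI[of _ 0]) (simp add: True laguerre_fun_def)
next
  case False
  let ?f = "\<lambda>x. exp (- (b * x / 2)) * G 0 x"
  let ?S = "(2 / (b * real N)) ^ k * (LINT x|HL. (G k x)\<^sup>2 * (x ^ k * exp (- (b * x))))"
  define c where "c n = (LINT x|HL. ?f x * laguerre_fun b (laguerre b n) x)" for n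
  have cont: "continuous_on half_line ?f"
    using primitive_continuous[OF chain[of 0]] False by (intro continuous_intros) auto
  have app: "poly_approximable b ?f" by (rule poly_approximable_continuous[OF b cont f])
  define q where "q = (\<Sum>n<N. smult (b * c n) (laguerre b n))"
  have "coeff q i = 0" if "i \<ge> N" for i
  proof -
    have "coeff (laguerre b n) i = 0" if "n < N" for n
      using rodrigues_poly_degree(1)[of 0 n b] that \<open>i \<ge> N\<close> by (intro coeff_eq_0) (simp add: laguerre_def)
    then show ?thesis by (simp add: q_def coeff_sum)
  qed
  moreover have "(LINT x|HL. (?f x - laguerre_fun b q x)\<^sup>2) \<le> ?S"
  proof (rule field_le_epsilon)
    fix \<epsilon> :: real assume "\<epsilon> > 0"
    then obtain p where p: "(LINT x|HL. (?f x - laguerre_fun b p x)\<^sup>2) < \<epsilon>"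
      using app unfolding poly_approximable_def by blast
    \<comment> \<open>The expansion up to M is at least as good as p, so only coefficients from N to M matter.\<close>
    define M where "M = max N (Suc (degree p))"
    have "coeff p i = 0" if "i \<ge> M" for i using that by (intro coeff_eq_0) (simp add: M_def)
    then obtain a where a: "p = (\<Sum>n<M. smult (a n) (laguerre b n))" using laguerre_span[of b M p] b by auto
    have "(LINT x|HL. (?f x)\<^sup>2) - (\<Sum>n<M. b * (c n)\<^sup>2) < \<epsilon>"
      using laguerre_best_approximation(1)[OF b f, of M a] p unfolding a c_def by (rule le_less_trans)
    moreover have "(\<Sum>n<M. b * (c n)\<^sup>2) = (\<Sum>n<N. b * (c n)\<^sup>2) + (\<Sum>n\<in>{N..<M}. b * (c n)\<^sup>2)"
      using sum.atLeastLessThan_concat[of 0 N M "\<lambda>n. b * (c n)\<^sup>2"] by (simp add: M_def lessThan_atLeast0)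
    moreover have "(\<Sum>n\<in>{N..<M}. b * (c n)\<^sup>2) \<le> ?S"
      using laguerre_coeff_tail[OF b N _ chain i, of M] False unfolding c_def laguerre_fun_times by simp
    moreover have "(LINT x|HL. (?f x - laguerre_fun b q x)\<^sup>2) = (LINT x|HL. (?f x)\<^sup>2) - (\<Sum>n<N. b * (c n)\<^sup>2)"
      unfolding q_def c_def by (rule laguerre_best_approximation(2)[OF b f])
    ultimately show "(LINT x|HL. (?f x - laguerre_fun b q x)\<^sup>2) \<le> ?S + \<epsilon>" by linarith
  qed
  ultimately show ?thesis by blast
qed

section \<open>Approximation in the spectral space\<close>

lemma H1_pair_cong_AE:
  assumes "H1_pair h g" "AE x in HL. g' x = g x" "g' \<in> borel_measurable HL"
  shows "H1_pair h g'"
proof -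
  have "AE x in HL. g x = g' x" using assms(2) by eventually_elim simp
  moreover have "sqint HL g'" by (rule sqint_cong_AE[OF _ assms(3,2)]) (use assms(1) in \<open>simp add: H1_pair_def\<close>)
  ultimately show ?thesis using assms(1) primitive_cong_AE unfolding H1_pair_def by blast
qed

lemma H1_pair_integral_product:
  assumes "H1_pair h g" "H1_pair k l"
  shows "(LINT x|HL. g x * k x + h x * l x) = - (h 0 * k 0)"
proof -
  have lim: "((\<lambda>x. h x * k x) \<longlongrightarrow> 0 * 0) at_top" 
    using assms unfolding H1_pair_def by (intro tendsto_mult) auto
  have lim0: "((\<lambda>x. h x * k x) \<longlongrightarrow> h 0 * k 0) (at_right 0)"
    using assms unfolding H1_pair_def by (intro tendsto_mult continuous_tendsto_at_right_0) auto
  have "(LINT x|HL. g x * k x + h x * l x) = 0 - h 0 * k 0"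
    by (rule integral_HL_primitive[OF primitive_mult])
       (use assms lim lim0 in \<open>auto simp: H1_pair_def intro!: Bochner_Integration.integrable_add sqint_mult_integrable\<close>)
  then show ?thesis by simp
qed

text \<open>The mixed term is the integral of the derivative of c e^2, which is zero because e vanishes at
both ends.\<close>

lemma H1_pair_shifted_norm:
  assumes "H1_pair e e'" "e 0 = 0"
  shows "(LINT x|HL. (e' x + c * e x)\<^sup>2) = (LINT x|HL. (e' x)\<^sup>2) + c\<^sup>2 * (LINT x|HL. (e x)\<^sup>2)"
proof -
  have s: "sqint HL e" "sqint HL e'" using assms(1) by (auto simp: H1_pair_def)
  have "(LINT x|HL. (e' x + c * e x)\<^sup>2) = (LINT x|HL. (e' x)\<^sup>2 + c\<^sup>2 * (e x)\<^sup>2 + c * (e' x * e x + e x * e' x))"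
    by (rule Bochner_Integration.integral_cong[OF refl]) (simp add: power2_eq_square algebra_simps)
  also have "\<dots> = (LINT x|HL. (e' x)\<^sup>2) + c\<^sup>2 * (LINT x|HL. (e x)\<^sup>2) + c * (LINT x|HL. e' x * e x + e x * e' x)"
    using sqint_integrable[OF s(1)] sqint_integrable[OF s(2)] sqint_mult_integrable[OF s(1,2)] sqint_mult_integrable[OF s(2,1)]
    by simp
  finally show ?thesis using H1_pair_integral_product[OF assms(1,1)] assms(2) by simp
qed

text \<open>The operator (d/dx + c)^j applied to G i, if each G (i + 1) is the derivative of G i.
Multiplication by e^(cx) turns it into an ordinary j-th derivative.\<close>

primrec shifted_deriv :: "(nat \<Rightarrow> real \<Rightarrow> real) \<Rightarrow> real \<Rightarrow> nat \<Rightarrow> nat \<Rightarrow> real \<Rightarrow> real" where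
  "shifted_deriv G c 0 i = G i"
| "shifted_deriv G c (Suc j) i = (\<lambda>x. shifted_deriv G c j (Suc i) x + c * shifted_deriv G c j i x)"

lemma primitive_shifted_deriv:
  assumes "\<And>i. i < r \<Longrightarrow> primitive (G i) (G (Suc i))" "i + j < r"
  shows "primitive (shifted_deriv G c j i) (shifted_deriv G c j (Suc i))"
  using assms(2) by (induction j arbitrary: i) (auto intro!: primitive_add primitive_cmult assms(1))

lemma primitive_exp_shifted_deriv:
  assumes "\<And>i. i < r \<Longrightarrow> primitive (G i) (G (Suc i))" "j < r"
  shows "primitive (\<lambda>x. exp (b * x / 2) * shifted_deriv G (b/2) j 0 x) (\<lambda>x. exp (b * x / 2) * shifted_deriv G (b/2) (Suc j) 0 x)"
proof -
  have "primitive (\<lambda>x. exp (b * x / 2)) (\<lambda>x. b / 2 * exp (b * x / 2))"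
    by (rule primitive_C1) (auto intro!: derivative_eq_intros continuous_intros)
  from primitive_mult[OF this primitive_shifted_deriv[where G=G and r=r and i=0 and j=j and c="b/2", OF assms(1)]] assms(2)
  show ?thesis by (simp add: algebra_simps)
qed

lemma binomial_sum_Suc:
  fixes q :: real
  shows "(\<Sum>l\<le>Suc j. real (Suc j choose l) * q ^ (Suc j - l) * F (i + l))
    = (\<Sum>l\<le>j. real (j choose l) * q ^ (j - l) * F (Suc i + l)) + q * (\<Sum>l\<le>j. real (j choose l) * q ^ (j - l) * F (i + l))"
proof -
  have "q * (\<Sum>l\<le>j. real (j choose l) * q ^ (j - l) * F (i + l)) = (\<Sum>l\<le>Suc j. real (j choose l) * q ^ (Suc j - l) * F (i + l))"
    by (simp add: sum_distrib_left Suc_diff_le mult_ac)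
  also have "\<dots> = q ^ Suc j * F i + (\<Sum>l\<le>j. real (j choose Suc l) * q ^ (j - l) * F (Suc i + l))"
    by (subst sum.atMost_Suc_shift) simp
  finally have 1: "q * (\<Sum>l\<le>j. real (j choose l) * q ^ (j - l) * F (i + l)) = \<dots>" .
  have "(\<Sum>l\<le>Suc j. real (Suc j choose l) * q ^ (Suc j - l) * F (i + l)) =
     q ^ Suc j * F i + (\<Sum>l\<le>j. real (Suc j choose Suc l) * q ^ (j - l) * F (Suc i + l))"
    by (subst sum.atMost_Suc_shift) simp
  also have "(\<Sum>l\<le>j. real (Suc j choose Suc l) * q ^ (j - l) * F (Suc i + l)) =
     (\<Sum>l\<le>j. real (j choose l) * q ^ (j - l) * F (Suc i + l)) + (\<Sum>l\<le>j. real (j choose Suc l) * q ^ (j - l) * F (Suc i + l))"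
    by (simp add: distrib_right sum.distrib)
  finally show ?thesis unfolding 1 by simp
qed

text \<open>Each application of d/dx + c costs a factor 2 by (a + cd)^2 \<le> 2 a^2 + 2 c^2 d^2; Pascal's rule
collects the terms.\<close>

lemma shifted_deriv_square_le:
  "(shifted_deriv G c j i x)\<^sup>2 \<le> 2 ^ j * (\<Sum>l\<le>j. real (j choose l) * (c\<^sup>2) ^ (j - l) * (G (i + l) x)\<^sup>2)"
proof (induction j arbitrary: i)
  case (Suc j)
  let ?a = "shifted_deriv G c j (Suc i) x" and ?d = "shifted_deriv G c j i x"
  have "0 \<le> (?a - c * ?d)\<^sup>2" by simp
  then have "(?a + c * ?d)\<^sup>2 \<le> 2 * ?a\<^sup>2 + 2 * c\<^sup>2 * ?d\<^sup>2"
    by (simp add: power2_eq_square algebra_simps)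
  also have "\<dots> \<le> 2 * (2 ^ j * (\<Sum>l\<le>j. real (j choose l) * (c\<^sup>2) ^ (j - l) * (G (Suc i + l) x)\<^sup>2))
     + 2 * c\<^sup>2 * (2 ^ j * (\<Sum>l\<le>j. real (j choose l) * (c\<^sup>2) ^ (j - l) * (G (i + l) x)\<^sup>2))"
    by (intro add_mono mult_left_mono Suc) auto
  also have "\<dots> = 2 ^ Suc j * (\<Sum>l\<le>Suc j. real (Suc j choose l) * (c\<^sup>2) ^ (Suc j - l) * (G (i + l) x)\<^sup>2)"
    unfolding binomial_sum_Suc[where F="\<lambda>l. (G l x)\<^sup>2"] by (simp add: algebra_simps)
  finally show ?case by simp
qed simp

lemma sqint_shifted_deriv:
  assumes "\<And>i. i \<le> r \<Longrightarrow> sqint HL (\<lambda>x. G i x * w x)" "i + j \<le> r"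
  shows "sqint HL (\<lambda>x. shifted_deriv G c j i x * w x)"
  using assms(2)
proof (induction j arbitrary: i)
  case (Suc j)
  have "sqint HL (\<lambda>x. shifted_deriv G c j (Suc i) x * w x + c * (shifted_deriv G c j i x * w x))"
    by (rule sqint_add[OF Suc.IH sqint_cmult[OF Suc.IH]]) (use Suc.prems in auto)
  then show ?case by (simp add: algebra_simps)
qed (use assms(1) in simp)

lemma poly_antiderivative:
  fixes q :: "real poly"
  assumes "\<And>i. i \<ge> N \<Longrightarrow> coeff q i = 0"
  shows "\<exists>p. pderiv p = q \<and> poly p 0 = c \<and> degree p \<le> N"
proof -
  define p where "p = [:c:] + (\<Sum>i\<le>degree q. monom (coeff q i / real (Suc i)) (Suc i))"
  have cS: "coeff p (Suc n) = coeff q n / real (Suc n)" for n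
  proof -
    have "coeff p (Suc n) = (\<Sum>i\<le>degree q. if i = n then coeff q i / real (Suc i) else 0)"
      by (auto simp: p_def coeff_sum intro!: sum.cong)
    then show ?thesis by (auto simp: coeff_eq_0)
  qed
  have "pderiv p = q" by (intro poly_eqI) (simp add: coeff_pderiv cS del: of_nat_Suc)
  moreover have "poly p 0 = c" by (simp add: p_def poly_sum poly_monom)
  moreover have "degree p \<le> N"
  proof (rule degree_le, intro allI impI)
    fix i assume "i > N" then show "coeff p i = 0" using cS assms by (cases i) auto
  qed
  ultimately show ?thesis by blast
qed

text \<open>The square of \<open>beta_norm\<close>, for a chain of functions in place of the weak derivatives.\<close>

definition weighted_sum :: "nat \<Rightarrow> real \<Rightarrow> (nat \<Rightarrow> real \<Rightarrow> real) \<Rightarrow> real" where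
  "weighted_sum r b G = (\<Sum>l\<le>r. real (r choose l) * (b\<^sup>2 / 4) ^ (r - l) * (LINT x|HL. (G l x)\<^sup>2 * x ^ (r - 1)))"

text \<open>The polynomial p is an antiderivative of the truncated Laguerre expansion of the derivative of
e^(bx/2) G 0, with the value at 0 that makes the trace exact. The constant combines the factor 2^r
of \<open>shifted_deriv_square_le\<close> with the factor 2^(r-1) of \<open>fact_ratio_le\<close>.\<close>

theorem approximation_in_X_space:
  assumes r: "r \<ge> 1" and b: "b > 0" and N: "N \<ge> 2 * r"
    and H: "H1_pair (G 0) (G 1)"
    and chain: "\<And>i. i < r \<Longrightarrow> primitive (G i) (G (Suc i))"
    and meas: "\<And>i. i \<le> r \<Longrightarrow> G i \<in> borel_measurable HL"
    and int: "\<And>i. i \<le> r \<Longrightarrow> integrable HL (\<lambda>x. (G i x)\<^sup>2 * x ^ (r - 1))"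
  obtains p where "degree p \<le> N" "poly p 0 = G 0 0"
    "(LINT x|HL. (G 1 x - laguerre_fun b (pderiv p - smult (b/2) p) x)\<^sup>2) + b\<^sup>2 / 4 * (LINT x|HL. (G 0 x - laguerre_fun b p x)\<^sup>2)
      \<le> 4 ^ r * (b * real N) powr (1 - real r) * weighted_sum r b G"
proof -
  define w where "w x = sqrt (x ^ (r - 1))" for x :: real
  have w: "(g x * w x)\<^sup>2 = (g x)\<^sup>2 * x ^ (r - 1)" if "x > 0" for x and g :: "real \<Rightarrow> real"
    using that by (simp add: w_def power_mult_distrib)
  have wm: "w \<in> borel_measurable HL" unfolding w_def[abs_def] by (intro continuous_HL_measurable continuous_intros)
  let ?D = "\<lambda>j. shifted_deriv G (b/2) j 0"
  define U where "U i x = exp (b * x / 2) * ?D (Suc i) x" for i x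
  have Gw: "sqint HL (\<lambda>x. G i x * w x)" if "i \<le> r" for i
    unfolding sqint_def
  proof
    show "(\<lambda>x. G i x * w x) \<in> borel_measurable HL" using meas[OF that] wm by simp
    show "integrable HL (\<lambda>x. (G i x * w x)\<^sup>2)"
      by (rule iffD2[OF Bochner_Integration.integrable_cong[OF refl] int[OF that]]) (simp add: w)
  qed
  have Dw: "sqint HL (\<lambda>x. ?D r x * w x)" by (rule sqint_shifted_deriv[OF Gw]) auto
  have Dint: "integrable HL (\<lambda>x. (?D r x)\<^sup>2 * x ^ (r - 1))"
    by (rule iffD2[OF Bochner_Integration.integrable_cong[OF refl] sqint_integrable[OF Dw]]) (simp add: w)
  have Usq: "(U (r - 1) x)\<^sup>2 * (x ^ (r - 1) * exp (- (b * x))) = (?D r x)\<^sup>2 * x ^ (r - 1)" for x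
  proof -
    have "(exp (b * x / 2))\<^sup>2 * exp (- (b * x)) = 1" by (simp add: power2_eq_square flip: exp_add)
    then show ?thesis using r by (simp add: U_def power_mult_distrib mult_ac)
  qed
  have U0: "exp (- (b * x / 2)) * U 0 x = G 1 x + b / 2 * G 0 x" for x
  proof -
    have "exp (- (b * x / 2)) * exp (b * x / 2) = 1" by (simp flip: exp_add)
    then show ?thesis by (simp add: U_def flip: mult.assoc)
  qed
  have "\<exists>q. (\<forall>i\<ge>N. coeff q i = 0) \<and> (LINT x|HL. (exp (- (b * x / 2)) * U 0 x - laguerre_fun b q x)\<^sup>2)
    \<le> (2 / (b * real N)) ^ (r - 1) * (LINT x|HL. (U (r - 1) x)\<^sup>2 * (x ^ (r - 1) * exp (- (b * x))))"
  proof (rule laguerre_projection_error[OF b])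
    show "2 * (r - 1) \<le> N" using N by simp
    show "primitive (U i) (U (Suc i))" if "i < r - 1" for i
      unfolding U_def[abs_def] by (rule primitive_exp_shifted_deriv[where r=r and G=G, OF chain]) (use that in auto)
    show "sqint HL (\<lambda>x. exp (- (b * x / 2)) * U 0 x)"
      unfolding U0 using H by (intro sqint_add sqint_cmult) (auto simp: H1_pair_def)
    show "integrable HL (\<lambda>x. (U (r - 1) x)\<^sup>2 * (x ^ (r - 1) * exp (- (b * x))))"
      unfolding Usq by (rule Dint)
  qed
  then obtain q where q: "\<And>i. i \<ge> N \<Longrightarrow> coeff q i = 0"
    "(LINT x|HL. (G 1 x + b / 2 * G 0 x - laguerre_fun b q x)\<^sup>2) \<le> (2 / (b * real N)) ^ (r - 1) * (LINT x|HL. (?D r x)\<^sup>2 * x ^ (r - 1))"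
    unfolding U0 Usq by blast
  obtain p where p: "pderiv p = q" "poly p 0 = G 0 0" "degree p \<le> N" using poly_antiderivative[OF q(1), where c="G 0 0"] by auto
  let ?e = "\<lambda>x. G 0 x - laguerre_fun b p x" and ?e' = "\<lambda>x. G 1 x - laguerre_fun b (pderiv p - smult (b/2) p) x"
  have e: "H1_pair ?e ?e'" by (rule H1_pair_diff[OF H H1_pair_laguerre_fun[OF b]])
  have e0: "?e 0 = 0" using p(2) by (simp add: laguerre_fun_def)
  have "(LINT x|HL. (?e' x)\<^sup>2) + (b/2)\<^sup>2 * (LINT x|HL. (?e x)\<^sup>2) = (LINT x|HL. (?e' x + b / 2 * ?e x)\<^sup>2)"
    by (rule H1_pair_shifted_norm[OF e e0, symmetric])
  also have "\<dots> = (LINT x|HL. (G 1 x + b / 2 * G 0 x - laguerre_fun b q x)\<^sup>2)"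
    by (rule Bochner_Integration.integral_cong[OF refl])
       (simp add: p(1)[symmetric] laguerre_fun_def algebra_simps)
  also have "\<dots> \<le> (2 / (b * real N)) ^ (r - 1) * (LINT x|HL. (?D r x)\<^sup>2 * x ^ (r - 1))" by (rule q(2))
  also have "\<dots> \<le> (2 / (b * real N)) ^ (r - 1) * (2 ^ r * weighted_sum r b G)"
  proof (rule mult_left_mono)
    have S: "integrable HL (\<lambda>x. \<Sum>l\<le>r. real (r choose l) * (b\<^sup>2 / 4) ^ (r - l) * ((G l x)\<^sup>2 * x ^ (r - 1)))"
      using int by (intro Bochner_Integration.integrable_sum integrable_mult_right) auto
    have "(LINT x|HL. (?D r x)\<^sup>2 * x ^ (r - 1)) \<le> (LINT x|HL. 2 ^ r * (\<Sum>l\<le>r. real (r choose l) * (b\<^sup>2 / 4) ^ (r - l) * ((G l x)\<^sup>2 * x ^ (r - 1))))"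
    proof (rule integral_mono_AE[OF Dint integrable_mult_right[OF S]], rule AE_I2)
      fix x assume "x \<in> space HL" then have x: "x > 0" by simp
      have "(?D r x)\<^sup>2 * x ^ (r - 1) \<le> (2 ^ r * (\<Sum>l\<le>r. real (r choose l) * ((b/2)\<^sup>2) ^ (r - l) * (G (0 + l) x)\<^sup>2)) * x ^ (r - 1)"
        using x by (intro mult_right_mono shifted_deriv_square_le) auto
      also have "\<dots> = 2 ^ r * (\<Sum>l\<le>r. real (r choose l) * (b\<^sup>2 / 4) ^ (r - l) * ((G l x)\<^sup>2 * x ^ (r - 1)))"
        by (simp add: sum_distrib_right sum_distrib_left mult_ac power_divide)
      finally show "(?D r x)\<^sup>2 * x ^ (r - 1) \<le> 2 ^ r * (\<Sum>l\<le>r. real (r choose l) * (b\<^sup>2 / 4) ^ (r - l) * ((G l x)\<^sup>2 * x ^ (r - 1)))" .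
    qed
    also have "\<dots> = 2 ^ r * weighted_sum r b G"
      using int by (simp add: weighted_sum_def Bochner_Integration.integral_sum)
    finally show "(LINT x|HL. (?D r x)\<^sup>2 * x ^ (r - 1)) \<le> 2 ^ r * weighted_sum r b G" .
  qed (use b in simp)
  also have "\<dots> \<le> 4 ^ r * (b * real N) powr (1 - real r) * weighted_sum r b G"
  proof -
    have bN: "b * real N > 0" using b N r by simp
    have ws: "weighted_sum r b G \<ge> 0"
      unfolding weighted_sum_def by (intro sum_nonneg mult_nonneg_nonneg integral_nonneg_AE AE_I2) auto
    have "(b * real N) powr (1 - real r) = 1 / (b * real N) ^ (r - 1)"
    proof -
      have "1 - real r = - real (r - 1)" using r by simp
      then show ?thesis using bN by (simp only: powr_minus powr_realpow inverse_eq_divide)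
    qed
    moreover have "(2 / (b * real N)) ^ (r - 1) * 2 ^ r \<le> 4 ^ r * (1 / (b * real N) ^ (r - 1))"
    proof -
      have "(2::real) ^ (r - 1) * 2 ^ r \<le> 2 ^ r * 2 ^ r" by (intro mult_right_mono power_increasing) auto
      also have "\<dots> = 4 ^ r" by (simp flip: power_mult_distrib)
      finally have "(2::real) ^ (r - 1) * 2 ^ r / (b * real N) ^ (r - 1) \<le> 4 ^ r / (b * real N) ^ (r - 1)"
        using bN by (intro divide_right_mono) auto
      then show ?thesis by (simp add: power_divide)
    qed
    ultimately have "(2 / (b * real N)) ^ (r - 1) * 2 ^ r * weighted_sum r b G \<le> 4 ^ r * (b * real N) powr (1 - real r) * weighted_sum r b G"
      using ws by (intro mult_right_mono) auto
    then show ?thesis by (simp only: mult.assoc)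
  qed
  finally have "(LINT x|HL. (?e' x)\<^sup>2) + b\<^sup>2 / 4 * (LINT x|HL. (?e x)\<^sup>2) \<le> 4 ^ r * (b * real N) powr (1 - real r) * weighted_sum r b G"
    by (simp add: power_divide)
  with p that show ?thesis by blast
qed

lemma sobolev_chain:
  assumes u: "u \<in> sobolev r (\<lambda>x. x ^ (r - 1))" and r: "r \<ge> 1" and rep: "represents u h (weak_deriv 1 u)"
  obtains G where "G 0 = h" "\<And>i. i < r \<Longrightarrow> primitive (G i) (G (Suc i))"
    "\<And>i. i \<le> r \<Longrightarrow> AE x in HL. G i x = weak_deriv i u x"
    "\<And>i. i \<le> r \<Longrightarrow> G i \<in> borel_measurable HL"
proof -
  have wd: "has_weak_deriv i u (weak_deriv i u)" if "i \<le> r" for i using sobolev_weak_deriv(1)[OF u that] .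
  have "\<exists>V. primitive V (weak_deriv (Suc i) u) \<and> (AE x in HL. weak_deriv i u x = V x)" if "i < r" for i
    using weak_deriv_imp_primitive[OF has_weak_deriv_step[OF wd wd]] that by (metis Suc_leI less_imp_le)
  then obtain V where V: "\<And>i. i < r \<Longrightarrow> primitive (V i) (weak_deriv (Suc i) u)"
    "\<And>i. i < r \<Longrightarrow> AE x in HL. weak_deriv i u x = V i x" by metis
  \<comment> \<open>The lowest function is the version that is continuous up to 0; the highest is only determined
    almost everywhere.\<close>
  define G where "G i = (if i = 0 then h else if i < r then V i else weak_deriv i u)" for i
  have ph: "primitive h (weak_deriv 1 u)" using rep by (auto simp: represents_def H1_pair_def)
  have ae: "AE x in HL. G i x = weak_deriv i u x" if i: "i \<le> r" for i
  proof -
    consider "i = 0" | "0 < i" "i < r" | "0 < i" "i = r" using i by linarith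
    then show ?thesis
    proof cases
      case 1
      have "AE x in HL. u x = h x" using represents_AE(1)[OF rep] .
      moreover have "AE x in HL. weak_deriv 0 u x = u x"
        by (rule weak_deriv_0_AE) (use rep in \<open>simp add: represents_def\<close>)
      ultimately show ?thesis unfolding 1 G_def by eventually_elim simp
    next
      case 2
      show ?thesis using V(2)[OF 2(2)] 2 unfolding G_def by (auto elim: eventually_mono)
    qed (simp add: G_def)
  qed
  have pG: "primitive (G i) (weak_deriv (Suc i) u)" if "i < r" for i
    using ph V(1)[OF that] that by (cases "i = 0") (auto simp: G_def)
  show ?thesis
  proof (rule that)
    show "G 0 = h" by (simp add: G_def)
    fix i
    show "primitive (G i) (G (Suc i))" if "i < r"
    proof (rule primitive_cong_AE[OF pG[OF that]])
      show "AE x in HL. weak_deriv (Suc i) u x = G (Suc i) x"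
        using ae[of "Suc i"] that by (auto elim: eventually_mono)
    qed
    show "AE x in HL. G i x = weak_deriv i u x" if "i \<le> r" by (rule ae[OF that])
    show "G i \<in> borel_measurable HL" if "i \<le> r"
    proof (cases "i < r")
      case True
      show ?thesis by (rule continuous_HL_measurable[OF primitive_continuous[OF pG[OF True]]])
    next
      case False
      then have "G i = weak_deriv i u" using that r by (simp add: G_def)
      then show ?thesis using wd[OF that] by (simp add: has_weak_deriv_def locally_integrable_measurable)
    qed
  qed
qed

lemma beta_norm_eq_weighted_sum:
  assumes "\<And>i. i \<le> r \<Longrightarrow> AE x in HL. G i x = weak_deriv i u x"
    "\<And>i. i \<le> r \<Longrightarrow> G i \<in> borel_measurable HL" "u \<in> sobolev r (\<lambda>x. x ^ (r - 1))"
  shows "(beta_norm r b u)\<^sup>2 = weighted_sum r b G" "beta_norm r b u = sqrt (weighted_sum r b G)"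
    "i \<le> r \<Longrightarrow> integrable HL (\<lambda>x. (G i x)\<^sup>2 * x ^ (r - 1))"
proof -
  have pm: "(\<lambda>x::real. x ^ (r - 1)) \<in> borel_measurable HL" by (intro continuous_HL_measurable continuous_intros)
  note S = sobolev_weighted_integrable[OF assms(3) _ pm]
  have eq: "(LINT x|HL. (G i x)\<^sup>2 * x ^ (r - 1)) = (wnorm (\<lambda>x. x ^ (r - 1)) (weak_deriv i u))\<^sup>2" if "i \<le> r" for i
  proof -
    have "(LINT x|HL. (G i x)\<^sup>2 * x ^ (r - 1)) = (LINT x|HL. (weak_deriv i u x)\<^sup>2 * x ^ (r - 1))"
    proof (rule integral_cong_AE)
      show "AE x in HL. (G i x)\<^sup>2 * x ^ (r - 1) = (weak_deriv i u x)\<^sup>2 * x ^ (r - 1)"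
        using assms(1)[OF that] by eventually_elim simp
    qed (use assms(2) S(1) pm that in auto)
    then show ?thesis by (simp add: wnorm_power2)
  qed
  have "beta_norm r b u = sqrt (\<Sum>l\<le>r. real (r choose l) * (b\<^sup>2 / 4) ^ (r - l) * (LINT x|HL. (G l x)\<^sup>2 * x ^ (r - 1)))"
    unfolding beta_norm_def atMost_atLeast0
  proof (intro arg_cong[where f=sqrt] sum.cong refl)
    fix l assume "l \<in> {0..r}"
    moreover have "(b\<^sup>2 / 4) ^ (r - l) = b ^ (2 * r - 2 * l) / 2 ^ (2 * r - 2 * l)"
      by (simp add: power_divide power_mult flip: diff_mult_distrib2)
    ultimately show "real (r choose l) * (b ^ (2 * r - 2 * l) / 2 ^ (2 * r - 2 * l)) * (wnorm (\<lambda>x. x ^ (r - 1)) (weak_deriv l u))\<^sup>2 =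
         real (r choose l) * (b\<^sup>2 / 4) ^ (r - l) * (LINT x|HL. (G l x)\<^sup>2 * x ^ (r - 1))"
      using eq[of l] by simp
  qed
  then show bn: "beta_norm r b u = sqrt (weighted_sum r b G)" by (simp add: weighted_sum_def)
  have "weighted_sum r b G \<ge> 0"
    unfolding weighted_sum_def by (intro sum_nonneg mult_nonneg_nonneg integral_nonneg_AE AE_I2) auto
  then show "(beta_norm r b u)\<^sup>2 = weighted_sum r b G" using bn by simp
  assume i: "i \<le> r"
  show "integrable HL (\<lambda>x. (G i x)\<^sup>2 * x ^ (r - 1))"
  proof (rule integrable_cong_AE_measurable[OF S(2)[OF i]])
    show "AE x in HL. (G i x)\<^sup>2 * x ^ (r - 1) = (weak_deriv i u x)\<^sup>2 * x ^ (r - 1)"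
      using assms(1)[OF i] by eventually_elim simp
  qed (use assms(2) pm i in auto)
qed

section \<open>The dual problem\<close>

lemma integral_0_primitive:
  fixes f :: "real \<Rightarrow> real"
  assumes "continuous_on UNIV f"
  shows "\<And>x. x > 0 \<Longrightarrow> ((\<lambda>x. integral {0..x} f) has_real_derivative f x) (at x)"
    and "continuous_on {0..} (\<lambda>x. integral {0..x} f)"
proof -
  have c: "continuous_on S f" for S using assms continuous_on_subset by blast
  show "((\<lambda>x. integral {0..x} f) has_real_derivative f x) (at x)" if "x > 0" for x
  proof -
    have "((\<lambda>x. integral {0..x} f) has_real_derivative f x) (at x within {0..x+1})"
      by (rule integral_has_real_derivative) (use that c in auto)
    moreover have "at x within {0..x+1} = at x" using that by (intro at_within_interior) auto
    ultimately show ?thesis by simp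
  qed
  show "continuous_on {0..} (\<lambda>x. integral {0..x} f)"
    unfolding continuous_on_eq_continuous_within
  proof
    fix x :: real assume x: "x \<in> {0..}"
    have "continuous_on {0..x+1} (\<lambda>x. integral {0..x} f)"
      by (intro indefinite_integral_continuous_1 integrable_continuous_real c)
    then have "continuous (at x within {0..x+1}) (\<lambda>x. integral {0..x} f)"
      using x by (simp add: continuous_on_eq_continuous_within)
    moreover have "at x within {0..x+1} = at x within {0..}"
      using x by (intro at_within_nhd[of x "{..<x+1}"]) auto
    ultimately show "continuous (at x within {0..}) (\<lambda>x. integral {0..x} f)" by simp
  qed
qed

text \<open>Variation of constants: P and Q solve P' = -\<open>\<kappa>\<close> P + g and Q' =
\<open>\<kappa>\<close> Q - g, and z is their sum divided by 2 \<open>\<kappa>\<close>. The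
constant b in Q removes the exponentially growing part, and a in P fulfils the boundary condition.
Both functions inherit the decay 1 / (1 + x) from g.\<close>

lemma dual_ode_solution:
  fixes g :: "real \<Rightarrow> real"
  assumes \<kappa>: "\<kappa> > 0" and \<mu>: "\<mu> \<ge> 0" and g: "continuous_on UNIV g" and M: "M \<ge> 0" "\<And>x. x \<ge> 0 \<Longrightarrow> \<bar>g x\<bar> \<le> M / (1 + x)"
  obtains z z' C where "continuous_on {0..} z" "continuous_on {0..} z'"
    "\<And>x. x > 0 \<Longrightarrow> (z has_real_derivative z' x) (at x)"
    "\<And>x. x > 0 \<Longrightarrow> (z' has_real_derivative \<kappa>\<^sup>2 * z x - g x) (at x)"
    "z' 0 = \<mu> * z 0" "C \<ge> 0" "\<And>x. x \<ge> 0 \<Longrightarrow> \<bar>z x\<bar> \<le> C / (1 + x)" "\<And>x. x \<ge> 0 \<Longrightarrow> \<bar>z' x\<bar> \<le> C / (1 + x)"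
proof -
  define I where "I x = integral {0..x} (\<lambda>y. exp (\<kappa> * y) * g y)" for x
  define J where "J x = integral {0..x} (\<lambda>y. exp (- (\<kappa> * y)) * g y)" for x
  define b where "b = (LINT y|HL. exp (- (\<kappa> * y)) * g y)"
  have cI: "continuous_on UNIV (\<lambda>y. exp (\<kappa> * y) * g y)" and cJ: "continuous_on UNIV (\<lambda>y. exp (- (\<kappa> * y)) * g y)"
    using g by (auto intro!: continuous_intros)
  note dI = integral_0_primitive[OF cI, folded I_def] and dJ = integral_0_primitive[OF cJ, folded J_def]
  define a where "a = b * (\<kappa> - \<mu>) / (\<kappa> + \<mu>)"
  define P where "P x = exp (- (\<kappa> * x)) * (a + I x)" for x
  define Q where "Q x = exp (\<kappa> * x) * (b - J x)" for x
  have dP: "(P has_real_derivative - \<kappa> * P x + g x) (at x)" if "x > 0" for x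
  proof -
    have e: "exp (- (\<kappa> * x)) * exp (\<kappa> * x) = 1" by (simp flip: exp_add)
    have "(P has_real_derivative exp (- (\<kappa> * x)) * (- \<kappa>) * (a + I x) + exp (- (\<kappa> * x)) * (exp (\<kappa> * x) * g x)) (at x)"
      unfolding P_def[abs_def] by (rule derivative_eq_intros dI(1)[OF that] refl | simp)+
    then show ?thesis by (simp add: P_def e flip: mult.assoc) (simp add: mult_ac)
  qed
  have dQ: "(Q has_real_derivative \<kappa> * Q x - g x) (at x)" if "x > 0" for x
  proof -
    have e: "exp (\<kappa> * x) * exp (- (\<kappa> * x)) = 1" by (simp flip: exp_add)
    have "(Q has_real_derivative exp (\<kappa> * x) * \<kappa> * (b - J x) - exp (\<kappa> * x) * (exp (- (\<kappa> * x)) * g x)) (at x)"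
      unfolding Q_def[abs_def] by (rule derivative_eq_intros dJ(1)[OF that] refl | simp)+
    then show ?thesis by (simp add: Q_def e flip: mult.assoc) (simp add: mult_ac)
  qed
  have cP: "continuous_on {0..} P" unfolding P_def[abs_def] by (intro continuous_intros dI(2))
  have cQ: "continuous_on {0..} Q" unfolding Q_def[abs_def] by (intro continuous_intros dJ(2))
  have ci: "f integrable_on {s..t}" if "continuous_on UNIV f" for f :: "real \<Rightarrow> real" and s t
    by (rule integrable_continuous_real) (rule continuous_on_subset[OF that], simp)
  have Jdiff: "\<bar>J t - J x\<bar> \<le> M / (1 + x) * (exp (- (\<kappa> * x)) / \<kappa>)" if x: "0 \<le> x" "x \<le> t" for x t
  proof -
    have "J t - J x = integral {x..t} (\<lambda>y. exp (- (\<kappa> * y)) * g y)"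
      unfolding J_def using Henstock_Kurzweil_Integration.integral_combine[OF x ci[OF cJ]] by simp
    also have "norm \<dots> \<le> integral {x..t} (\<lambda>y. M / (1 + x) * exp (- (\<kappa> * y)))"
    proof (rule integral_norm_bound_integral[OF ci[OF cJ] ci])
      fix y assume y: "y \<in> {x..t}"
      have "\<bar>g y\<bar> \<le> M / (1 + y)" using M(2) y x by simp
      also have "\<dots> \<le> M / (1 + x)" using M(1) y x by (intro divide_left_mono) auto
      finally have "\<bar>g y\<bar> * exp (- (\<kappa> * y)) \<le> M / (1 + x) * exp (- (\<kappa> * y))" by (intro mult_right_mono) auto
      then show "norm (exp (- (\<kappa> * y)) * g y) \<le> M / (1 + x) * exp (- (\<kappa> * y))"
        by (simp add: abs_mult mult.commute)
    qed (intro continuous_intros)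
    also have "\<dots> = M / (1 + x) * ((exp (- (\<kappa> * x)) - exp (- (\<kappa> * t))) / \<kappa>)"
    proof -
      have "((\<lambda>y. exp (- (\<kappa> * y))) has_integral - exp (- (\<kappa> * t)) / \<kappa> - - exp (- (\<kappa> * x)) / \<kappa>) {x..t}"
        by (rule fundamental_theorem_of_calculus[OF x(2)])
           (use \<kappa> in \<open>auto intro!: derivative_eq_intros simp flip: has_real_derivative_iff_has_vector_derivative\<close>)
      then show ?thesis by (simp add: integral_unique diff_divide_distrib)
    qed
    also have "\<dots> \<le> M / (1 + x) * (exp (- (\<kappa> * x)) / \<kappa>)"
      using M(1) x \<kappa> by (intro mult_left_mono divide_right_mono) auto
    finally show ?thesis by simp
  qed
  have int: "integrable HL (\<lambda>y. exp (- (\<kappa> * y)) * g y)"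
  proof (rule Bochner_Integration.integrable_bound)
    show "integrable HL (\<lambda>y. M * exp (- (\<kappa> * y)))" using integrable_exp_decay[OF \<kappa>] by simp
    show "(\<lambda>y. exp (- (\<kappa> * y)) * g y) \<in> borel_measurable HL"
      by (rule continuous_HL_measurable) (rule continuous_on_subset[OF cJ], simp)
    show "AE y in HL. norm (exp (- (\<kappa> * y)) * g y) \<le> norm (M * exp (- (\<kappa> * y)))"
    proof (rule AE_I2)
      fix y assume "y \<in> space HL" then have y: "y > 0" by simp
      have "\<bar>g y\<bar> \<le> M / (1 + y)" using M(2) y by simp
      also have "\<dots> \<le> M / 1" using M(1) y by (intro divide_left_mono) auto
      finally show "norm (exp (- (\<kappa> * y)) * g y) \<le> norm (M * exp (- (\<kappa> * y)))"
        using M(1) by (simp add: abs_mult mult.commute mult_right_mono)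
    qed
  qed
  have Jlim: "(\<lambda>n. J (real (Suc n))) \<longlonglongrightarrow> b"
  proof -
    have pJ: "primitive J (\<lambda>y. exp (- (\<kappa> * y)) * g y)"
      by (rule primitive_C1[OF dJ(1)]) (auto intro: continuous_on_subset[OF cJ])
    have "(\<lambda>n. J (real (Suc n)) - J (1 / real (Suc n))) \<longlonglongrightarrow> b"
      using integral_HL_exhaustion_limit[OF int] unfolding primitive_integral_exhaustion[OF pJ] b_def .
    moreover have "(\<lambda>n. J (1 / real (Suc n))) \<longlonglongrightarrow> J 0"
    proof (rule filterlim_compose[OF continuous_tendsto_at_right_0[OF dJ(2)]])
      show "filterlim (\<lambda>n. 1 / real (Suc n)) (at_right 0) sequentially" by real_asymp
    qed
    ultimately have "(\<lambda>n. J (real (Suc n)) - J (1 / real (Suc n)) + J (1 / real (Suc n))) \<longlonglongrightarrow> b + J 0" by (rule tendsto_add)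
    then show ?thesis by (simp add: J_def)
  qed
  have Qb: "\<bar>Q x\<bar> \<le> M / \<kappa> / (1 + x)" if x: "x \<ge> 0" for x
  proof -
    have "(\<lambda>n. \<bar>J (real (Suc n)) - J x\<bar>) \<longlonglongrightarrow> \<bar>b - J x\<bar>" by (intro tendsto_intros Jlim)
    moreover have "\<forall>\<^sub>F n in sequentially. real (Suc n) \<ge> x" by real_asymp
    then have "\<forall>\<^sub>F n in sequentially. \<bar>J (real (Suc n)) - J x\<bar> \<le> M / (1 + x) * (exp (- (\<kappa> * x)) / \<kappa>)"
      by eventually_elim (rule Jdiff[OF x])
    ultimately have le: "\<bar>b - J x\<bar> \<le> M / (1 + x) * (exp (- (\<kappa> * x)) / \<kappa>)"
      by (rule tendsto_upperbound) simp
    have "\<bar>Q x\<bar> = exp (\<kappa> * x) * \<bar>b - J x\<bar>" by (simp add: Q_def abs_mult)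
    also have "\<dots> \<le> exp (\<kappa> * x) * (M / (1 + x) * (exp (- (\<kappa> * x)) / \<kappa>))" using le by (intro mult_left_mono) auto
    also have "\<dots> = exp (\<kappa> * x) * exp (- (\<kappa> * x)) * (M / \<kappa> / (1 + x))" by (simp add: mult_ac)
    also have "exp (\<kappa> * x) * exp (- (\<kappa> * x)) = 1" by (simp flip: exp_add)
    finally show ?thesis by simp
  qed
  have Pb: "\<bar>P x\<bar> \<le> (\<bar>a\<bar> * (1 + 1 / \<kappa>) + M * (1 / \<kappa> + 1 / \<kappa>\<^sup>2)) / (1 + x)" if x: "x \<ge> 0" for x
  proof -
    define F where "F y = exp (\<kappa> * y) * ((1 + x - y) / \<kappa> + 1 / \<kappa>\<^sup>2)" for y
    have "norm (I x) \<le> integral {0..x} (\<lambda>y. M / (1 + x) * (exp (\<kappa> * y) * (1 + x - y)))"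
      unfolding I_def
    proof (rule integral_norm_bound_integral[OF ci[OF cI] ci])
      fix y assume y: "y \<in> {0..x}"
      have "\<bar>g y\<bar> \<le> M / (1 + y)" using M(2) y by simp
      also have "\<dots> = M * (1 / (1 + y))" by simp
      \<comment> \<open>Unlike 1 / (1 + y), this bound has an elementary antiderivative F after multiplication by e^(\<kappa>y).\<close>
      also have "\<dots> \<le> M * ((1 + x - y) / (1 + x))"
      proof (rule mult_left_mono[OF _ M(1)])
        have "0 \<le> y * (x - y)" using y by simp
        then have "1 + x \<le> (1 + x - y) * (1 + y)" by (simp add: algebra_simps)
        then show "1 / (1 + y) \<le> (1 + x - y) / (1 + x)" using y by (simp add: divide_simps)
      qed
      finally have "exp (\<kappa> * y) * \<bar>g y\<bar> \<le> exp (\<kappa> * y) * (M * ((1 + x - y) / (1 + x)))" by (intro mult_left_mono) auto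
      then show "norm (exp (\<kappa> * y) * g y) \<le> M / (1 + x) * (exp (\<kappa> * y) * (1 + x - y))"
        by (simp add: abs_mult mult_ac)
    qed (intro continuous_intros)
    also have "\<dots> = M / (1 + x) * (F x - F 0)"
    proof -
      have "(F has_real_derivative exp (\<kappa> * y) * (1 + x - y)) (at y within {0..x})" for y
      proof -
        have "((\<lambda>y. exp (\<kappa> * y)) has_real_derivative exp (\<kappa> * y) * \<kappa>) (at y within {0..x})"
          by (auto intro!: derivative_eq_intros)
        moreover have "((\<lambda>y. (1 + x - y) / \<kappa> + 1 / \<kappa>\<^sup>2) has_real_derivative (0 - 1) / \<kappa> + 0) (at y within {0..x})"
          by (intro DERIV_add DERIV_cdivide DERIV_diff DERIV_const DERIV_ident)
        ultimately have "(F has_real_derivative exp (\<kappa> * y) * \<kappa> * ((1 + x - y) / \<kappa> + 1 / \<kappa>\<^sup>2) + exp (\<kappa> * y) * (- 1 / \<kappa>)) (at y within {0..x})"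
          unfolding F_def[abs_def] by (rule DERIV_cong[OF DERIV_mult]) (simp add: mult.commute)
        moreover have "exp (\<kappa> * y) * \<kappa> * ((1 + x - y) / \<kappa> + 1 / \<kappa>\<^sup>2) + exp (\<kappa> * y) * (- 1 / \<kappa>) = exp (\<kappa> * y) * (1 + x - y)"
        proof -
          have "\<kappa> * ((1 + x - y) / \<kappa> + 1 / \<kappa>\<^sup>2) = (1 + x - y) + 1 / \<kappa>" using \<kappa> by (simp add: field_simps power2_eq_square)
          moreover have "A * \<kappa> * T + A * (- 1 / \<kappa>) = A * R" if "\<kappa> * T = R + 1 / \<kappa>" for A T R
            by (simp add: mult.assoc that distrib_left)
          ultimately show ?thesis by blast
        qed
        ultimately show ?thesis by (simp only:)
      qed
      then have "((\<lambda>y. exp (\<kappa> * y) * (1 + x - y)) has_integral F x - F 0) {0..x}"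
        by (intro fundamental_theorem_of_calculus x) (simp add: has_real_derivative_iff_has_vector_derivative)
      then show ?thesis by (simp add: integral_unique)
    qed
    also have "\<dots> \<le> M / (1 + x) * F x"
    proof -
      have "(1 + x) / \<kappa> \<ge> 0" "1 / \<kappa>\<^sup>2 \<ge> 0" using x \<kappa> by auto
      then have "F 0 \<ge> 0" unfolding F_def by simp
      then show ?thesis using M(1) x by (intro mult_left_mono) auto
    qed
    finally have "exp (- (\<kappa> * x)) * \<bar>I x\<bar> \<le> exp (- (\<kappa> * x)) * (M / (1 + x) * F x)" by (intro mult_left_mono) auto
    also have "\<dots> = exp (- (\<kappa> * x)) * exp (\<kappa> * x) * (M * (1 / \<kappa> + 1 / \<kappa>\<^sup>2) / (1 + x))" by (simp add: F_def)
    also have "exp (- (\<kappa> * x)) * exp (\<kappa> * x) = 1" by (simp flip: exp_add)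
    finally have 1: "exp (- (\<kappa> * x)) * \<bar>I x\<bar> \<le> M * (1 / \<kappa> + 1 / \<kappa>\<^sup>2) / (1 + x)" by simp
    have "exp (- (\<kappa> * x)) \<le> (1 + 1 / \<kappa>) / (1 + x)"
    proof -
      have "1 + x \<le> (1 + 1 / \<kappa>) * (1 + \<kappa> * x)" using \<kappa> x by (simp add: field_simps)
      also have "\<dots> \<le> (1 + 1 / \<kappa>) * exp (\<kappa> * x)"
        using \<kappa> exp_ge_add_one_self[of "\<kappa> * x"] by (intro mult_left_mono) auto
      finally have "(1 + x) * exp (- (\<kappa> * x)) \<le> (1 + 1 / \<kappa>) * exp (\<kappa> * x) * exp (- (\<kappa> * x))" by (intro mult_right_mono) auto
      also have "\<dots> = 1 + 1 / \<kappa>" by (simp add: mult.assoc flip: exp_add)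
      finally show ?thesis using x by (simp add: pos_le_divide_eq mult.commute)
    qed
    then have 2: "exp (- (\<kappa> * x)) * \<bar>a\<bar> \<le> \<bar>a\<bar> * (1 + 1 / \<kappa>) / (1 + x)"
      using mult_left_mono[of "exp (- (\<kappa> * x))" "(1 + 1 / \<kappa>) / (1 + x)" "\<bar>a\<bar>"] by (simp add: mult.commute)
    have "\<bar>P x\<bar> \<le> exp (- (\<kappa> * x)) * (\<bar>a\<bar> + \<bar>I x\<bar>)"
      unfolding P_def abs_mult by (intro mult_mono) auto
    with 1 2 show ?thesis by (simp add: distrib_left add_divide_distrib)
  qed
  define D where "D = \<bar>a\<bar> * (1 + 1 / \<kappa>) + M * (1 / \<kappa> + 1 / \<kappa>\<^sup>2) + M / \<kappa>"
  have D: "D \<ge> 0" using M(1) \<kappa> by (simp add: D_def)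
  have PQ: "\<bar>P x\<bar> + \<bar>Q x\<bar> \<le> D / (1 + x)" if "x \<ge> 0" for x
    using Pb[OF that] Qb[OF that] by (simp add: D_def add_divide_distrib)
  define z where "z x = (P x + Q x) / (2 * \<kappa>)" for x
  define z' where "z' x = (Q x - P x) / 2" for x
  show ?thesis
  proof (rule that[of z z' "D * (1 / (2 * \<kappa>) + 1 / 2)"])
    show "continuous_on {0..} z" "continuous_on {0..} z'"
      unfolding z_def[abs_def] z'_def[abs_def] using \<kappa> by (auto intro!: continuous_intros cP cQ)
    show "(z has_real_derivative z' x) (at x)" if "x > 0" for x
    proof -
      have "(z has_real_derivative ((- \<kappa> * P x + g x) + (\<kappa> * Q x - g x)) / (2 * \<kappa>)) (at x)"
        unfolding z_def[abs_def] by (intro DERIV_cdivide DERIV_add dP dQ that)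
      moreover have "((- \<kappa> * P x + g x) + (\<kappa> * Q x - g x)) / (2 * \<kappa>) = z' x"
        using \<kappa> by (simp add: z'_def field_simps)
      ultimately show ?thesis by (simp only:)
    qed
    show "(z' has_real_derivative \<kappa>\<^sup>2 * z x - g x) (at x)" if "x > 0" for x
    proof -
      have "(z' has_real_derivative ((\<kappa> * Q x - g x) - (- \<kappa> * P x + g x)) / 2) (at x)"
        unfolding z'_def[abs_def] by (intro DERIV_cdivide DERIV_diff dP dQ that)
      moreover have "((\<kappa> * Q x - g x) - (- \<kappa> * P x + g x)) / 2 = \<kappa>\<^sup>2 * z x - g x"
        using \<kappa> by (simp add: z_def field_simps power2_eq_square)
      ultimately show ?thesis by (simp only:)
    qed
    show "z' 0 = \<mu> * z 0"
    proof -
      have "P 0 = a" "Q 0 = b" by (simp_all add: P_def Q_def I_def J_def)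
      moreover have "(b - a) / 2 = \<mu> * ((a + b) / (2 * \<kappa>))"
      proof -
        have s: "\<kappa> + \<mu> > 0" using \<kappa> \<mu> by simp
        then have "b - a = 2 * b * \<mu> / (\<kappa> + \<mu>)" "a + b = 2 * b * \<kappa> / (\<kappa> + \<mu>)"
          by (simp_all add: a_def field_simps)
        moreover have "(2 * b * \<mu> / t) / 2 = \<mu> * ((2 * b * \<kappa> / t) / (2 * \<kappa>))" for t using \<kappa> by simp
        ultimately show ?thesis by (simp only:)
      qed
      ultimately show ?thesis by (simp add: z_def z'_def)
    qed
    show "D * (1 / (2 * \<kappa>) + 1 / 2) \<ge> 0" using D \<kappa> by simp
    fix x :: real assume x: "x \<ge> 0"
    have "\<bar>z x\<bar> \<le> (\<bar>P x\<bar> + \<bar>Q x\<bar>) / (2 * \<kappa>)" using \<kappa> by (simp add: z_def abs_divide divide_right_mono)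
    also have "\<dots> \<le> D / (1 + x) / (2 * \<kappa>)" using PQ[OF x] \<kappa> by (intro divide_right_mono) auto
    also have "\<dots> = D * (1 / (2 * \<kappa>)) / (1 + x)" by (simp only: times_divide_eq_right mult_1_right divide_divide_eq_left mult_ac)
    also have "\<dots> \<le> D * (1 / (2 * \<kappa>) + 1 / 2) / (1 + x)" using D x by (intro divide_right_mono mult_left_mono) auto
    finally show "\<bar>z x\<bar> \<le> D * (1 / (2 * \<kappa>) + 1 / 2) / (1 + x)" .
    have "\<bar>z' x\<bar> \<le> (\<bar>P x\<bar> + \<bar>Q x\<bar>) / 2" by (simp add: z'_def)
    also have "\<dots> \<le> D / (1 + x) / 2" using PQ[OF x] by (intro divide_right_mono) auto
    also have "\<dots> = D * (1 / 2) / (1 + x)" by (simp only: times_divide_eq_right mult_1_right divide_divide_eq_left mult_ac)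
    also have "\<dots> \<le> D * (1 / (2 * \<kappa>) + 1 / 2) / (1 + x)" using D x \<kappa> by (intro divide_right_mono mult_left_mono) auto
    finally show "\<bar>z' x\<bar> \<le> D * (1 / (2 * \<kappa>) + 1 / 2) / (1 + x)" .
  qed
qed

lemma sqint_inverse_bound:
  assumes "f \<in> borel_measurable HL" "\<And>x. x \<ge> 0 \<Longrightarrow> \<bar>f x\<bar> \<le> C / (1 + x)"
  shows "sqint HL f"
proof (rule sqint_bound[of HL "\<lambda>x. C * (1 / (1 + x))"])
  have "integrable HL (\<lambda>x. (1 / (1 + x))\<^sup>2)"
  proof (rule integrable_HL_primitive)
    show "primitive (\<lambda>x. - (1 / (1 + x))) (\<lambda>x. (1 / (1 + x))\<^sup>2)"
      by (rule primitive_C1) (auto intro!: derivative_eq_intros continuous_intros simp: power2_eq_square divide_simps)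
    show "\<bar>- (1 / (1 + x))\<bar> \<le> 1" if "x > 0" for x :: real using that by simp
  qed simp
  moreover have "(\<lambda>x::real. 1 / (1 + x)) \<in> borel_measurable HL"
    by (intro continuous_HL_measurable continuous_intros) auto
  ultimately show "sqint HL (\<lambda>x. C * (1 / (1 + x)))" by (intro sqint_cmult) (simp add: sqint_def)
  show "AE x in HL. \<bar>f x\<bar> \<le> \<bar>C * (1 / (1 + x))\<bar>"
  proof (rule AE_I2)
    fix x assume "x \<in> space HL"
    then have "\<bar>f x\<bar> \<le> C / (1 + x)" using assms(2)[of x] by simp
    then have "\<bar>f x\<bar> \<le> C * (1 / (1 + x))" by simp
    then show "\<bar>f x\<bar> \<le> \<bar>C * (1 / (1 + x))\<bar>" using abs_ge_self order_trans by blast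
  qed
qed (rule assms)

lemma continuous_inverse_bound_tendsto_0:
  fixes f :: "real \<Rightarrow> real"
  assumes "\<And>x. x \<ge> 0 \<Longrightarrow> \<bar>f x\<bar> \<le> C / (1 + x)"
  shows "(f \<longlongrightarrow> 0) at_top"
proof (rule Lim_null_comparison)
  show "\<forall>\<^sub>F x in at_top. norm (f x) \<le> C / (1 + x)"
    using eventually_ge_at_top[of 0] by eventually_elim (use assms in simp)
  show "((\<lambda>x. C / (1 + x)) \<longlongrightarrow> 0) at_top" by real_asymp
qed

lemma H1_pair_energy_ode:
  assumes z: "H1_pair z z'" and z': "H1_pair z' z''" and k: "H1_pair k l"
    and ode: "\<And>x. x > 0 \<Longrightarrow> z'' x = \<gamma> * z x - g x" and bc: "z' 0 = \<mu> * z 0"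
  shows "energy \<gamma> \<mu> z z' k l = (LINT x|HL. g x * k x)"
proof -
  note s = z[unfolded H1_pair_def] z'[unfolded H1_pair_def] k[unfolded H1_pair_def]
  have i: "integrable HL (\<lambda>x. z'' x * k x)" "integrable HL (\<lambda>x. z' x * l x)" "integrable HL (\<lambda>x. z x * k x)"
    using s by (auto intro: sqint_mult_integrable)
  have "(LINT x|HL. z'' x * k x + z' x * l x) = - (z' 0 * k 0)" by (rule H1_pair_integral_product[OF z' k])
  then have "(LINT x|HL. z'' x * k x) + (LINT x|HL. z' x * l x) = - (z' 0 * k 0)" using i by simp
  moreover have "(LINT x|HL. g x * k x) = (LINT x|HL. \<gamma> * (z x * k x) - z'' x * k x)"
    by (rule Bochner_Integration.integral_cong[OF refl]) (simp add: ode algebra_simps)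
  then have "(LINT x|HL. g x * k x) = \<gamma> * (LINT x|HL. z x * k x) - (LINT x|HL. z'' x * k x)"
    using i by simp
  ultimately show ?thesis by (simp add: energy_def bc)
qed

lemma square_integral_nonneg: "0 \<le> (LINT x|HL. (f x)\<^sup>2 * x)"
  by (rule integral_nonneg_AE) (auto intro!: AE_I2)

text \<open>Tested with z, the equation bounds z(0). Tested with x z, it bounds the weighted norms of z and
z', and z'' is then expressed by the equation. The second test uses an explicit antiderivative W,
because the weighted integrals are not known to be finite beforehand.\<close>

theorem dual_problem:
  assumes e: "H1_pair e e'" and \<gamma>: "\<gamma> > 0" and \<mu>: "\<mu> > 0" and b: "b > 0"
  defines "S \<equiv> (LINT x|HL. (e x)\<^sup>2 * (1 / (1 + x)))"
  obtains z :: "nat \<Rightarrow> real \<Rightarrow> real" where "H1_pair (z 0) (z 1)" "primitive (z 1) (z 2)"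
    "z 2 \<in> borel_measurable HL"
    "\<And>i. i \<le> 2 \<Longrightarrow> integrable HL (\<lambda>x. (z i x)\<^sup>2 * x)"
    "\<And>k l. H1_pair k l \<Longrightarrow> energy \<gamma> \<mu> (z 0) (z 1) k l = (LINT x|HL. e x / (1 + x) * k x)"
    "weighted_sum 2 b z \<le> 4 * S * (1 + 1 / (4 * \<mu>)) * (1 + b\<^sup>2 / (4 * \<gamma>))\<^sup>2"
proof -
  note e1 = e[unfolded H1_pair_def]
  have ec: "continuous_on {0..} e" and es: "sqint HL e" using e1 by auto
  obtain M where M: "M > 0" "\<And>x. x \<ge> 0 \<Longrightarrow> \<bar>e x\<bar> \<le> M"
    using continuous_tendsto_0_bounded[of e] e1 by blast
  \<comment> \<open>Extended continuously to the whole line, so that integrals from 0 can be differentiated.\<close>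
  define g where "g x = e (max x 0) / (1 + max x 0)" for x
  have g: "g x = e x / (1 + x)" if "x \<ge> 0" for x using that by (simp add: g_def)
  have gc: "continuous_on UNIV g"
    unfolding g_def[abs_def] by (intro continuous_intros continuous_on_compose2[OF ec]) (auto simp: max_def)
  have gM: "\<bar>g x\<bar> \<le> M / (1 + x)" if "x \<ge> 0" for x
    using M(2)[OF that] that by (simp add: g abs_divide divide_right_mono)
  have \<kappa>: "sqrt \<gamma> > 0" "(sqrt \<gamma>)\<^sup>2 = \<gamma>" using \<gamma> by auto
  obtain z z' C where z: "continuous_on {0..} z" "continuous_on {0..} z'"
    "\<And>x. x > 0 \<Longrightarrow> (z has_real_derivative z' x) (at x)"
    "\<And>x. x > 0 \<Longrightarrow> (z' has_real_derivative (sqrt \<gamma>)\<^sup>2 * z x - g x) (at x)"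
    "z' 0 = \<mu> * z 0" "C \<ge> 0" "\<And>x. x \<ge> 0 \<Longrightarrow> \<bar>z x\<bar> \<le> C / (1 + x)" "\<And>x. x \<ge> 0 \<Longrightarrow> \<bar>z' x\<bar> \<le> C / (1 + x)"
    by (rule dual_ode_solution[OF \<kappa>(1) less_imp_le[OF \<mu>] gc less_imp_le[OF M(1)] gM]) (assumption, rule that, assumption+)
  define z'' where "z'' x = \<gamma> * z x - g x" for x
  have dz': "(z' has_real_derivative z'' x) (at x)" if "x > 0" for x using z(4)[OF that] \<kappa>(2) by (simp add: z''_def)
  have zc: "continuous_on half_line z" "continuous_on half_line z'" using z(1,2) by (auto elim: continuous_on_subset)
  have gc': "continuous_on half_line g" using gc continuous_on_subset by blast
  have z''c: "continuous_on half_line z''" unfolding z''_def[abs_def] by (intro continuous_intros zc gc')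
  have sz: "sqint HL z" "sqint HL z'"
    by (rule sqint_inverse_bound[OF continuous_HL_measurable[OF zc(1)] z(7)], assumption,
        rule sqint_inverse_bound[OF continuous_HL_measurable[OF zc(2)] z(8)], assumption)
  have gs: "sqint HL g"
  proof (rule sqint_bound[OF es continuous_HL_measurable[OF gc']], rule AE_I2)
    fix x assume "x \<in> space HL" then have x: "x > 0" by simp
    have "\<bar>e x\<bar> / (1 + x) \<le> \<bar>e x\<bar> / 1" using x by (intro divide_left_mono) auto
    then show "\<bar>g x\<bar> \<le> \<bar>e x\<bar>" using x by (simp add: g)
  qed
  have sz'': "sqint HL z''" unfolding z''_def[abs_def] by (intro sqint_diff sqint_cmult sz gs)
  have H: "H1_pair z z'"
    unfolding H1_pair_def using z sz zc continuous_inverse_bound_tendsto_0[OF z(7)] by (auto intro: primitive_C1)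
  have pz': "primitive z' z''" by (rule primitive_C1[OF dz' z''c])
  have H': "H1_pair z' z''"
    unfolding H1_pair_def using z(2) sz(2) sz'' pz' continuous_inverse_bound_tendsto_0[OF z(8)] by auto
  have energy: "energy \<gamma> \<mu> z z' k l = (LINT x|HL. g x * k x)" if "H1_pair k l" for k l
    by (rule H1_pair_energy_ode[OF H H' that _ z(5)]) (simp add: z''_def)
  have bound: "x * (1 / (1 + x)\<^sup>2) \<le> 1 / (1 + x)" "1 / (1 + x)\<^sup>2 \<le> 1 / (1 + x)" if "x > 0" for x :: real
    using that by (auto simp: divide_simps power2_eq_square)
  have em: "e \<in> borel_measurable HL" using es by (simp add: sqint_def)
  have Si: "integrable HL (\<lambda>x. (e x)\<^sup>2 * (1 / (1 + x)))"
  proof (rule Bochner_Integration.integrable_bound[OF sqint_integrable[OF es]])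
    show "(\<lambda>x. (e x)\<^sup>2 * (1 / (1 + x))) \<in> borel_measurable HL"
      by (rule borel_measurable_times[OF borel_measurable_power[OF em] continuous_HL_measurable]) (auto intro!: continuous_intros)
    show "AE x in HL. norm ((e x)\<^sup>2 * (1 / (1 + x))) \<le> norm ((e x)\<^sup>2)"
    proof (rule AE_I2)
      fix x assume "x \<in> space HL" then have x: "x > 0" by simp
      then have "(e x)\<^sup>2 * (1 / (1 + x)) \<le> (e x)\<^sup>2 * 1" by (intro mult_left_mono) auto
      then show "norm ((e x)\<^sup>2 * (1 / (1 + x))) \<le> norm ((e x)\<^sup>2)" using x by simp
    qed
  qed
  have g2: "(LINT x|HL. (g x)\<^sup>2) \<le> S" unfolding S_def
  proof (rule integral_mono_AE[OF sqint_integrable[OF gs] Si], rule AE_I2)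
    fix x assume "x \<in> space HL" then have x: "x > 0" by simp
    show "(g x)\<^sup>2 \<le> (e x)\<^sup>2 * (1 / (1 + x))"
      using mult_left_mono[OF bound(2)[OF x], of "(e x)\<^sup>2"] x by (simp add: g power_divide)
  qed
  have xg: "(g x)\<^sup>2 * x \<le> (e x)\<^sup>2 * (1 / (1 + x))" if x: "x > 0" for x
    using mult_left_mono[OF bound(1)[OF x], of "(e x)\<^sup>2"] x by (simp add: g power_divide mult_ac)
  have xm: "(\<lambda>x::real. x) \<in> borel_measurable HL" by (intro continuous_HL_measurable continuous_intros)
  have g2xi: "integrable HL (\<lambda>x. (g x)\<^sup>2 * x)"
  proof (rule Bochner_Integration.integrable_bound[OF Si])
    show "(\<lambda>x. (g x)\<^sup>2 * x) \<in> borel_measurable HL"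
      by (intro borel_measurable_times borel_measurable_power sqint_measurable[OF gs] xm)
    show "AE x in HL. norm ((g x)\<^sup>2 * x) \<le> norm ((e x)\<^sup>2 * (1 / (1 + x)))"
      by (rule AE_I2) (use xg in \<open>auto simp: abs_mult\<close>)
  qed
  have g2x: "(LINT x|HL. (g x)\<^sup>2 * x) \<le> S" unfolding S_def
    by (rule integral_mono_AE[OF g2xi Si], rule AE_I2) (use xg in auto)
  have "0 \<le> (LINT x|HL. (g x)\<^sup>2)" by simp
  with g2 have Snn: "S \<ge> 0" by linarith

  \<comment> \<open>Tested with z, the equation bounds the trace; Young's inequality absorbs the zero-order term.\<close>
  define A where "A = (LINT x|HL. (z x)\<^sup>2)"
  have "(LINT x|HL. g x * z x) \<le> (LINT x|HL. 1 / (4 * \<gamma>) * (g x)\<^sup>2 + \<gamma> * (z x)\<^sup>2)"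
  proof (rule integral_mono[OF sqint_mult_integrable[OF gs sz(1)]])
    show "integrable HL (\<lambda>x. 1 / (4 * \<gamma>) * (g x)\<^sup>2 + \<gamma> * (z x)\<^sup>2)"
      using gs sz by (intro Bochner_Integration.integrable_add integrable_mult_right sqint_integrable)
    show "g x * z x \<le> 1 / (4 * \<gamma>) * (g x)\<^sup>2 + \<gamma> * (z x)\<^sup>2" for x
    proof -
      have "0 \<le> (g x - 2 * \<gamma> * z x)\<^sup>2 / (4 * \<gamma>)" using \<gamma> by simp
      also have "\<dots> = 1 / (4 * \<gamma>) * (g x)\<^sup>2 + \<gamma> * (z x)\<^sup>2 - g x * z x"
        using \<gamma> by (simp add: field_simps power2_eq_square)
      finally show ?thesis by simp
    qed
  qed
  also have "\<dots> = 1 / (4 * \<gamma>) * (LINT x|HL. (g x)\<^sup>2) + \<gamma> * A"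
    using sqint_integrable[OF gs] sqint_integrable[OF sz(1)] by (simp add: A_def)
  also have "\<dots> \<le> 1 / (4 * \<gamma>) * S + \<gamma> * A" using g2 \<gamma> by (intro add_mono mult_left_mono) auto
  finally have "energy \<gamma> \<mu> z z' z z' \<le> 1 / (4 * \<gamma>) * S + \<gamma> * A" using energy[OF H] by simp
  moreover have "energy \<gamma> \<mu> z z' z z' = \<mu> * (z 0)\<^sup>2 + (LINT x|HL. (z' x)\<^sup>2) + \<gamma> * A"
    by (simp add: energy_def A_def power2_eq_square mult.assoc)
  moreover have "(LINT x|HL. (z' x)\<^sup>2) \<ge> 0" by simp
  ultimately have "\<mu> * (z 0)\<^sup>2 \<le> 1 / (4 * \<gamma>) * S" by linarith
  then have z0: "(z 0)\<^sup>2 \<le> S / (4 * \<gamma> * \<mu>)" using \<mu> \<gamma> by (simp add: field_simps)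

  \<comment> \<open>Tested with x z, it bounds the weighted norms of z and z'.\<close>
  have xgs: "sqint HL (\<lambda>x. x * g x)"
  proof (rule sqint_bound[OF es])
    show "(\<lambda>x. x * g x) \<in> borel_measurable HL" by (intro borel_measurable_times sqint_measurable[OF gs] xm)
    show "AE x in HL. \<bar>x * g x\<bar> \<le> \<bar>e x\<bar>"
    proof (rule AE_I2)
      fix x assume "x \<in> space HL" then have x: "x > 0" by simp
      have "x / (1 + x) * \<bar>e x\<bar> \<le> 1 * \<bar>e x\<bar>" using x by (intro mult_right_mono) auto
      then show "\<bar>x * g x\<bar> \<le> \<bar>e x\<bar>" using x by (simp add: g abs_mult)
    qed
  qed
  have ixgz: "integrable HL (\<lambda>x. x * g x * z x)" by (rule sqint_mult_integrable[OF xgs sz(1)])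
  \<comment> \<open>Multiplied by x z, the equation says that \<tau> is the derivative of W.\<close>
  define \<tau> where "\<tau> x = x * (z' x)\<^sup>2 + \<gamma> * (x * (z x)\<^sup>2) - x * g x * z x" for x
  define W where "W x = x * (z x * z' x) - (z x)\<^sup>2 / 2" for x
  have W: "primitive W \<tau>"
  proof (rule primitive_C1)
    fix x :: real assume x: "x > 0"
    have "(W has_real_derivative (1 * (z x * z' x) + (z' x * z' x + z'' x * z x) * x) - 2 * z x * z' x / 2) (at x)"
      unfolding W_def[abs_def]
      by (rule derivative_eq_intros z(3)[OF x] dz'[OF x] refl | simp)+
    moreover have "(1 * (z x * z' x) + (z' x * z' x + z'' x * z x) * x) - 2 * z x * z' x / 2 = \<tau> x"
      by (simp add: \<tau>_def z''_def power2_eq_square algebra_simps)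
    ultimately show "(W has_real_derivative \<tau> x) (at x)" by simp
  next
    show "continuous_on half_line \<tau>" unfolding \<tau>_def[abs_def] by (intro continuous_intros zc gc')
  qed
  have Wb: "\<bar>W x\<bar> \<le> 2 * C\<^sup>2 / (1 + x)" if x: "x > 0" for x
  proof -
    have "\<bar>x * (z x * z' x)\<bar> \<le> x * (C / (1 + x) * (C / (1 + x)))"
      using z(7)[of x] z(8)[of x] x unfolding abs_mult by (intro mult_mono) auto
    also have "\<dots> = C\<^sup>2 * (x * (1 / (1 + x)\<^sup>2))" by (simp add: power2_eq_square)
    also have "\<dots> \<le> C\<^sup>2 * (1 / (1 + x))" by (intro mult_left_mono bound x) auto
    finally have 1: "\<bar>x * (z x * z' x)\<bar> \<le> C\<^sup>2 / (1 + x)" by simp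
    have "\<bar>z x\<bar> * \<bar>z x\<bar> \<le> C / (1 + x) * (C / (1 + x))"
      using z(7)[of x] x by (intro mult_mono) auto
    also have "\<dots> = C\<^sup>2 * (1 / (1 + x)\<^sup>2)" by (simp add: power2_eq_square)
    also have "\<dots> \<le> C\<^sup>2 * (1 / (1 + x))" by (intro mult_left_mono bound x) auto
    finally have 2: "(z x)\<^sup>2 \<le> C\<^sup>2 / (1 + x)" by (simp add: power2_eq_square)
    have "\<bar>W x\<bar> \<le> \<bar>x * (z x * z' x)\<bar> + (z x)\<^sup>2 / 2" unfolding W_def using zero_le_power2[of "z x"] by linarith
    moreover have "(z x)\<^sup>2 \<ge> 0" by simp
    ultimately show ?thesis using 1 2 by simp
  qed
  have "continuous_on half_line (\<lambda>x. x * g x * z x)" by (intro continuous_intros gc' zc)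
  then have "(\<lambda>x. x * g x * z x) absolutely_integrable_on {s..t}" if "0 < s" for s t
    by (intro absolutely_integrable_continuous_real) (rule continuous_on_subset, use that in auto)
  then obtain B where B: "primitive B (\<lambda>x. x * g x * z x)"
    using primitive_exists[OF locally_integrableI] by blast
  obtain CB where CB: "\<And>x. x > 0 \<Longrightarrow> \<bar>B x\<bar> \<le> CB" by (rule primitive_bounded[OF B ixgz]) blast
  \<comment> \<open>The weighted integrals are finite, since their nonnegative integrand has a bounded antiderivative.\<close>
  have isum: "integrable HL (\<lambda>x. \<tau> x + x * g x * z x)"
  proof (rule integrable_HL_primitive[OF primitive_add[OF W B]])
    show "0 \<le> \<tau> x + x * g x * z x" if "x > 0" for x using that \<gamma> by (simp add: \<tau>_def)
    show "\<bar>W x + B x\<bar> \<le> 2 * C\<^sup>2 + CB" if "x > 0" for x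
    proof -
      have "2 * C\<^sup>2 / (1 + x) \<le> 2 * C\<^sup>2 / 1" using that by (intro divide_left_mono) auto
      with Wb[OF that] CB[OF that] show ?thesis by linarith
    qed
  qed
  have tsum: "\<tau> x + x * g x * z x = (z' x)\<^sup>2 * x + \<gamma> * ((z x)\<^sup>2 * x)" for x by (simp add: \<tau>_def mult_ac)
  have zxm: "(\<lambda>x. (z x)\<^sup>2 * x) \<in> borel_measurable HL" "(\<lambda>x. (z' x)\<^sup>2 * x) \<in> borel_measurable HL" "(\<lambda>x. (z'' x)\<^sup>2 * x) \<in> borel_measurable HL"
    by (intro borel_measurable_times borel_measurable_power sqint_measurable sz sz'' xm)+
  have iz': "integrable HL (\<lambda>x. (z' x)\<^sup>2 * x)"
    by (rule Bochner_Integration.integrable_bound[OF isum zxm(2)], rule AE_I2) (use \<gamma> in \<open>auto simp: tsum\<close>)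
  have "integrable HL (\<lambda>x. \<gamma> * ((z x)\<^sup>2 * x))"
    by (rule Bochner_Integration.integrable_bound[OF isum], use zxm in simp, rule AE_I2) (use \<gamma> in \<open>auto simp: tsum\<close>)
  then have iz: "integrable HL (\<lambda>x. (z x)\<^sup>2 * x)" using \<gamma> by simp
  have i\<tau>: "integrable HL \<tau>" using Bochner_Integration.integrable_diff[OF isum ixgz] by simp
  have "(LINT x|HL. \<tau> x) = 0 - W 0"
  proof (rule integral_HL_primitive[OF W i\<tau>])
    have "continuous_on {0..} W" unfolding W_def[abs_def] by (intro continuous_intros z(1,2)) auto
    then show "(W \<longlongrightarrow> W 0) (at_right 0)" by (rule continuous_tendsto_at_right_0)
    show "(W \<longlongrightarrow> 0) at_top"
    proof (rule Lim_null_comparison)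
      show "\<forall>\<^sub>F x in at_top. norm (W x) \<le> 2 * C\<^sup>2 / (1 + x)"
        using eventually_gt_at_top[of 0] by eventually_elim (use Wb in simp)
      show "((\<lambda>x. 2 * C\<^sup>2 / (1 + x)) \<longlongrightarrow> 0) at_top" by real_asymp
    qed
  qed
  then have \<tau>eq: "(LINT x|HL. \<tau> x) = (z 0)\<^sup>2 / 2" by (simp add: W_def)
  define X0 X1 X2 where "X0 = (LINT x|HL. (z x)\<^sup>2 * x)" and "X1 = (LINT x|HL. (z' x)\<^sup>2 * x)" and "X2 = (LINT x|HL. (z'' x)\<^sup>2 * x)"
  have Xnn: "X0 \<ge> 0" "X1 \<ge> 0" by (simp_all add: X0_def X1_def square_integral_nonneg)
  have "X1 + \<gamma> * X0 = (LINT x|HL. \<tau> x + x * g x * z x)"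
    unfolding tsum X0_def X1_def using iz iz' by simp
  also have "\<dots> = (z 0)\<^sup>2 / 2 + (LINT x|HL. x * g x * z x)" using i\<tau> ixgz \<tau>eq by simp
  also have "(LINT x|HL. x * g x * z x) \<le> (LINT x|HL. 1 / (2 * \<gamma>) * ((g x)\<^sup>2 * x) + \<gamma> / 2 * ((z x)\<^sup>2 * x))"
  proof (rule integral_mono_AE[OF ixgz])
    show "integrable HL (\<lambda>x. 1 / (2 * \<gamma>) * ((g x)\<^sup>2 * x) + \<gamma> / 2 * ((z x)\<^sup>2 * x))"
      by (intro Bochner_Integration.integrable_add integrable_mult_right g2xi iz)
    show "AE x in HL. x * g x * z x \<le> 1 / (2 * \<gamma>) * ((g x)\<^sup>2 * x) + \<gamma> / 2 * ((z x)\<^sup>2 * x)"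
    proof (rule AE_I2)
      fix x assume "x \<in> space HL"
      then have "0 \<le> (g x - \<gamma> * z x)\<^sup>2 / (2 * \<gamma>) * x" using \<gamma> by simp
      also have "\<dots> = 1 / (2 * \<gamma>) * ((g x)\<^sup>2 * x) + \<gamma> / 2 * ((z x)\<^sup>2 * x) - x * g x * z x"
        using \<gamma> by (simp add: field_simps power2_eq_square)
      finally show "x * g x * z x \<le> 1 / (2 * \<gamma>) * ((g x)\<^sup>2 * x) + \<gamma> / 2 * ((z x)\<^sup>2 * x)" by simp
    qed
  qed
  also have "(LINT x|HL. 1 / (2 * \<gamma>) * ((g x)\<^sup>2 * x) + \<gamma> / 2 * ((z x)\<^sup>2 * x)) = 1 / (2 * \<gamma>) * (LINT x|HL. (g x)\<^sup>2 * x) + \<gamma> / 2 * X0"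
    using g2xi iz by (simp add: X0_def)
  also have "\<dots> \<le> 1 / (2 * \<gamma>) * S + \<gamma> / 2 * X0" using g2x \<gamma> by (intro add_mono mult_left_mono) auto
  finally have "X1 + \<gamma> / 2 * X0 \<le> (z 0)\<^sup>2 / 2 + 1 / (2 * \<gamma>) * S" by simp
  also have "\<dots> \<le> S / (4 * \<gamma> * \<mu>) / 2 + 1 / (2 * \<gamma>) * S" using z0 by simp
  also have "\<dots> = S * (1 + 1 / (4 * \<mu>)) / (2 * \<gamma>)" using \<gamma> \<mu> by (simp add: field_simps)
  finally have XX: "X1 + \<gamma> / 2 * X0 \<le> S * (1 + 1 / (4 * \<mu>)) / (2 * \<gamma>)" .
  define m where "m = 1 + 1 / (4 * \<mu>)"
  have m: "m \<ge> 1" using \<mu> by (simp add: m_def)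
  have "0 \<le> \<gamma> / 2 * X0" using Xnn \<gamma> by simp
  with XX have X1: "X1 \<le> S * m / (2 * \<gamma>)" unfolding m_def by linarith
  have "\<gamma> / 2 * X0 \<le> S * m / (2 * \<gamma>)" using XX Xnn(2) unfolding m_def by linarith
  then have X0: "\<gamma>\<^sup>2 * X0 \<le> S * m" using \<gamma> by (simp add: field_simps power2_eq_square)
  have z''le: "(z'' x)\<^sup>2 * x \<le> 2 * \<gamma>\<^sup>2 * ((z x)\<^sup>2 * x) + 2 * ((g x)\<^sup>2 * x)" if "x > 0" for x
  proof -
    have "0 \<le> (\<gamma> * z x + g x)\<^sup>2" by simp
    then have "(z'' x)\<^sup>2 \<le> 2 * \<gamma>\<^sup>2 * (z x)\<^sup>2 + 2 * (g x)\<^sup>2"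
      by (simp add: z''_def power2_eq_square algebra_simps)
    then have "(z'' x)\<^sup>2 * x \<le> (2 * \<gamma>\<^sup>2 * (z x)\<^sup>2 + 2 * (g x)\<^sup>2) * x" using that by (intro mult_right_mono) auto
    then show ?thesis by (simp add: algebra_simps)
  qed
  have iR: "integrable HL (\<lambda>x. 2 * \<gamma>\<^sup>2 * ((z x)\<^sup>2 * x) + 2 * ((g x)\<^sup>2 * x))"
    by (intro Bochner_Integration.integrable_add integrable_mult_right iz g2xi)
  have iz'': "integrable HL (\<lambda>x. (z'' x)\<^sup>2 * x)"
  proof (rule Bochner_Integration.integrable_bound[OF iR zxm(3)], rule AE_I2)
    fix x assume "x \<in> space HL" then have x: "x > 0" by simp
    have "0 \<le> (z'' x)\<^sup>2 * x" using x by simp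
    with z''le[OF x] show "norm ((z'' x)\<^sup>2 * x) \<le> norm (2 * \<gamma>\<^sup>2 * ((z x)\<^sup>2 * x) + 2 * ((g x)\<^sup>2 * x))"
      unfolding real_norm_def by linarith
  qed
  have "X2 \<le> (LINT x|HL. 2 * \<gamma>\<^sup>2 * ((z x)\<^sup>2 * x) + 2 * ((g x)\<^sup>2 * x))"
    unfolding X2_def by (rule integral_mono_AE[OF iz'' iR], rule AE_I2) (use z''le in auto)
  also have "\<dots> = 2 * \<gamma>\<^sup>2 * X0 + 2 * (LINT x|HL. (g x)\<^sup>2 * x)" using iz g2xi by (simp add: X0_def)
  also have "\<dots> \<le> 2 * (S * m) + 2 * S" using X0 g2x by simp
  also have "\<dots> \<le> 4 * (S * m)" using Snn m mult_left_mono[of 1 m S] by simp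
  finally have X2: "X2 \<le> 4 * (S * m)" .
  define t where "t = b\<^sup>2 / (4 * \<gamma>)"
  have t: "t \<ge> 0" using \<gamma> by (simp add: t_def)
  have bt: "b\<^sup>2 / 4 = t * \<gamma>" using \<gamma> by (simp add: t_def)
  have sum: "(b\<^sup>2 / 4)\<^sup>2 * X0 + 2 * (b\<^sup>2 / 4) * X1 + X2 \<le> 4 * S * m * (1 + t)\<^sup>2"
  proof -
    have "(b\<^sup>2 / 4)\<^sup>2 * X0 = t\<^sup>2 * (\<gamma>\<^sup>2 * X0)" unfolding bt by (simp add: power_mult_distrib)
    also have "\<dots> \<le> t\<^sup>2 * (S * m)" using X0 by (intro mult_left_mono) auto
    finally have 1: "(b\<^sup>2 / 4)\<^sup>2 * X0 \<le> t\<^sup>2 * (S * m)" .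
    have "2 * (b\<^sup>2 / 4) * X1 \<le> 2 * (t * \<gamma>) * (S * m / (2 * \<gamma>))" unfolding bt using X1 t \<gamma> by (intro mult_left_mono) auto
    also have "\<dots> = t * (S * m)" using \<gamma> by (simp add: field_simps)
    finally have 2: "2 * (b\<^sup>2 / 4) * X1 \<le> t * (S * m)" .
    have Sm: "0 \<le> S * m" using Snn m by simp
    have "4 * S * m * (1 + t)\<^sup>2 = t\<^sup>2 * (S * m) + t * (S * m) + 4 * (S * m) + (3 * t\<^sup>2 * (S * m) + 7 * (t * (S * m)))"
      by (simp add: power2_eq_square algebra_simps)
    moreover have "0 \<le> 3 * t\<^sup>2 * (S * m) + 7 * (t * (S * m))" using Sm t by simp
    ultimately show ?thesis using 1 2 X2 by linarith
  qed
  define Z where "Z i = (if i = 0 then z else if i = 1 then z' else z'')" for i :: nat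
  have ws: "weighted_sum 2 b Z = (b\<^sup>2 / 4)\<^sup>2 * X0 + 2 * (b\<^sup>2 / 4) * X1 + X2"
    by (simp add: weighted_sum_def Z_def X0_def X1_def X2_def numeral_2_eq_2)
  show ?thesis
  proof (rule that[of Z])
    show "H1_pair (Z 0) (Z 1)" "primitive (Z 1) (Z 2)" using H pz' by (simp_all add: Z_def)
    show "Z 2 \<in> borel_measurable HL" using sz'' by (simp add: Z_def sqint_def)
    show "integrable HL (\<lambda>x. (Z i x)\<^sup>2 * x)" for i using iz iz' iz'' by (simp add: Z_def)
    show "energy \<gamma> \<mu> (Z 0) (Z 1) k l = (LINT x|HL. e x / (1 + x) * k x)" if "H1_pair k l" for k l
    proof -
      have "(LINT x|HL. g x * k x) = (LINT x|HL. e x / (1 + x) * k x)"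
        by (rule Bochner_Integration.integral_cong[OF refl]) (simp add: g)
      then show ?thesis using energy[OF that] by (simp add: Z_def)
    qed
    show "weighted_sum 2 b Z \<le> 4 * S * (1 + 1 / (4 * \<mu>)) * (1 + b\<^sup>2 / (4 * \<gamma>))\<^sup>2"
      unfolding ws using sum by (simp add: m_def t_def)
  qed
qed

section \<open>Error of the spectral scheme\<close>

text \<open>The approximation has the exact trace, so the boundary term of the energy vanishes and
\<open>\<gamma>\<close> is compared with b^2 / 4.\<close>

lemma energy_approximation:
  assumes r: "r \<ge> 1" and b: "b > 0" and N: "N \<ge> 2 * r" and \<gamma>: "\<gamma> \<ge> 0"
    and H: "H1_pair (G 0) (G 1)"
    and chain: "\<And>i. i < r \<Longrightarrow> primitive (G i) (G (Suc i))"
    and meas: "\<And>i. i \<le> r \<Longrightarrow> G i \<in> borel_measurable HL"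
    and int: "\<And>i. i \<le> r \<Longrightarrow> integrable HL (\<lambda>x. (G i x)\<^sup>2 * x ^ (r - 1))"
  obtains p y y' where "degree p \<le> N" "y = (\<lambda>x. G 0 x - laguerre_fun b p x)"
    "y' = (\<lambda>x. G 1 x - laguerre_fun b (pderiv p - smult (b/2) p) x)" "H1_pair y y'"
    "energy \<gamma> \<mu> y y' y y' \<le> (1 + 4 * \<gamma> / b\<^sup>2) * (4 ^ r * (b * real N) powr (1 - real r) * weighted_sum r b G)"
proof -
  obtain p where p: "degree p \<le> N" "poly p 0 = G 0 0"
    "(LINT x|HL. (G 1 x - laguerre_fun b (pderiv p - smult (b/2) p) x)\<^sup>2) + b\<^sup>2 / 4 * (LINT x|HL. (G 0 x - laguerre_fun b p x)\<^sup>2)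
      \<le> 4 ^ r * (b * real N) powr (1 - real r) * weighted_sum r b G"
    by (rule approximation_in_X_space[OF r b N H chain meas int])
  define y where "y x = G 0 x - laguerre_fun b p x" for x
  define y' where "y' x = G 1 x - laguerre_fun b (pderiv p - smult (b/2) p) x" for x
  have y: "H1_pair y y'" unfolding y_def[abs_def] y'_def[abs_def] by (rule H1_pair_diff[OF H H1_pair_laguerre_fun[OF b]])
  have y0: "y 0 = 0" using p(2) by (simp add: y_def laguerre_fun_def)
  define A B where "A = (LINT x|HL. (y' x)\<^sup>2)" and "B = (LINT x|HL. (y x)\<^sup>2)"
  have AB: "A \<ge> 0" "B \<ge> 0" by (simp_all add: A_def B_def)
  have "energy \<gamma> \<mu> y y' y y' = A + \<gamma> * B" by (simp add: energy_def y0 A_def B_def power2_eq_square)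
  also have "\<dots> \<le> (1 + 4 * \<gamma> / b\<^sup>2) * (A + b\<^sup>2 / 4 * B)"
  proof -
    have "(1 + 4 * \<gamma> / b\<^sup>2) * (A + b\<^sup>2 / 4 * B) = A + \<gamma> * B + (4 * \<gamma> / b\<^sup>2 * A + b\<^sup>2 / 4 * B)"
      using b by (simp add: field_simps)
    moreover have "0 \<le> 4 * \<gamma> / b\<^sup>2 * A + b\<^sup>2 / 4 * B" using AB \<gamma> by simp
    ultimately show ?thesis by linarith
  qed
  also have "\<dots> \<le> (1 + 4 * \<gamma> / b\<^sup>2) * (4 ^ r * (b * real N) powr (1 - real r) * weighted_sum r b G)"
    using p(3) \<gamma> by (intro mult_left_mono) (auto simp: A_def B_def y_def y'_def)
  finally show ?thesis using that[of p y y'] p(1) y by (auto simp: y_def[abs_def] y'_def[abs_def])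
qed

text \<open>Cea's lemma for a symmetric form: e is the error of the scheme, y that of any other element of the
space.\<close>

lemma Galerkin_optimality:
  assumes "\<mu> \<ge> 0" "\<gamma> \<ge> 0" "H1_pair e e'" "H1_pair y y'"
    and orth: "energy \<gamma> \<mu> e e' e e' = energy \<gamma> \<mu> e e' y y'"
  shows "energy \<gamma> \<mu> e e' e e' \<le> energy \<gamma> \<mu> y y' y y'"
proof -
  define E where "E = energy \<gamma> \<mu> e e' e e'"
  have E: "E \<ge> 0" unfolding E_def by (rule energy_nonneg[OF assms(1,2)])
  have "E * E \<le> E * energy \<gamma> \<mu> y y' y y'"
    using energy_Cauchy_Schwarz[OF assms(1-4)] orth by (simp add: E_def power2_eq_square)
  then show ?thesis
    using E energy_nonneg[OF assms(1,2), of y y'] by (cases "E = 0") (auto simp: E_def mult_le_cancel_left)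
qed

lemma final_constant:
  assumes "\<mu> > 0" "\<gamma> > 0" "b > 0"
  shows "(1 + 4 * \<gamma> / b\<^sup>2)\<^sup>2 * (1 + 1 / (4 * \<mu>)) * (1 + b\<^sup>2 / (4 * \<gamma>))\<^sup>2
    \<le> ((1 + 1 / sqrt (2 * \<mu>)) * (1 + b\<^sup>2 / (4 * \<gamma>)) * (1 + 2 * sqrt \<gamma> / b)\<^sup>2)\<^sup>2"
proof -
  have "1 + 4 * \<gamma> / b\<^sup>2 \<le> (1 + 2 * sqrt \<gamma> / b)\<^sup>2"
  proof -
    have "(1 + 2 * sqrt \<gamma> / b)\<^sup>2 = 1 + 4 * (sqrt \<gamma>)\<^sup>2 / b\<^sup>2 + 4 * sqrt \<gamma> / b"
      by (simp add: power2_sum power_divide power_mult_distrib)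
    moreover have "0 \<le> 4 * sqrt \<gamma> / b" using assms by simp
    ultimately show ?thesis using assms by simp
  qed
  then have 1: "(1 + 4 * \<gamma> / b\<^sup>2)\<^sup>2 \<le> ((1 + 2 * sqrt \<gamma> / b)\<^sup>2)\<^sup>2"
    using assms by (intro power_mono) auto
  have 2: "1 + 1 / (4 * \<mu>) \<le> (1 + 1 / sqrt (2 * \<mu>))\<^sup>2"
  proof -
    have "(1 + 1 / sqrt (2 * \<mu>))\<^sup>2 = 1 + 1 / (2 * \<mu>) + 2 / sqrt (2 * \<mu>)"
      using assms by (simp add: power2_sum power_divide)
    moreover have "0 \<le> 2 / sqrt (2 * \<mu>)" using assms by simp
    moreover have "1 / (4 * \<mu>) \<le> 1 / (2 * \<mu>)" using assms by (intro divide_left_mono) auto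
    ultimately show ?thesis by linarith
  qed
  have "(1 + 4 * \<gamma> / b\<^sup>2)\<^sup>2 * (1 + 1 / (4 * \<mu>)) * (1 + b\<^sup>2 / (4 * \<gamma>))\<^sup>2
     \<le> ((1 + 2 * sqrt \<gamma> / b)\<^sup>2)\<^sup>2 * (1 + 1 / sqrt (2 * \<mu>))\<^sup>2 * (1 + b\<^sup>2 / (4 * \<gamma>))\<^sup>2"
    using assms by (intro mult_right_mono mult_mono 1 2) auto
  then show ?thesis by (simp only: power_mult_distrib mult_ac)
qed

text \<open>The bound N \<ge> 4 is needed because the dual solution is approximated with two derivatives, that
is, with r = 2 in \<open>energy_approximation\<close>.\<close>

lemma spectral_error_bounds:
  fixes \<beta> \<gamma> \<mu> \<eta> :: real
  assumes r: "r \<ge> 1" and \<beta>: "\<beta> > 0" and \<gamma>: "\<gamma> \<ge> 0" and \<mu>: "\<mu> \<ge> 0"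
    and u: "weak_solution \<gamma> \<mu> \<eta> f u" and ur: "u \<in> sobolev r (\<lambda>x. x ^ (r - 1))"
    and N: "N \<ge> 2 * r" "N \<ge> 4" and uN: "spectral_solution \<beta> N \<gamma> \<mu> \<eta> f uN"
  shows "\<mu> * \<bar>trace0 u - trace0 uN\<bar>\<^sup>2 + (L2norm (weak_deriv 1 (\<lambda>x. u x - uN x)))\<^sup>2
             + \<gamma> * (L2norm (\<lambda>x. u x - uN x))\<^sup>2
           \<le> 4 ^ r * (1 + 4 * \<gamma> / \<beta>\<^sup>2) * (\<beta> * real N) powr (1 - real r) * (beta_norm r \<beta> u)\<^sup>2" (is ?energy)
    and "\<gamma> > 0 \<Longrightarrow> \<mu> > 0 \<Longrightarrow> wnorm (\<lambda>x. 1 / (1 + x)) (\<lambda>x. u x - uN x)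
           \<le> 8 * 4 ^ r * (1 + 1 / sqrt (2 * \<mu>)) * (1 + \<beta>\<^sup>2 / (4 * \<gamma>))
               * (1 + 2 * sqrt \<gamma> / \<beta>)\<^sup>2 * (\<beta> * real N) powr (- (real r / 2)) * beta_norm r \<beta> u"
proof -
  have uH: "u \<in> H1" and uv: "vanishes_at_infinity u"
    and ueq: "\<And>v. v \<in> H1 \<Longrightarrow> bilinear_form \<gamma> \<mu> u v = f v + \<eta> * trace0 v"
    using u by (auto simp: weak_solution_def)
  obtain h where h: "represents u h (weak_deriv 1 u)" using H1_represents[OF uH uv] by blast
  obtain G where G: "G 0 = h" "\<And>i. i < r \<Longrightarrow> primitive (G i) (G (Suc i))"
    "\<And>i. i \<le> r \<Longrightarrow> AE x in HL. G i x = weak_deriv i u x" "\<And>i. i \<le> r \<Longrightarrow> G i \<in> borel_measurable HL"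
    by (rule sobolev_chain[OF ur r h]) (rule that, assumption+)
  have bn1: "(beta_norm r \<beta> u)\<^sup>2 = weighted_sum r \<beta> G"
    by (rule beta_norm_eq_weighted_sum(1)[OF G(3,4) ur])
  have bn2: "beta_norm r \<beta> u = sqrt (weighted_sum r \<beta> G)"
    by (rule beta_norm_eq_weighted_sum(2)[OF G(3,4) ur])
  have int: "integrable HL (\<lambda>x. (G i x)\<^sup>2 * x ^ (r - 1))" if "i \<le> r" for i
    by (rule beta_norm_eq_weighted_sum(3)[OF G(3,4) ur that])
  have H: "H1_pair (G 0) (G 1)"
    unfolding G(1) by (rule H1_pair_cong_AE[OF _ G(3)[OF r] G(4)[OF r]]) (use h in \<open>simp add: represents_def\<close>)
  have repu: "represents u (G 0) (G 1)" using h H by (simp add: represents_def G(1))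
  obtain p y y' where p: "degree p \<le> N" "y = (\<lambda>x. G 0 x - laguerre_fun \<beta> p x)"
    "y' = (\<lambda>x. G 1 x - laguerre_fun \<beta> (pderiv p - smult (\<beta>/2) p) x)" "H1_pair y y'"
    and yE: "energy \<gamma> \<mu> y y' y y' \<le> (1 + 4 * \<gamma> / \<beta>\<^sup>2) * (4 ^ r * (\<beta> * real N) powr (1 - real r) * weighted_sum r \<beta> G)"
    by (rule energy_approximation[where \<mu>=\<mu>, OF r \<beta> N(1) \<gamma> H G(2) G(4) int])
  obtain q where q: "degree q \<le> N" "uN = laguerre_fun \<beta> q" using uN by (auto simp: spectral_solution_def X_space_iff)
  let ?d = "\<lambda>q. laguerre_fun \<beta> (pderiv q - smult (\<beta>/2) q)"
  note L = H1_pair_laguerre_fun[OF \<beta>]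
  define e where "e x = G 0 x - laguerre_fun \<beta> q x" for x
  define e' where "e' x = G 1 x - ?d q x" for x
  have repe: "represents (\<lambda>x. u x - uN x) e e'"
    unfolding e_def[abs_def] e'_def[abs_def] q(2) by (rule represents_diff[OF repu represents_self[OF L]])
  then have e: "H1_pair e e'" by (simp add: represents_def)
  have orth: "energy \<gamma> \<mu> e e' (laguerre_fun \<beta> s) (?d s) = 0" if "degree s \<le> N" for s
  proof -
    have s: "represents (laguerre_fun \<beta> s) (laguerre_fun \<beta> s) (?d s)" by (rule represents_self[OF L])
    have "laguerre_fun \<beta> s \<in> X_space \<beta> N" using that by (auto simp: X_space_iff)
    then have "bilinear_form \<gamma> \<mu> uN (laguerre_fun \<beta> s) = bilinear_form \<gamma> \<mu> u (laguerre_fun \<beta> s)"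
      using uN ueq[OF represents_H1[OF s]] by (simp add: spectral_solution_def)
    then have "energy \<gamma> \<mu> (laguerre_fun \<beta> q) (?d q) (laguerre_fun \<beta> s) (?d s) = energy \<gamma> \<mu> (G 0) (G 1) (laguerre_fun \<beta> s) (?d s)"
      unfolding q(2) represents_bilinear_form[OF repu s] represents_bilinear_form[OF represents_self[OF L] s] .
    then show ?thesis
      unfolding e_def[abs_def] e'_def[abs_def] energy_commute[of _ _ "\<lambda>x. G 0 x - laguerre_fun \<beta> q x"]
      by (subst energy_diff_right[OF L H L]) (simp add: energy_commute[of _ _ "laguerre_fun \<beta> s"])
  qed
  have "energy \<gamma> \<mu> e e' e e' \<le> energy \<gamma> \<mu> y y' y y'"
  proof (rule Galerkin_optimality[OF \<mu> \<gamma> e p(4)])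
    have "energy \<gamma> \<mu> e e' e e' = energy \<gamma> \<mu> e e' (G 0) (G 1)"
      using energy_diff_right[OF e H L, of \<gamma> \<mu> q] orth[OF q(1)] unfolding e_def[abs_def, symmetric] e'_def[abs_def, symmetric] by simp
    also have "\<dots> = energy \<gamma> \<mu> e e' y y'"
      using energy_diff_right[OF e H L, of \<gamma> \<mu> p] orth[OF p(1)] unfolding p(2,3) by simp
    finally show "energy \<gamma> \<mu> e e' e e' = energy \<gamma> \<mu> e e' y y'" .
  qed
  with yE have eE: "energy \<gamma> \<mu> e e' e e' \<le> 4 ^ r * (1 + 4 * \<gamma> / \<beta>\<^sup>2) * (\<beta> * real N) powr (1 - real r) * weighted_sum r \<beta> G"
    by (simp add: mult_ac)
  have "trace0 u - trace0 uN = trace0 (\<lambda>x. u x - uN x)"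
    using represents_trace0[OF repu] represents_trace0[OF repe] represents_trace0[OF represents_self[OF L]]
    by (simp add: q(2) e_def)
  then show ?energy using eE represents_energy_norm[OF repe, of \<mu> \<gamma>] by (simp add: bn1)

  assume \<gamma>': "\<gamma> > 0" and \<mu>': "\<mu> > 0"
  define S where "S = (LINT x|HL. (e x)\<^sup>2 * (1 / (1 + x)))"
  define m t where "m = 1 + 1 / (4 * \<mu>)" and "t = 1 + \<beta>\<^sup>2 / (4 * \<gamma>)"
  have mt: "m > 0" "t > 0" using \<mu>' \<gamma>' by (auto simp: m_def t_def add_pos_nonneg)
  obtain z where z: "H1_pair (z 0) (z 1)" "primitive (z 1) (z 2)" "z 2 \<in> borel_measurable HL"
    "\<And>i. i \<le> 2 \<Longrightarrow> integrable HL (\<lambda>x. (z i x)\<^sup>2 * x)"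
    "\<And>k l. H1_pair k l \<Longrightarrow> energy \<gamma> \<mu> (z 0) (z 1) k l = (LINT x|HL. e x / (1 + x) * k x)"
    and "weighted_sum 2 \<beta> z \<le> 4 * (LINT x|HL. (e x)\<^sup>2 * (1 / (1 + x))) * (1 + 1 / (4 * \<mu>)) * (1 + \<beta>\<^sup>2 / (4 * \<gamma>))\<^sup>2"
    by (rule dual_problem[OF e \<gamma>' \<mu>' \<beta>]) (rule that, assumption+)
  then have zw: "weighted_sum 2 \<beta> z \<le> 4 * S * m * t\<^sup>2" unfolding S_def m_def t_def by blast
  have zchain: "primitive (z i) (z (Suc i))" if "i < 2" for i
  proof -
    have "Suc 1 = 2" "primitive (z 0) (z (Suc 0))" using z(1) by (simp_all add: H1_pair_def)
    with z(2) that show ?thesis by (metis less_2_cases One_nat_def)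
  qed
  have zmeas: "z i \<in> borel_measurable HL" if "i \<le> 2" for i
  proof -
    from that consider "i = 0" | "i = 1" | "i = 2" by linarith
    then show ?thesis using z(1,3) by cases (auto simp: H1_pair_def sqint_def)
  qed
  have zint: "integrable HL (\<lambda>x. (z i x)\<^sup>2 * x ^ (2 - 1))" if "i \<le> 2" for i using z(4)[OF that] by simp
  have N4: "2 * 2 \<le> N" using N(2) by simp
  obtain p2 w w' where w: "degree p2 \<le> N" "w = (\<lambda>x. z 0 x - laguerre_fun \<beta> p2 x)"
    "w' = (\<lambda>x. z 1 x - laguerre_fun \<beta> (pderiv p2 - smult (\<beta>/2) p2) x)" "H1_pair w w'"
    and wE: "energy \<gamma> \<mu> w w' w w' \<le> (1 + 4 * \<gamma> / \<beta>\<^sup>2) * (4 ^ 2 * (\<beta> * real N) powr (1 - real 2) * weighted_sum 2 \<beta> z)"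
    by (rule energy_approximation[where \<mu>=\<mu>, OF _ \<beta> N4 \<gamma> z(1) zchain zmeas zint]) auto
  \<comment> \<open>Galerkin orthogonality allows z to be replaced by its approximation error w.\<close>
  have "S = energy \<gamma> \<mu> (z 0) (z 1) e e'"
    unfolding z(5)[OF e] S_def by (rule Bochner_Integration.integral_cong[OF refl]) (simp add: power2_eq_square)
  also have "\<dots> = energy \<gamma> \<mu> e e' w w'"
    using energy_diff_right[OF e z(1) L, of \<gamma> \<mu> p2] orth[OF w(1)] unfolding w(2,3)
    by (simp add: energy_commute[of _ _ "z 0"])
  finally have "S\<^sup>2 \<le> energy \<gamma> \<mu> e e' e e' * energy \<gamma> \<mu> w w' w w'"
    using energy_Cauchy_Schwarz[OF \<mu> \<gamma> e w(4)] by simp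
  also have "\<dots> \<le> (4 ^ r * (1 + 4 * \<gamma> / \<beta>\<^sup>2) * (\<beta> * real N) powr (1 - real r) * weighted_sum r \<beta> G)
     * ((1 + 4 * \<gamma> / \<beta>\<^sup>2) * (4 ^ 2 * (\<beta> * real N) powr (1 - real 2) * (4 * S * m * t\<^sup>2)))"
  proof (rule mult_mono[OF eE])
    show "energy \<gamma> \<mu> w w' w w' \<le> (1 + 4 * \<gamma> / \<beta>\<^sup>2) * (4 ^ 2 * (\<beta> * real N) powr (1 - real 2) * (4 * S * m * t\<^sup>2))"
      by (rule order_trans[OF wE], intro mult_left_mono zw) (use \<gamma> in auto)
    show "0 \<le> 4 ^ r * (1 + 4 * \<gamma> / \<beta>\<^sup>2) * (\<beta> * real N) powr (1 - real r) * weighted_sum r \<beta> G"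
      by (rule order_trans[OF energy_nonneg[OF \<mu> \<gamma>] eE])
  qed (rule energy_nonneg[OF \<mu> \<gamma>])
  \<comment> \<open>64 is the product of the constants 4^2 of the approximation of z and 4 of its norm bound.\<close>
  also have "\<dots> = S * (64 * 4 ^ r * ((1 + 4 * \<gamma> / \<beta>\<^sup>2)\<^sup>2 * m * t\<^sup>2) * ((\<beta> * real N) powr (1 - real r) * (\<beta> * real N) powr (1 - real 2)) * weighted_sum r \<beta> G)"
    by (simp add: power2_eq_square)
  also have "(\<beta> * real N) powr (1 - real r) * (\<beta> * real N) powr (1 - real 2) = (\<beta> * real N) powr (- real r)"
  proof -
    have "(1 - real r) + (1 - real 2) = - real r" by simp
    then show ?thesis by (simp only: powr_add[symmetric])
  qed
  finally have SS: "S * S \<le> S * (64 * 4 ^ r * ((1 + 4 * \<gamma> / \<beta>\<^sup>2)\<^sup>2 * m * t\<^sup>2) * (\<beta> * real N) powr (- real r) * weighted_sum r \<beta> G)"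
    by (simp add: power2_eq_square)
  define R where "R = 8 * 4 ^ r * (1 + 1 / sqrt (2 * \<mu>)) * (1 + \<beta>\<^sup>2 / (4 * \<gamma>))
               * (1 + 2 * sqrt \<gamma> / \<beta>)\<^sup>2 * (\<beta> * real N) powr (- (real r / 2)) * beta_norm r \<beta> u"
  have wsn: "weighted_sum r \<beta> G \<ge> 0" unfolding bn1[symmetric] by simp
  have R0: "R \<ge> 0" unfolding R_def using \<gamma> \<mu> \<beta> wsn by (simp add: bn2)
  have Snn: "S \<ge> 0" unfolding S_def by (rule integral_nonneg_AE) (auto intro!: AE_I2)
  have "64 * 4 ^ r * ((1 + 4 * \<gamma> / \<beta>\<^sup>2)\<^sup>2 * m * t\<^sup>2) * (\<beta> * real N) powr (- real r) * weighted_sum r \<beta> G \<le> R\<^sup>2"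
  proof -
    have "64 * 4 ^ r \<le> (8 * 4 ^ r :: real)\<^sup>2"
      using mult_left_mono[of "1::real" "4 ^ r" "4 ^ r"] by (simp add: power2_eq_square)
    moreover have "((\<beta> * real N) powr (- (real r / 2)))\<^sup>2 = (\<beta> * real N) powr (- real r)"
      by (simp add: power2_eq_square flip: powr_add)
    then have "R\<^sup>2 = (8 * 4 ^ r)\<^sup>2 * ((1 + 1 / sqrt (2 * \<mu>)) * (1 + \<beta>\<^sup>2 / (4 * \<gamma>)) * (1 + 2 * sqrt \<gamma> / \<beta>)\<^sup>2)\<^sup>2 * (\<beta> * real N) powr (- real r) * weighted_sum r \<beta> G"
      unfolding R_def bn1[symmetric] by (simp only: power_mult_distrib mult_ac)
    moreover have "0 \<le> (1 + 4 * \<gamma> / \<beta>\<^sup>2)\<^sup>2 * (1 + 1 / (4 * \<mu>)) * (1 + \<beta>\<^sup>2 / (4 * \<gamma>))\<^sup>2"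
      using \<mu>' by simp
    ultimately show ?thesis
      using final_constant[OF \<mu>' \<gamma>' \<beta>] wsn unfolding m_def t_def
      by (simp only:) (intro mult_right_mono mult_mono; simp)
  qed
  with SS Snn have "S * S \<le> S * R\<^sup>2" by (meson mult_left_mono order_trans)
  then have "S \<le> R\<^sup>2" using Snn by (cases "S = 0") (auto simp: mult_le_cancel_left)
  then have "sqrt S \<le> R" using R0 by (simp add: real_le_lsqrt)
  moreover have "wnorm (\<lambda>x. 1 / (1 + x)) (\<lambda>x. u x - uN x) = sqrt S"
  proof -
    have "(\<lambda>x::real. 1 / (1 + x)) \<in> borel_measurable HL" by (rule continuous_HL_measurable) (auto intro!: continuous_intros)
    then have "wnorm (\<lambda>x. 1 / (1 + x)) (\<lambda>x. u x - uN x) = wnorm (\<lambda>x. 1 / (1 + x)) e"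
      by (rule wnorm_cong_AE[OF represents_AE(1)[OF repe] represents_measurable(1,3)[OF repe]])
    then show ?thesis unfolding S_def wnorm_def .
  qed
  ultimately show "wnorm (\<lambda>x. 1 / (1 + x)) (\<lambda>x. u x - uN x)
           \<le> 8 * 4 ^ r * (1 + 1 / sqrt (2 * \<mu>)) * (1 + \<beta>\<^sup>2 / (4 * \<gamma>))
               * (1 + 2 * sqrt \<gamma> / \<beta>)\<^sup>2 * (\<beta> * real N) powr (- (real r / 2)) * beta_norm r \<beta> u"
    by (simp add: R_def)
qed

theorem theorem3:
  fixes r :: nat
  assumes "r \<ge> 1"
  shows "\<exists>c>0. \<forall>(\<beta>::real) (\<gamma>::real) (\<mu>::real) (\<eta>::real)
            (f :: (real \<Rightarrow> real) \<Rightarrow> real) (u :: real \<Rightarrow> real).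
          \<beta> > 0 \<longrightarrow> \<gamma> \<ge> 0 \<longrightarrow> \<mu> \<ge> 0 \<longrightarrow> f \<in> H1_dual \<longrightarrow>
          weak_solution \<gamma> \<mu> \<eta> f u \<longrightarrow> u \<in> sobolev r (\<lambda>x. x ^ (r - 1)) \<longrightarrow>
          (\<forall>\<^sub>F N in sequentially. \<forall>uN. spectral_solution \<beta> N \<gamma> \<mu> \<eta> f uN \<longrightarrow>
             \<mu> * \<bar>trace0 u - trace0 uN\<bar>\<^sup>2 + (L2norm (weak_deriv 1 (\<lambda>x. u x - uN x)))\<^sup>2
                 + \<gamma> * (L2norm (\<lambda>x. u x - uN x))\<^sup>2
               \<le> c * (1 + 4 * \<gamma> / \<beta>\<^sup>2) * (\<beta> * real N) powr (1 - real r) * (beta_norm r \<beta> u)\<^sup>2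
             \<and> (\<gamma> > 0 \<and> \<mu> > 0 \<longrightarrow>
                 wnorm (\<lambda>x. 1 / (1 + x)) (\<lambda>x. u x - uN x)
                   \<le> c * (1 + 1 / sqrt (2 * \<mu>)) * (1 + \<beta>\<^sup>2 / (4 * \<gamma>))
                       * (1 + 2 * sqrt \<gamma> / \<beta>)\<^sup>2 * (\<beta> * real N) powr (- (real r / 2))
                       * beta_norm r \<beta> u))"
proof (intro exI[of _ "8 * 4 ^ r :: real"] conjI allI impI)
  fix \<beta> \<gamma> \<mu> \<eta> :: real and f :: "(real \<Rightarrow> real) \<Rightarrow> real" and u :: "real \<Rightarrow> real"
  assume asm: "\<beta> > 0" "\<gamma> \<ge> 0" "\<mu> \<ge> 0" "f \<in> H1_dual" "weak_solution \<gamma> \<mu> \<eta> f u" "u \<in> sobolev r (\<lambda>x. x ^ (r - 1))"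
  show "\<forall>\<^sub>F N in sequentially. \<forall>uN. spectral_solution \<beta> N \<gamma> \<mu> \<eta> f uN \<longrightarrow>
             \<mu> * \<bar>trace0 u - trace0 uN\<bar>\<^sup>2 + (L2norm (weak_deriv 1 (\<lambda>x. u x - uN x)))\<^sup>2
                 + \<gamma> * (L2norm (\<lambda>x. u x - uN x))\<^sup>2
               \<le> 8 * 4 ^ r * (1 + 4 * \<gamma> / \<beta>\<^sup>2) * (\<beta> * real N) powr (1 - real r) * (beta_norm r \<beta> u)\<^sup>2
             \<and> (\<gamma> > 0 \<and> \<mu> > 0 \<longrightarrow>
                 wnorm (\<lambda>x. 1 / (1 + x)) (\<lambda>x. u x - uN x)
                   \<le> 8 * 4 ^ r * (1 + 1 / sqrt (2 * \<mu>)) * (1 + \<beta>\<^sup>2 / (4 * \<gamma>))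
                       * (1 + 2 * sqrt \<gamma> / \<beta>)\<^sup>2 * (\<beta> * real N) powr (- (real r / 2))
                       * beta_norm r \<beta> u)"
    using eventually_ge_at_top[of "2 * r + 4"]
  proof eventually_elim
    case (elim N)
    then have N: "N \<ge> 2 * r" "N \<ge> 4" by auto
    show ?case
    proof (intro allI impI conjI)
      fix uN assume uN: "spectral_solution \<beta> N \<gamma> \<mu> \<eta> f uN"
      note B = spectral_error_bounds[OF assms asm(1,2,3,5,6) N uN]
      have "4 ^ r * (1 + 4 * \<gamma> / \<beta>\<^sup>2) * (\<beta> * real N) powr (1 - real r) * (beta_norm r \<beta> u)\<^sup>2
        \<le> 8 * 4 ^ r * (1 + 4 * \<gamma> / \<beta>\<^sup>2) * (\<beta> * real N) powr (1 - real r) * (beta_norm r \<beta> u)\<^sup>2"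
        using asm(2) by (intro mult_right_mono) auto
      then show "\<mu> * \<bar>trace0 u - trace0 uN\<bar>\<^sup>2 + (L2norm (weak_deriv 1 (\<lambda>x. u x - uN x)))\<^sup>2
                 + \<gamma> * (L2norm (\<lambda>x. u x - uN x))\<^sup>2
               \<le> 8 * 4 ^ r * (1 + 4 * \<gamma> / \<beta>\<^sup>2) * (\<beta> * real N) powr (1 - real r) * (beta_norm r \<beta> u)\<^sup>2"
        by (rule order_trans[OF B(1)])
      show "wnorm (\<lambda>x. 1 / (1 + x)) (\<lambda>x. u x - uN x)
                   \<le> 8 * 4 ^ r * (1 + 1 / sqrt (2 * \<mu>)) * (1 + \<beta>\<^sup>2 / (4 * \<gamma>))
                       * (1 + 2 * sqrt \<gamma> / \<beta>)\<^sup>2 * (\<beta> * real N) powr (- (real r / 2)) * beta_norm r \<beta> u"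
        if "\<gamma> > 0 \<and> \<mu> > 0" using B(2) that by blast
    qed
  qed
qed simp

end
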